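(* Let $D$ be a weakly locally finite division ring with center $F$ and let $G$ be an almost subnormal subgroup of $D^*$. If $G$ is soluble-by-periodic, then $G$ is central, i.e. $G\subseteq F^*$.
   Context: A division ring $D$ is weakly locally finite if every finite subset of $D$ generates a division subring that is finite-dimensional over its own center. A group $G$ is soluble-by-periodic if it has a soluble normal subgroup $H$ such that every element of $G/H$ has finite order. A subgroup $H$ of a group $K$ is almost subnormal in $K$ if there is a chain of subgroups $H=H_r\le H_{r-1}\le\cdots\le H_1=K$ such that for each $1<i\le r$, either $H_i$ is normal in $H_{i-1}$ or $H_i$ has finite index in $H_{i-1}$. *)

theory Defs
  imports "HOL-Algebra.Algebra"
begin

definition units_group :: "('a::division_ring) monoid" where
  "units_group = \<lparr>carrier = - {0}, monoid.mult = (*), one = 1\<rparr>"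

inductive_set divsubring_gen :: "('a::division_ring) set \<Rightarrow> 'a set" for S where
  gen: "x \<in> S \<Longrightarrow> x \<in> divsubring_gen S"
| zero: "0 \<in> divsubring_gen S"
| one: "1 \<in> divsubring_gen S"
| add: "x \<in> divsubring_gen S \<Longrightarrow> y \<in> divsubring_gen S \<Longrightarrow> x + y \<in> divsubring_gen S"
| neg: "x \<in> divsubring_gen S \<Longrightarrow> - x \<in> divsubring_gen S"
| mult: "x \<in> divsubring_gen S \<Longrightarrow> y \<in> divsubring_gen S \<Longrightarrow> x * y \<in> divsubring_gen S"
| inv: "x \<in> divsubring_gen S \<Longrightarrow> inverse x \<in> divsubring_gen S"

definition center_of :: "('a::division_ring) set \<Rightarrow> 'a set" where
  "center_of E = {x \<in> E. \<forall>y\<in>E. x * y = y * x}"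

definition fin_dim_over_center :: "('a::division_ring) set \<Rightarrow> bool" where
  "fin_dim_over_center E \<longleftrightarrow>
     (\<exists>B. finite B \<and> B \<subseteq> E \<and>
        (\<forall>x\<in>E. \<exists>c. (\<forall>b\<in>B. c b \<in> center_of E) \<and> x = (\<Sum>b\<in>B. c b * b)))"

definition weakly_locally_finite :: "('a::division_ring) itself \<Rightarrow> bool" where
  "weakly_locally_finite _ \<longleftrightarrow>
     (\<forall>S::'a set. finite S \<longrightarrow> fin_dim_over_center (divsubring_gen S))"

definition almost_subnormal :: "('a, 'b) monoid_scheme \<Rightarrow> 'a set \<Rightarrow> 'a set \<Rightarrow> bool" where
  "almost_subnormal M H K \<longleftrightarrow>
     (\<exists>(r::nat) (Hs :: nat \<Rightarrow> 'a set). 1 \<le> r \<and> Hs r = H \<and> Hs 1 = K \<and>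
        (\<forall>i. 1 \<le> i \<and> i \<le> r \<longrightarrow> subgroup (Hs i) M) \<and>
        (\<forall>i. 1 < i \<and> i \<le> r \<longrightarrow> Hs i \<subseteq> Hs (i - 1) \<and>
           (Hs i \<lhd> M\<lparr>carrier := Hs (i - 1)\<rparr> \<or>
            finite (rcosets\<^bsub>M\<lparr>carrier := Hs (i - 1)\<rparr>\<^esub> (Hs i)))))"

definition soluble_by_periodic :: "('a, 'b) monoid_scheme \<Rightarrow> 'a set \<Rightarrow> bool" where
  "soluble_by_periodic M G \<longleftrightarrow>
     (\<exists>N. N \<lhd> M\<lparr>carrier := G\<rparr> \<and> solvable (M\<lparr>carrier := N\<rparr>) \<and>
          (\<forall>g\<in>G. \<exists>n::nat. n \<ge> 1 \<and> g [^]\<^bsub>M\<^esub> n \<in> N))"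

end

theory Submission
  imports Defs "HOL-Number_Theory.Residues" "Jordan_Normal_Form.Determinant"
begin

text \<open>Given \<open>g \<in> G\<close> and \<open>d \<in> D\<close>, work in the division subring \<open>E\<close> generated by \<open>g\<close> and \<open>d\<close>, which has finite
  dimension over its center \<open>F\<close>. If \<open>F\<close> has positive characteristic and every \<open>x \<noteq> 0\<close> in \<open>F\<close> has its
  inverse in the ring generated by \<open>x\<close>, then \<open>g\<close> and \<open>d\<close> lie in a finite subring and commute by
  Wedderburn's theorem.

  Otherwise \<open>F\<close> has a proper valuation ring \<open>V\<close>, and the \<open>V\<close>-lattices make \<open>E\<close> a Hausdorff nondiscrete
  topological ring in which no nontrivial torsion is close to 1. In this topology:
  if the elements of \<open>H\<close> near 1 commute with \<open>g\<close>, then so do the elements of \<open>K\<close> near 1, when \<open>H\<close> has finite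
  index in \<open>K\<close> (some coset of \<open>H\<close> accumulates at 1) and also when \<open>H\<close> is normal in \<open>K\<close> and contains \<open>g\<close>
  (for \<open>t\<close> near 1 in \<open>K\<close>, \<open>c = [t, g]\<close> commutes with \<open>g\<close> and \<open>c * g\<close> is a root near \<open>g\<close> of an algebraic equation
  satisfied by \<open>g\<close>, so \<open>c = 1\<close>).
  Climbing from \<open>G\<close> to \<open>D\<^sup>*\<close>, one finds that \<open>g\<close> is central in \<open>E\<close> as soon as the elements of \<open>G\<close> near 1
  commute with \<open>g\<close>. This is so if all \<open>[t, g]\<close> are central, which settles the solvable case by induction on
  the derived length, and also if some power of every element of \<open>G\<close> is central: then some power of
  \<open>[t, g]\<close> is central and has determinant 1 over \<open>F\<close>, so \<open>[t, g]\<close> is torsion.\<close>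

section \<open>Finite subrings of division rings\<close>

text \<open>The chain climbs to all nonzero elements of the division ring, whereas only subrings
  such as \<open>E\<close> are finite-dimensional, and \<open>G\<close> need not lie in any of them.
  Commuting with \<open>g\<close> near 1 is a property that sees only the trace of a subgroup on
  \<open>E\<close>, and it can be carried upwards through steps of finite index as well, where
  centrality of \<open>g\<close> in the subgroup itself is not visibly inherited. No completion of
  \<open>E\<close> is formed: every limit argument is the choice of a small enough neighbourhood.
  Both cases come from one question: is there a nonzero \<open>x\<close> in \<open>F\<close> whose
  inverse escapes the ring generated by \<open>x\<close>? If so, Zorn's lemma gives a subring of
  \<open>F\<close> maximal without that inverse, and it is a valuation ring; in characteristic 0, 2
  is always such an \<open>x\<close>. If not, in positive characteristic, inverses are integral over
  the prime field, so finitely many coordinates and structure constants lie in a finite subring of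
  \<open>F\<close>, over which \<open>g\<close> and \<open>d\<close> generate a finite ring.\<close>

lemma one_plus_power:
  fixes x :: "'a::ring_1"
  shows "(1 + x) ^ n = (\<Sum>k\<le>n. of_nat (n choose k) * x ^ k)"
proof (induction n)
  case (Suc n)
  have "(1 + x) ^ Suc n = (\<Sum>k\<le>n. of_nat (n choose k) * x ^ k) + (\<Sum>k\<le>n. of_nat (n choose k) * x ^ Suc k)"
    by (simp only: power_Suc Suc.IH distrib_right mult_1_left)
       (simp add: sum_distrib_left mult_of_nat_commute mult.assoc)
  also have "(\<Sum>k\<le>n. of_nat (n choose k) * x ^ k) = (\<Sum>k\<le>Suc n. of_nat (n choose k) * x ^ k)"
    by (simp add: binomial_eq_0)
  also have "\<dots> = 1 + (\<Sum>k\<le>n. of_nat (n choose Suc k) * x ^ Suc k)"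
    by (subst sum.atMost_Suc_shift) simp
  also have "1 + (\<Sum>k\<le>n. of_nat (n choose Suc k) * x ^ Suc k) + (\<Sum>k\<le>n. of_nat (n choose k) * x ^ Suc k)
     = 1 + (\<Sum>k\<le>n. of_nat (Suc n choose Suc k) * x ^ Suc k)"
    by (simp add: sum.distrib[symmetric] algebra_simps)
  also have "\<dots> = (\<Sum>k\<le>Suc n. of_nat (Suc n choose k) * x ^ k)"
    by (subst sum.atMost_Suc_shift) simp
  finally show ?case .
qed simp

text \<open>For the characteristic \<open>p\<close> the inner binomial coefficients vanish, so
  \<open>1 = (1 + (z - 1)) ^ p = 1 + (z - 1) ^ p\<close>, and a division ring has no
  nilpotents.\<close>

lemma power_CHAR_one_imp_one:
  fixes z :: "'a::division_ring"
  assumes "Factorial_Ring.prime CHAR('a)" and "z ^ CHAR('a) = 1"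
  shows "z = 1"
proof -
  let ?p = "CHAR('a)" and ?x = "z - 1"
  have p: "?p > 0"
    using assms(1) by (simp add: prime_gt_0_nat)
  have van: "of_nat (?p choose k) * ?x ^ k = 0" if "k \<in> {..?p} - {0, ?p}" for k
  proof -
    have "?p dvd ?p choose k"
      using that assms(1) by (intro dvd_choose_prime) auto
    then show ?thesis by (simp add: of_nat_eq_0_iff_char_dvd)
  qed
  have "1 = (1 + ?x) ^ ?p" using assms by simp
  also have "\<dots> = (\<Sum>k\<in>{0, ?p}. of_nat (?p choose k) * ?x ^ k)"
    unfolding one_plus_power by (rule sum.mono_neutral_right) (use van in auto)
  also have "\<dots> = 1 + ?x ^ ?p" using p by simp
  finally show ?thesis by simp
qed

lemma sum_powers_eq_zero:
  fixes z :: "'a::division_ring"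
  assumes "z ^ n = 1" "z \<noteq> 1"
  shows "(\<Sum>i<n. z ^ i) = 0"
proof -
  have "(z - 1) * (\<Sum>i<n. z ^ i) = z ^ n - 1" for n
    by (induction n) (simp_all add: algebra_simps)
  with assms show ?thesis by (metis cancel_comm_monoid_add_class.diff_cancel mult_eq_0_iff right_minus_eq)
qed

lemma commute_power:
  fixes a b :: "'a::monoid_mult"
  shows "a * b = b * a \<Longrightarrow> a * b ^ n = b ^ n * a"
  by (simp add: power_commuting_commutes)

text \<open>A discrete Fourier transform. Right multiplication by \<open>h\<close> has
  \<open>N\<close>-th power 1 and commutes with left multiplication by \<open>u\<close>; up to the
  factor \<open>N\<close>, \<open>y j\<close> is the component of \<open>x\<close> on which right
  multiplication by \<open>h\<close> agrees with left multiplication by the inverse of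
  \<open>u ^ j\<close>.\<close>

lemma eigen_decomposition:
  fixes u h x :: "'a::division_ring"
  assumes "u ^ N = 1" "h ^ N = 1" "\<And>i. 0 < i \<Longrightarrow> i < N \<Longrightarrow> u ^ i \<noteq> 1"
  defines "y \<equiv> \<lambda>j. \<Sum>i<N. u ^ (j * i) * x * h ^ i"
  shows "u ^ j * y j * h = y j" and "(\<Sum>j<N. y j) = of_nat N * x"
proof -
  have "u ^ j * y j * h = (\<Sum>i<N. u ^ (j * Suc i) * x * h ^ Suc i)"
    unfolding y_def by (simp add: sum_distrib_left sum_distrib_right power_add mult.assoc power_commutes)
  also have "\<dots> = (\<Sum>i<Suc N. u ^ (j * i) * x * h ^ i) - x"
    by (subst sum.lessThan_Suc_shift) simp
  also have "\<dots> = y j"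
  proof -
    have "u ^ (j * N) = 1"
      using assms(1) by (metis mult.commute power_mult power_one)
    then show ?thesis
      unfolding y_def by (simp add: assms(2))
  qed
  finally show "u ^ j * y j * h = y j" .
  have z: "(\<Sum>j<N. u ^ (j * i)) = 0" if "0 < i" "i < N" for i
  proof -
    have "(u ^ i) ^ N = 1"
      using assms(1) by (metis mult.commute power_mult power_one)
    moreover have "(u ^ i) ^ j = u ^ (j * i)" for j
      by (metis mult.commute power_mult)
    ultimately show ?thesis
      using sum_powers_eq_zero[of "u ^ i" N] assms(3)[OF that] by simp
  qed
  have "(\<Sum>j<N. y j) = (\<Sum>i<N. (\<Sum>j<N. u ^ (j * i)) * x * h ^ i)"
    unfolding y_def by (subst sum.swap) (simp add: sum_distrib_right)
  also have "\<dots> = (\<Sum>i<N. if i = 0 then of_nat N * x else 0)"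
    by (rule sum.cong) (auto simp: z)
  also have "\<dots> = of_nat N * x"
    by (subst sum.delta) auto
  finally show "(\<Sum>j<N. y j) = of_nat N * x" .
qed

definition is_subring :: "'a::ring_1 set \<Rightarrow> bool" where
  "is_subring S \<longleftrightarrow> 1 \<in> S \<and> (\<forall>x\<in>S. \<forall>y\<in>S. x - y \<in> S \<and> x * y \<in> S)"

lemma is_subringD:
  assumes "is_subring S"
  shows "0 \<in> S" "1 \<in> S" "x \<in> S \<Longrightarrow> - x \<in> S" "x \<in> S \<Longrightarrow> y \<in> S \<Longrightarrow> x - y \<in> S"
    "x \<in> S \<Longrightarrow> y \<in> S \<Longrightarrow> x + y \<in> S" "x \<in> S \<Longrightarrow> y \<in> S \<Longrightarrow> x * y \<in> S"
    "x \<in> S \<Longrightarrow> x ^ n \<in> S" "of_nat n \<in> S"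
proof -
  show one: "1 \<in> S" and zero: "0 \<in> S"
    and mult: "\<And>x y. x \<in> S \<Longrightarrow> y \<in> S \<Longrightarrow> x * y \<in> S"
    and diff: "\<And>x y. x \<in> S \<Longrightarrow> y \<in> S \<Longrightarrow> x - y \<in> S"
    using assms unfolding is_subring_def by (auto, metis diff_self)
  show neg: "\<And>x. x \<in> S \<Longrightarrow> - x \<in> S"
    using diff[OF zero] by simp
  show add: "\<And>x y. x \<in> S \<Longrightarrow> y \<in> S \<Longrightarrow> x + y \<in> S"
    using diff[OF _ neg] by simp
  show "\<And>x. x \<in> S \<Longrightarrow> x ^ n \<in> S" by (induction n) (auto intro: one mult)
  show "of_nat n \<in> S" by (induction n) (auto intro: zero one add)
qed

lemma is_subring_sum:
  assumes "is_subring S" "\<And>i. i \<in> I \<Longrightarrow> f i \<in> S"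
  shows "sum f I \<in> S"
  using assms(2) by (induction I rule: infinite_finite_induct) (auto intro: is_subringD[OF assms(1)])

definition commutant :: "'a::ring_1 set \<Rightarrow> 'a set \<Rightarrow> 'a set" where
  "commutant S T = {x \<in> S. \<forall>t\<in>T. x * t = t * x}"

lemma commutantD: "x \<in> commutant S T \<Longrightarrow> x \<in> S" "x \<in> commutant S T \<Longrightarrow> t \<in> T \<Longrightarrow> x * t = t * x"
  by (auto simp: commutant_def)

lemma is_subring_commutant:
  assumes "is_subring S" shows "is_subring (commutant S T)"
  unfolding is_subring_def commutant_def
  by (auto intro: is_subringD[OF assms] simp: algebra_simps) (metis mult.assoc)

lemma finite_power_one:
  fixes S :: "'a::division_ring set"
  assumes "finite S" "is_subring S" "x \<in> S" "x \<noteq> 0"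
  shows "\<exists>n>0. x ^ n = 1"
proof -
  have "\<not> inj (\<lambda>n::nat. x ^ n)"
    using assms(1) is_subringD(7)[OF assms(2,3)]
    by (metis finite_imageD finite_subset image_subsetI infinite_UNIV_nat)
  then obtain m n :: nat where "x ^ m = x ^ n" "m < n"
    unfolding inj_def by (metis nat_neq_iff)
  then have "x ^ m * x ^ (n - m) = x ^ m * 1"
    by (metis le_add_diff_inverse less_imp_le mult_1_right power_add)
  then have "x ^ (n - m) = 1" using assms(4) by (metis mult_left_cancel power_not_zero)
  then show ?thesis using \<open>m < n\<close> by (metis zero_less_diff)
qed

lemma finite_inverse_mem:
  fixes S :: "'a::division_ring set"
  assumes "finite S" "is_subring S" "x \<in> S"
  shows "inverse x \<in> S"
proof (cases "x = 0")
  case False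
  then obtain n where n: "n > 0" "x ^ n = 1" using finite_power_one assms by metis
  then have "x * x ^ (n - 1) = 1" by (metis power_minus_mult power_commutes)
  then have "inverse x = x ^ (n - 1)" by (metis inverse_unique)
  then show ?thesis using is_subringD(7)[OF assms(2,3)] by simp
qed (use is_subringD(1)[OF assms(2)] in simp)

lemma prime_CHAR_division_ring:
  assumes "CHAR('a::division_ring) > 0"
  shows "Factorial_Ring.prime CHAR('a)"
  unfolding prime_nat_iff'
proof (intro conjI ballI notI)
  have "CHAR('a) \<noteq> 1" using of_nat_CHAR[where 'a='a] by (metis of_nat_1 zero_neq_one)
  with assms show "CHAR('a) > 1" by linarith
next
  fix k assume k: "k \<in> {2..<CHAR('a)}" "k dvd CHAR('a)"
  then obtain m where m: "CHAR('a) = k * m" by blast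
  then have "of_nat k * of_nat m = (0::'a)"
    by (metis of_nat_CHAR of_nat_mult)
  then have "CHAR('a) dvd k \<or> CHAR('a) dvd m"
    by (simp add: of_nat_eq_0_iff_char_dvd[symmetric])
  moreover have "0 < k" "0 < m" "k < CHAR('a)" "m < CHAR('a)"
    using k m assms by auto
  ultimately show False by (metis nat_dvd_not_less)
qed

lemma finite_subring_CHAR:
  fixes S :: "'a::division_ring set"
  assumes "finite S" "is_subring S"
  shows "Factorial_Ring.prime CHAR('a)"
proof -
  have "\<not> inj (of_nat :: nat \<Rightarrow> 'a)"
    using assms(1) is_subringD(8)[OF assms(2)]
    by (metis finite_imageD finite_subset image_subsetI infinite_UNIV_nat)
  then obtain m n :: nat where mn: "of_nat m = (of_nat n :: 'a)" "m < n"
    unfolding inj_def by (metis nat_neq_iff)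
  then have "of_nat (n - m) = (0::'a)"
    by (simp add: of_nat_diff)
  then have "CHAR('a) > 0"
    using mn(2) CHAR_pos_iff by (metis zero_less_diff)
  then show ?thesis by (rule prime_CHAR_division_ring)
qed

text \<open>Makes the factor \<open>N\<close> of \<open>eigen_decomposition\<close> cancellable: if
  \<open>N = CHAR('a) * m\<close>, then \<open>u ^ m\<close> would be torsion of order the
  characteristic.\<close>

lemma order_nonzero:
  fixes u :: "'a::division_ring"
  assumes "Factorial_Ring.prime CHAR('a)" "u ^ N = 1" "N > 0" "\<And>i. 0 < i \<Longrightarrow> i < N \<Longrightarrow> u ^ i \<noteq> 1"
  shows "of_nat N \<noteq> (0::'a)"
proof
  assume "of_nat N = (0::'a)"
  then obtain m where m: "N = CHAR('a) * m"
    by (auto simp: of_nat_eq_0_iff_char_dvd)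
  have "(u ^ m) ^ CHAR('a) = 1"
    using assms(2) m by (simp add: power_mult[symmetric] mult.commute)
  then have "u ^ m = 1" by (rule power_CHAR_one_imp_one[OF assms(1)])
  moreover have "0 < m" "m < N"
    using m assms(1,3) prime_gt_1_nat[OF assms(1)] by auto
  ultimately show False using assms(4) by blast
qed

section \<open>Wedderburn's theorem through a minimal noncommutative finite subring\<close>

locale minimal_noncommutative =
  fixes S :: "'a::division_ring set"
  assumes finite_S: "finite S" and subring_S: "is_subring S"
    and noncomm: "\<exists>x\<in>S. \<exists>y\<in>S. x * y \<noteq> y * x"
    and proper_comm: "\<And>T x y. T \<subset> S \<Longrightarrow> is_subring T \<Longrightarrow> x \<in> T \<Longrightarrow> y \<in> T \<Longrightarrow> x * y = y * x"
begin

abbreviation "Z \<equiv> commutant S S"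

lemmas S_closed = is_subringD[OF subring_S] finite_inverse_mem[OF finite_S subring_S]

lemma ZS: "z \<in> Z \<Longrightarrow> z \<in> S" and Z_comm: "z \<in> Z \<Longrightarrow> x \<in> S \<Longrightarrow> z * x = x * z"
  by (auto simp: commutant_def)

lemma subring_Z: "is_subring Z" and finite_Z: "finite Z"
  using is_subring_commutant[OF subring_S] finite_S by (auto simp: commutant_def)

lemmas Z_closed = is_subringD[OF subring_Z] finite_inverse_mem[OF finite_Z subring_Z]

text \<open>The centralizer of a noncentral element is a proper subring, so minimality applies to
  it.\<close>

lemma centralizer_comm:
  assumes "a \<in> S" "a \<notin> Z" "x \<in> S" "y \<in> S" "x * a = a * x" "y * a = a * y"
  shows "x * y = y * x"
proof (rule proper_comm)
  obtain t where "t \<in> S" "a * t \<noteq> t * a" using assms(1,2) by (auto simp: commutant_def)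
  then have "t \<in> S - commutant S {a}" by (auto simp: commutant_def)
  then show "commutant S {a} \<subset> S" by (auto simp: commutant_def)
  show "is_subring (commutant S {a})" by (rule is_subring_commutant[OF subring_S])
qed (use assms in \<open>auto simp: commutant_def\<close>)

lemma prime_CHAR: "Factorial_Ring.prime CHAR('a)"
  using finite_subring_CHAR[OF finite_S subring_S] .

text \<open>Decompose 1 with respect to right multiplication by \<open>h\<close>. The components
  commute with \<open>h\<close>, so a nonzero one turns \<open>u ^ j * y j * h = y j\<close> into
  \<open>u ^ j * h = 1\<close>: the \<open>N\<close>-th roots of 1 in \<open>S\<close> are exhausted
  by the powers of \<open>u\<close>.\<close>

lemma root_of_unity_central:
  assumes u: "u \<in> Z" "u ^ N = 1" "N > 0" "\<And>i. 0 < i \<Longrightarrow> i < N \<Longrightarrow> u ^ i \<noteq> 1"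
    and h: "h \<in> S" "h ^ N = 1"
  shows "h \<in> Z"
proof -
  define y where "y j = (\<Sum>i<N. u ^ (j * i) * 1 * h ^ i)" for j
  note eig = eigen_decomposition[where u = u and N = N and h = h and x = 1, folded y_def, OF u(2) h(2) u(4)]
  have "(\<Sum>j<N. y j) \<noteq> 0"
    using eig(2) order_nonzero[OF prime_CHAR u(2-4)] by simp
  then obtain j where j: "y j \<noteq> 0"
    by (metis (no_types, lifting) sum.neutral)
  have comm: "y j * h = h * y j"
    unfolding y_def sum_distrib_left sum_distrib_right
    by (rule sum.cong) (use Z_comm[OF Z_closed(7)[OF u(1)] h(1)] in \<open>simp_all add: mult.assoc power_commutes, simp add: mult.assoc[symmetric]\<close>)
  have "(u ^ j * h) * y j = 1 * y j"
    using eig(1)[of j] comm by (simp add: mult.assoc)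
  then have "u ^ j * h = 1" using j by (metis mult_right_cancel)
  then have "h = inverse (u ^ j)" by (metis inverse_unique)
  then show ?thesis using Z_closed(9)[OF Z_closed(7)[OF u(1)]] by simp
qed

text \<open>Fourier transform with \<open>u = h = a\<close> of an \<open>x\<close> that does not
  commute with \<open>a\<close>. If all components commuted with \<open>a\<close>, so would
  \<open>of_nat N * x\<close>; one that does not satisfies
  \<open>y j * a = a ^ (N - j) * y j\<close>.\<close>

lemma conj_to_power:
  assumes a: "a \<in> S" "a \<notin> Z"
  obtains y k where "y \<in> S" "y \<noteq> 0" "y * a = a ^ k * y" "a ^ k \<noteq> a"
proof -
  obtain x where x: "x \<in> S" "x * a \<noteq> a * x"
    using a by (auto simp: commutant_def)
  have "a \<noteq> 0" using a Z_closed(1) by auto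
  define N where "N = (LEAST n. n > 0 \<and> a ^ n = 1)"
  have N: "N > 0" "a ^ N = 1"
    using LeastI_ex[OF finite_power_one[OF finite_S subring_S a(1) \<open>a \<noteq> 0\<close>]] unfolding N_def by auto
  have min: "a ^ i \<noteq> 1" if "0 < i" "i < N" for i
    using not_less_Least[of i "\<lambda>n. n > 0 \<and> a ^ n = 1"] that unfolding N_def by auto
  define y where "y j = (\<Sum>i<N. a ^ (j * i) * x * a ^ i)" for j
  note eig = eigen_decomposition[where u = a and N = N and h = a and x = x, folded y_def, OF N(2) N(2) min]
  have yS: "y j \<in> S" for j
    unfolding y_def by (intro is_subring_sum[OF subring_S] S_closed a x)
  have "\<exists>j<N. y j \<noteq> 0 \<and> y j * a \<noteq> a * y j"
  proof (rule ccontr)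
    assume "\<not> ?thesis"
    then have "(\<Sum>j<N. y j) * a = a * (\<Sum>j<N. y j)"
      unfolding sum_distrib_left sum_distrib_right by (intro sum.cong) auto
    then have "of_nat N * (x * a) = a * (of_nat N * x)"
      using eig(2) by (simp add: mult.assoc)
    also have "\<dots> = of_nat N * (a * x)"
      by (metis mult.assoc mult_of_nat_commute)
    finally have "of_nat N * (x * a - a * x) = 0"
      by (simp add: right_diff_distrib)
    then show False
      using x(2) order_nonzero[OF prime_CHAR N(2,1) min] by simp
  qed
  then obtain j where j: "j < N" "y j \<noteq> 0" "y j * a \<noteq> a * y j" by blast
  have "a ^ (N - j) * (a ^ j * y j * a) = (a ^ (N - j) * a ^ j) * (y j * a)"
    by (simp add: mult.assoc)
  also have "a ^ (N - j) * a ^ j = 1"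
    using j(1) N(2) by (simp add: power_add[symmetric])
  finally have "y j * a = a ^ (N - j) * y j"
    using eig(1)[of j] by simp
  then show thesis
    using that[OF yS j(2)] j(3) by metis
qed

end

lemma finite_field_generator:
  fixes Z :: "'a::division_ring set"
  assumes "finite Z" "is_subring Z" "\<And>x y. x \<in> Z \<Longrightarrow> y \<in> Z \<Longrightarrow> x * y = y * x"
  obtains g where "g \<in> Z" "g \<noteq> 0" "\<And>z. z \<in> Z \<Longrightarrow> z \<noteq> 0 \<Longrightarrow> \<exists>i::nat. z = g ^ i"
proof -
  note cl = is_subringD[OF assms(2)] finite_inverse_mem[OF assms(1,2)]
  define R :: "'a ring" where "R = \<lparr>carrier = Z, monoid.mult = (*), one = 1, ring.zero = 0, add = (+)\<rparr>"
  have "cring R"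
    by (rule cringI, rule abelian_groupI, unfold_locales)
       (auto simp: R_def cl assms(3) algebra_simps Units_def intro: bexI[of _ "- x" for x])
  then interpret cring R .
  have "field R"
  proof (rule cring_fieldI)
    show "Units R = carrier R - {\<zero>\<^bsub>R\<^esub>}"
      unfolding Units_def R_def using cl(9) 
      by (auto intro!: bexI[of _ "inverse x" for x])
  qed
  then interpret field R .
  have pow: "a [^]\<^bsub>R\<^esub> (i::nat) = a ^ i" for a i
    by (induction i) (simp_all add: R_def power_commutes)
  obtain a where a: "a \<in> carrier (mult_of R)" "carrier (mult_of R) = {a [^]\<^bsub>R\<^esub> i | i::nat. i \<in> UNIV}"
    using finite_field_mult_group_has_gen assms(1) unfolding R_def by auto
  have C: "carrier (mult_of R) = Z - {0}" by (simp add: R_def)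
  show thesis
    by (rule that[of a]) (use a C pow in auto)
qed

lemma power_eq_one_coprime:
  fixes l :: "'a::division_ring"
  assumes "Factorial_Ring.prime r" "l ^ r = 1" "l \<noteq> 1"
  shows "l ^ i = 1 \<longleftrightarrow> r dvd i"
proof
  assume i: "l ^ i = 1"
  show "r dvd i"
  proof (rule ccontr)
    assume "\<not> r dvd i"
    then have "coprime i r" using assms(1) by (metis coprime_commute prime_imp_coprime)
    moreover have "r \<noteq> 1" using assms(1) by auto
    ultimately obtain x y where "i * x = Suc (r * y)"
      using coprime_bezout_strong[of i r] by (metis Suc_eq_plus1)
    then have "l ^ (i * x) = l ^ (r * y) * l" by (simp add: power_commutes)
    then show False using i assms(2,3) by (simp add: power_mult)
  qed
qed (use assms(2) in \<open>auto simp: power_mult\<close>)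

lemma twisted_powers:
  fixes a b l :: "'a::monoid_mult"
  assumes "b * a = l * a * b" "l * a = a * l" "l * b = b * l"
  shows "b * a ^ n = l ^ n * a ^ n * b" "b ^ m * a ^ n = l ^ (m * n) * a ^ n * b ^ m"
proof -
  have la: "a * l ^ k = l ^ k * a" and lb: "b * l ^ k = l ^ k * b" for k
    using assms(2,3) by (metis commute_power)+
  show *: "b * a ^ n = l ^ n * a ^ n * b" for n
  proof (induction n)
    case (Suc n)
    have "b * a ^ Suc n = l * a * (b * a ^ n)"
      by (simp add: assms(1) mult.assoc[symmetric])
    also have "\<dots> = l * (a * l ^ n) * a ^ n * b"
      unfolding Suc by (simp add: mult.assoc)
    also have "\<dots> = l ^ Suc n * a ^ Suc n * b"
      unfolding la by (simp add: mult.assoc)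
    finally show ?case .
  qed simp
  show "b ^ m * a ^ n = l ^ (m * n) * a ^ n * b ^ m"
  proof (induction m)
    case (Suc m)
    have "b ^ Suc m * a ^ n = b * (b ^ m * a ^ n)"
      by (simp add: mult.assoc)
    also have "\<dots> = (b * l ^ (m * n)) * a ^ n * b ^ m"
      unfolding Suc by (simp add: mult.assoc)
    also have "\<dots> = l ^ (m * n) * (b * a ^ n) * b ^ m"
      unfolding lb by (simp add: mult.assoc)
    also have "\<dots> = l ^ (Suc m * n) * a ^ n * b ^ Suc m"
      unfolding * by (simp add: mult.assoc power_add add.commute[of n])
    finally show ?case .
  qed simp
qed

text \<open>Sorting the product moves each \<open>b\<close> past every later \<open>d\<close>, at
  the cost of one factor \<open>l\<close> for each pair of positions.\<close>

lemma twisted_product_power: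
  fixes d b l :: "'a::monoid_mult"
  assumes "b * d = l * d * b" "l * d = d * l" "l * b = b * l"
  shows "(d * b) ^ k = l ^ (k choose 2) * d ^ k * b ^ k"
proof (induction k)
  case (Suc k)
  have "(d * b) ^ Suc k = (d * b) ^ k * d * b"
    by (simp add: power_commutes[symmetric] mult.assoc)
  also have "\<dots> = l ^ (k choose 2) * d ^ k * (b ^ k * d ^ 1) * b"
    unfolding Suc by (simp add: mult.assoc)
  also have "\<dots> = l ^ (k choose 2) * (d ^ k * l ^ k) * d * b ^ Suc k"
    unfolding twisted_powers(2)[OF assms] by (simp add: mult.assoc power_commutes[symmetric])
  also have "d ^ k * l ^ k = l ^ k * d ^ k"
    using assms(2) by (metis commute_power)
  also have "l ^ (k choose 2) * (l ^ k * d ^ k) * d * b ^ Suc k = l ^ (Suc k choose 2) * d ^ Suc k * b ^ Suc k"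
    by (simp add: numeral_2_eq_2 power_add mult.assoc power_commutes[symmetric] add.commute[of k])
  finally show ?case .
qed (simp add: numeral_2_eq_2)

context minimal_noncommutative
begin

lemma prime_order_element:
  assumes "y \<in> S" "y \<notin> Z" "n > 0" "y ^ n \<in> Z"
  obtains r a where "Factorial_Ring.prime r" "r \<le> n" "a \<in> S" "a \<notin> Z" "a ^ r \<in> Z"
proof -
  define k where "k = (LEAST k. k > 0 \<and> y ^ k \<in> Z)"
  have k: "k > 0" "y ^ k \<in> Z" "k \<le> n"
    using LeastI[of "\<lambda>k. k > 0 \<and> y ^ k \<in> Z" n] Least_le[of "\<lambda>k. k > 0 \<and> y ^ k \<in> Z" n] assms(3,4)
    unfolding k_def by auto
  have "k \<noteq> 1" using k assms(2) by auto
  then obtain r where r: "Factorial_Ring.prime r" "r dvd k" using prime_factor_nat by blast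
  then obtain m where m: "k = r * m" by blast
  have "0 < m" "m < k" using m k(1) prime_gt_1_nat[OF r(1)] by auto
  then have "y ^ m \<notin> Z"
    using not_less_Least[of m "\<lambda>k. k > 0 \<and> y ^ k \<in> Z"] unfolding k_def by auto
  moreover have "(y ^ m) ^ r \<in> Z" using k(2) m by (simp add: power_mult[symmetric] mult.commute)
  moreover have "r \<le> n" using k(1,3) r(2) by (meson dvd_imp_le le_trans)
  ultimately show thesis using that r(1) S_closed(7)[OF assms(1)] by blast
qed

text \<open>\<open>r\<close> is the least prime for which some noncentral \<open>a\<close> has a
  central \<open>r\<close>-th power. If \<open>y\<close> conjugates \<open>a\<close> to
  \<open>a ^ k\<close>, then \<open>y ^ (r - 1)\<close> conjugates it to
  \<open>a ^ (k ^ (r - 1))\<close>, and Fermat's theorem makes this a central multiple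
  \<open>l * a\<close>. Minimality of \<open>r\<close> keeps \<open>y ^ (r - 1)\<close>
  noncentral.\<close>

lemma twisted_pair:
  obtains r a b l where "Factorial_Ring.prime r" "a \<in> S" "a \<notin> Z" "b \<in> S" "b \<notin> Z" "l \<in> Z"
    "b * a = l * a * b" "l \<noteq> 1" "l ^ r = 1" "a ^ r \<in> Z" "b ^ r \<in> Z"
proof -
  define P where "P r \<longleftrightarrow> Factorial_Ring.prime r \<and> (\<exists>a\<in>S - Z. a ^ r \<in> Z)" for r
  obtain y0 where y0: "y0 \<in> S" "y0 \<notin> Z" using noncomm by (auto simp: commutant_def)
  then have "y0 \<noteq> 0" using Z_closed(1) by auto
  then obtain n where "n > 0" "y0 ^ n = 1"
    using finite_power_one[OF finite_S subring_S y0(1)] by blast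
  then have "\<exists>r. P r"
    using prime_order_element[OF y0, of n] Z_closed(2) unfolding P_def by (metis DiffI)
  define r where "r = Least P"
  have "P r" unfolding r_def using \<open>\<exists>r. P r\<close> by (rule LeastI_ex)
  then obtain a where r: "Factorial_Ring.prime r" and a: "a \<in> S" "a \<notin> Z" "a ^ r \<in> Z"
    unfolding P_def by blast
  \<comment> \<open>The least exponent making a power of \<open>y\<close> central has a prime
    factor, so minimality among primes extends to all exponents below \<open>r\<close>.\<close>
  have small: "y ^ n \<notin> Z" if yn: "y \<in> S" "y \<notin> Z" "n > 0" "n < r" for y n
  proof
    assume "y ^ n \<in> Z"
    then obtain r' a' where "P r'" "r' \<le> n"
      using prime_order_element[OF yn(1-3)] unfolding P_def by (metis DiffI)
    then show False using yn(4) Least_le[of P r'] unfolding r_def by linarith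
  qed
  have r1: "r > 1" using prime_gt_1_nat[OF r] .
  obtain y k where y: "y \<in> S" "y \<noteq> 0" "y * a = a ^ k * y" "a ^ k \<noteq> a"
    using conj_to_power[OF a(1,2)] .
  have "\<not> r dvd k"
  proof
    assume "r dvd k"
    then have "a ^ k \<in> Z" using Z_closed(7)[OF a(3)] by (auto simp: power_mult)
    then have "y * a = y * a ^ k" using y(1,3) Z_comm by metis
    then show False using y(2,4) by simp
  qed
  then have "[k ^ (r - 1) = 1] (mod r)" using r by (rule fermat_theorem[rotated])
  moreover have "k ^ (r - 1) \<ge> 1" using \<open>\<not> r dvd k\<close> by (cases k) auto
  ultimately obtain q where q: "k ^ (r - 1) = 1 + r * q"
    by (metis cong_le_nat add.commute mult.commute)
  have yp: "y ^ m * a = a ^ (k ^ m) * y ^ m" for m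
  proof (induction m)
    case (Suc m)
    have ya: "y * a ^ i = a ^ (k * i) * y" for i
    proof (induction i)
      case (Suc i)
      then show ?case by (simp add: power_add mult.assoc[symmetric] y(3)) (simp add: mult.assoc)
    qed simp
    have "y ^ Suc m * a = y * (y ^ m * a)" by (simp add: mult.assoc)
    also have "\<dots> = (y * a ^ (k ^ m)) * y ^ m" unfolding Suc by (simp add: mult.assoc)
    finally show ?case unfolding ya by (simp add: mult.assoc)
  qed simp
  define b where "b = y ^ (r - 1)"
  define l where "l = (a ^ r) ^ q"
  have l: "l \<in> Z" unfolding l_def using Z_closed(7)[OF a(3)] .
  have bS: "b \<in> S" unfolding b_def using S_closed(7)[OF y(1)] .
  have ba: "b * a = l * a * b"
    unfolding b_def yp q l_def by (simp add: power_mult[symmetric] power_add power_commutes)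
  have ya: "y * a \<noteq> a * y" using y(2-4) by auto
  then have yZ: "y \<notin> Z" using a(1) Z_comm by blast
  have bZ: "b \<notin> Z"
    unfolding b_def using small[OF y(1) yZ, of "r - 1"] r1 by simp
  have l1: "l \<noteq> 1"
  proof
    assume "l = 1"
    then have "a * b = b * a" using ba by simp
    moreover have "y * b = b * y" unfolding b_def by (simp add: power_commutes)
    ultimately show False using centralizer_comm[OF bS bZ y(1) a(1)] ya by simp
  qed
  note tw = twisted_powers[OF ba Z_comm[OF l a(1)] Z_comm[OF l bS]]
  have a0: "a \<noteq> 0" "b \<noteq> 0" using a(2) bZ Z_closed(1) by auto
  have "1 * (a ^ r * b) = l ^ r * (a ^ r * b)"
    using tw(1)[of r] Z_comm[OF a(3) bS] by (simp add: mult.assoc)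
  then have lr: "l ^ r = 1" using a0 by (metis mult_eq_0_iff mult_right_cancel power_not_zero)
  \<comment> \<open>\<open>b ^ r\<close> commutes with \<open>b\<close>, and with \<open>a\<close>
    because \<open>l ^ r = 1\<close>; were it noncentral, \<open>a\<close> and \<open>b\<close>
    would lie in its commutative centralizer.\<close>
  have brZ: "b ^ r \<in> Z"
  proof (rule ccontr)
    assume n: "b ^ r \<notin> Z"
    have "b ^ r * a = a * b ^ r" using tw(2)[of r 1] lr by simp
    then have "a * b = b * a"
      using centralizer_comm[OF S_closed(7)[OF bS] n a(1) bS] by (simp add: power_commutes)
    then have "1 * (a * b) = l * (a * b)" using ba by (simp add: mult.assoc)
    then show False using a0 l1 by (metis mult_eq_0_iff mult_right_cancel)
  qed
  show thesis by (rule that[OF r a(1,2) bS bZ l ba l1 lr a(3) brZ])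
qed

end

lemma square_mult_commuting:
  fixes x z :: "'a::semigroup_mult"
  assumes "x * z = z * x"
  shows "(x * z) * (x * z) = (x * x) * (z * z)"
  using assms by (metis mult.assoc)

context minimal_noncommutative
begin

text \<open>\<open>l\<close> has exact order \<open>r\<close>, so
  \<open>root_of_unity_central\<close> applies to \<open>a * inverse z\<close>, whose
  \<open>r\<close>-th power is 1.\<close>

lemma root_of_central_power_central:
  assumes "l \<in> Z" "Factorial_Ring.prime r" "l ^ r = 1" "l \<noteq> 1"
    and "a \<in> S" "z \<in> Z" "a ^ r = z ^ r"
  shows "a \<in> Z"
proof (cases "z = 0")
  case False
  have "a * inverse z = inverse z * a"
    using Z_comm[OF Z_closed(9)[OF assms(6)] assms(5)] by simp
  then have "(a * inverse z) ^ r = 1"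
    using False assms(7) twisted_product_power[of "inverse z" a 1 r] by (simp add: power_inverse)
  moreover have "l ^ i \<noteq> 1" if "0 < i" "i < r" for i
    using power_eq_one_coprime[OF assms(2-4)] that by (auto dest: dvd_imp_le)
  ultimately have "a * inverse z \<in> Z"
    using root_of_unity_central[OF assms(1,3)] assms(2,5,6)
    by (simp add: prime_gt_0_nat S_closed ZS Z_closed)
  then have "a * inverse z * z \<in> Z" using Z_closed(6) assms(6) by blast
  then show ?thesis using False by (simp add: mult.assoc)
next
  case True
  then have "a ^ r = 0" using assms(2,7) prime_gt_0_nat[OF assms(2)] by simp
  then show ?thesis using Z_closed(1) by simp
qed

text \<open>The twisted pair is adjusted to \<open>p\<close>, \<open>q\<close> with equal
  \<open>r\<close>-th powers. For odd \<open>r\<close> their quotient is then central, which is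
  absurd; for \<open>r = 2\<close> they span a quaternion algebra over the finite field
  \<open>Z\<close>, and such an algebra has zero divisors.\<close>

theorem no_minimal_noncommutative: False
proof -
  obtain r a b l where r: "Factorial_Ring.prime r" and a: "a \<in> S" "a \<notin> Z" "a ^ r \<in> Z"
    and b: "b \<in> S" "b \<notin> Z" "b ^ r \<in> Z" and l: "l \<in> Z" "b * a = l * a * b" "l \<noteq> 1" "l ^ r = 1"
    using twisted_pair by metis
  note central = root_of_central_power_central[OF l(1) r l(4,3)]
  have r1: "r > 1" using prime_gt_1_nat[OF r] .
  have ZZ: "x * y = y * x" if "x \<in> Z" "y \<in> Z" for x y using that Z_comm ZS by blast
  obtain g where g: "g \<in> Z" "g \<noteq> 0" "\<And>z. z \<in> Z \<Longrightarrow> z \<noteq> 0 \<Longrightarrow> \<exists>i::nat. z = g ^ i"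
    using finite_field_generator[OF finite_Z subring_Z ZZ] by metis
  have nz: "a \<noteq> 0" "b \<noteq> 0" using a(2) b(2) Z_closed(1) by auto
  obtain n m where n: "a ^ r = g ^ n" and m: "b ^ r = g ^ m"
    using g(3)[OF a(3)] g(3)[OF b(3)] nz by auto
  have nd: "\<not> r dvd n" "\<not> r dvd m"
    using central[OF a(1) Z_closed(7)[OF g(1)]] central[OF b(1) Z_closed(7)[OF g(1)]] a(2) b(2) n m
    by (auto elim!: dvdE simp: power_mult mult.commute[of r]) blast+
  \<comment> \<open>The exponents are crossed so that \<open>p ^ r\<close> and \<open>q ^ r\<close>
    are both \<open>g ^ (n * m)\<close>. As \<open>r\<close> divides neither \<open>n\<close> nor
    \<open>m\<close>, the new twist \<open>u\<close> is still a nontrivial \<open>r\<close>-th root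
    of 1.\<close>
  define p where "p = a ^ m"
  define q where "q = b ^ n"
  define u where "u = l ^ (n * m)"
  have u: "u \<in> Z" "u ^ r = 1" "u \<noteq> 1"
    unfolding u_def using Z_closed(7)[OF l(1)] power_eq_one_coprime[OF r l(4,3)] nd r
    by (auto simp: prime_dvd_mult_iff power_mult[symmetric])
  have pq: "p \<in> S" "q \<in> S" "p \<noteq> 0" "q \<noteq> 0" 
    unfolding p_def q_def using S_closed(7) a b nz by auto
  have prqr: "p ^ r = g ^ (n * m)" "q ^ r = g ^ (n * m)"
    unfolding p_def q_def using n m by (metis mult.commute power_mult)+
  have tw: "q * p = u * p * q"
    unfolding p_def q_def u_def using twisted_powers(2)[OF l(2) Z_comm[OF l(1) a(1)] Z_comm[OF l(1) b(1)]] .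
  have upq: "u * p = p * u" "u * q = q * u" using Z_comm[OF u(1)] pq by auto
  have not_comm: "p * q \<noteq> q * p"
  proof
    assume "p * q = q * p"
    then have "1 * (p * q) = u * (p * q)" using tw by (simp add: mult.assoc)
    then show False using pq u(3) by (metis mult_eq_0_iff mult_right_cancel)
  qed
  define v where "v = inverse u"
  have u0: "u \<noteq> 0" using u(2) r1 by (metis power_0_left less_numeral_extra(3) not_one_less_zero zero_neq_one)
  have v: "v \<in> Z" "v ^ r = 1" "v \<noteq> 1"
    unfolding v_def using u Z_closed(9) by (auto simp: power_inverse) (metis inverse_1 inverse_inverse_eq)
  have iS: "inverse p \<in> S" using S_closed(9)[OF pq(1)] .
  have "v * (q * p) = v * u * p * q" unfolding tw by (simp add: mult.assoc)
  then have vqp: "v * (q * p) = p * q" using u0 by (simp add: v_def)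
  have "q * inverse p = v * inverse p * q"
  proof -
    have "p * (q * inverse p) = v * (q * p) * inverse p" unfolding vqp by (simp add: mult.assoc)
    also have "\<dots> = v * q" using pq(3) by (simp add: mult.assoc)
    also have "\<dots> = p * (v * inverse p * q)"
      using Z_comm[OF v(1) pq(1)] pq(3) by (simp add: mult.assoc[symmetric])
        (metis Z_comm divisors_zero iS mult.assoc pq(1) right_inverse v(1) mult_1_left mult_1_right)
    finally show ?thesis using pq(3) by (metis mult_left_cancel)
  qed
  note pw = twisted_product_power[OF this Z_comm[OF v(1) iS] Z_comm[OF v(1) pq(2)], of r]
  have "inverse p ^ r * q ^ r = 1" using prqr pq(3) by (metis left_inverse power_inverse power_not_zero)
  then have cr: "(inverse p * q) ^ r = v ^ (r choose 2)" using pw by (simp add: mult.assoc)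
  \<comment> \<open>An odd \<open>r\<close> divides \<open>r choose 2\<close>, so
    \<open>inverse p * q\<close> is an \<open>r\<close>-th root of 1 and hence central.\<close>
  have "r = 2"
  proof (rule ccontr)
    assume "r \<noteq> 2"
    then have "r dvd r choose 2" using r r1 by (intro dvd_choose_prime) auto
    then have "(inverse p * q) ^ r = 1 ^ r" using cr v(2) by (auto simp: power_mult)
    then have "inverse p * q \<in> Z"
      using central[OF S_closed(6)[OF iS pq(2)] Z_closed(2)] by simp
    then have "inverse p * q * p = p * (inverse p * q)" using Z_comm pq by simp
    then have "p * (inverse p * q * p) = p * q" using pq(3) by (simp add: mult.assoc[symmetric])
    then show False using not_comm pq(3) by (simp add: mult.assoc[symmetric])
  qed
  have "(u - 1) * (u + 1) = 0" using u(2) \<open>r = 2\<close> by (simp add: algebra_simps power2_eq_square)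
  then have u_eq: "u = -1" using u(3) by (simp add: add_eq_0_iff2)
  have two: "(2::'a) \<noteq> 0" using u(3) unfolding u_eq by (metis one_add_one add_eq_0_iff)
  define al where "al = g ^ (n * m)"
  have al: "p * p = al" "q * q = al" "al \<in> Z"
    using prqr \<open>r = 2\<close> Z_closed(7)[OF g(1)] unfolding al_def by (auto simp: power2_eq_square)
  have pZ: "p \<notin> Z" using not_comm pq(2) Z_comm by blast
  have not_sq: "al \<noteq> z * z" if "z \<in> Z" for z
    using central[OF pq(1) that] pZ al(1) \<open>r = 2\<close> by (auto simp: power2_eq_square)
  have odd_nm: "odd (n * m)" using nd \<open>r = 2\<close> by auto
  \<comment> \<open>Otherwise sums of two squares are squares, and so is -1. Then \<open>al\<close>,
    the difference of the squares of \<open>(al + 1) * h\<close> and \<open>(al - 1) * h\<close>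
    with \<open>h\<close> one half, would be a square too.\<close>
  have "\<exists>x\<in>Z. \<forall>z\<in>Z. 1 + x * x \<noteq> z * z"
  proof (rule ccontr)
    assume "\<not> ?thesis"
    then have one_sq: "\<exists>z\<in>Z. 1 + x * x = z * z" if "x \<in> Z" for x using that by blast
    have nat_sq: "\<exists>z\<in>Z. of_nat k = z * z" for k
    proof (induction k)
      case (Suc k)
      then show ?case using one_sq by (metis of_nat_Suc add.commute)
    qed (use Z_closed(1) in force)
    \<comment> \<open>In positive characteristic -1 is a sum of ones.\<close>
    have "of_nat (CHAR('a) - 1) = (-1::'a)"
      using prime_gt_0_nat[OF prime_CHAR] by (simp add: of_nat_diff)
    then obtain i where i: "i \<in> Z" "i * i = -1" using nat_sq by metis
    have sum_sq: "\<exists>z\<in>Z. x * x + y * y = z * z" if xy: "x \<in> Z" "y \<in> Z" for x y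
    proof (cases "x = 0")
      case False
      define t where "t = inverse x * y"
      have t: "t \<in> Z" "x * t = y"
        unfolding t_def using Z_closed(6)[OF Z_closed(9)[OF xy(1)] xy(2)] False
        by (simp_all add: mult.assoc[symmetric])
      obtain z where z: "z \<in> Z" "1 + t * t = z * z"
        using one_sq[OF t(1)] by blast
      have "(x * z) * (x * z) = x * x * (1 + t * t)"
        using square_mult_commuting[OF ZZ[OF xy(1) z(1)]] z(2) by simp
      also have "\<dots> = x * x + y * y"
        using square_mult_commuting[OF ZZ[OF xy(1) t(1)]] t(2) by (simp add: distrib_left)
      finally show ?thesis using Z_closed(6)[OF xy(1) z(1)] by (intro bexI[of _ "x * z"]) auto
    qed (use xy in auto)
    define h where "h = inverse (2::'a)"
    have h: "h \<in> Z" "h * 2 = 1"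
      unfolding h_def using left_inverse[OF two] Z_closed(9)[OF Z_closed(8)[of 2]] by simp_all
    have hal: "al * h = h * al" using ZZ[OF al(3) h(1)] .
    have hh: "h + h = 1" using h(2) by (metis mult_2_right)
    let ?x = "(al + 1) * h" and ?y = "i * ((al - 1) * h)"
    have "?y * ?y = (i * i) * (((al - 1) * h) * ((al - 1) * h))"
      using ZZ[OF i(1) Z_closed(6)[OF Z_closed(4)[OF al(3) Z_closed(2)] h(1)]]
      by (rule square_mult_commuting)
    then have "?x * ?x + ?y * ?y = al * h * h + al * h * h + (al * h * h + al * h * h)"
      using hal by (simp add: i(2) algebra_simps)
    also have "\<dots> = al * ((h + h) * (h + h))" by (simp only: distrib_left distrib_right mult.assoc)
    finally have "?x * ?x + ?y * ?y = al" unfolding hh by simp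
    moreover have "?x \<in> Z" "?y \<in> Z" using i h al Z_closed by auto
    ultimately show False using sum_sq not_sq by metis
  qed
  then obtain x where x: "x \<in> Z" "\<And>z. z \<in> Z \<Longrightarrow> 1 + x * x \<noteq> z * z" by blast
  have "1 + x * x \<noteq> 0" using x(2)[OF Z_closed(1)] by simp
  then obtain i where i: "1 + x * x = g ^ i"
    using g(3) Z_closed x(1) by (metis Z_closed)
  have "odd i"
  proof
    assume "even i"
    then obtain j where "i = j + j" by (metis evenE mult_2)
    then show False using x(2)[OF Z_closed(7)[OF g(1)], of j] i by (simp add: power_add)
  qed
  \<comment> \<open>\<open>1 + x * x\<close> and \<open>al\<close> are both odd powers of
    \<open>g\<close>, so their quotient is a square, namely \<open>y * y\<close>.\<close>
  then obtain k where k: "i + n * m = k + k" using odd_nm by (metis evenE mult_2 odd_even_add)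
  define y where "y = g ^ k * inverse al"
  have al0: "al \<noteq> 0" using al(1) pq(3) by auto
  have y: "y \<in> Z" unfolding y_def using Z_closed g al by auto
  have "al * (y * y) = 1 + x * x"
  proof -
    have "al * (y * y) = al * inverse al * inverse al * (g ^ k * g ^ k)"
      unfolding y_def using ZZ[OF Z_closed(7)[OF g(1)] Z_closed(9)[OF al(3)]] by (metis mult.assoc)
    also have "g ^ k * g ^ k = al * g ^ i"
      unfolding al_def by (simp add: power_add[symmetric] k[symmetric] add.commute)
    finally show ?thesis using al0 i by (simp add: mult.assoc) (simp add: mult.assoc[symmetric])
  qed
  then have rel: "al * (1 + x * x) = al * (al * (y * y))" by simp
  have qp: "q * p = - (p * q)" using tw u_eq by simp
  have qp': "q * (p * w) = - (p * (q * w))" for w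
    using arg_cong[OF qp, of "\<lambda>s. s * w"] by (simp add: mult.assoc)
  have al': "p * (p * w) = al * w" "q * (q * w) = al * w" for w
    using al by (metis mult.assoc)+
  have c: "s * x = x * s" "s * (x * w) = x * (s * w)" "s * y = y * s" "s * (y * w) = y * (s * w)"
    "s * al = al * s" "s * (al * w) = al * (s * w)" if "s \<in> {p, q}" for s w
    using that Z_comm[OF x(1)] Z_comm[OF y] Z_comm[OF al(3)] pq by (auto simp: mult.assoc[symmetric])
  have c': "y * x = x * y" "y * (x * w) = x * (y * w)" "x * al = al * x" "x * (al * w) = al * (x * w)"
    "y * al = al * y" "y * (al * w) = al * (y * w)" for w
    using ZZ x(1) y al(3) by (metis mult.assoc)+
  \<comment> \<open>A pure quaternion whose square is
    \<open>al * (1 + x * x) - al * (al * (y * y))\<close>, which is 0 by the choice of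
    \<open>y\<close>. Its anticommutator with \<open>p\<close> retains only the first term, so
    \<open>w\<close> cannot be 0.\<close>
  define w where "w = p + x * q + y * (p * q)"
  have "w * w = al * (1 + x * x) - al * (al * (y * y))"
    unfolding w_def by (simp add: algebra_simps qp qp' al al' c c')
  then have "w = 0" using rel by simp
  moreover have "p * w + w * p = 2 * al"
    unfolding w_def mult_2 by (simp add: algebra_simps qp qp' al al' c c')
  ultimately show False using two al0 by auto
qed

end

theorem finite_subring_commutative:
  fixes S :: "'a::division_ring set"
  assumes "finite S" "is_subring S" "x \<in> S" "y \<in> S"
  shows "x * y = y * x"
  using assms
proof (induction "card S" arbitrary: S x y rule: less_induct)
  case less
  show ?case
  proof (rule ccontr)
    assume "x * y \<noteq> y * x"
    interpret minimal_noncommutative S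
    proof
      fix T x y assume "T \<subset> S" "is_subring T" "x \<in> T" "y \<in> T"
      then show "x * y = y * x"
        using less.hyps[of T] less.prems(1) by (meson finite_subset psubset_card_mono psubset_imp_subset)
    qed (use less.prems \<open>x * y \<noteq> y * x\<close> in auto)
    show False by (rule no_minimal_noncommutative)
  qed
qed

section \<open>Extension of valuations\<close>

text \<open>An inductive set instead of explicit finite sums, so that every closure property is a
  rule induction. Scalars stand on the left throughout.\<close>

inductive_set vspan :: "'a::ring_1 set \<Rightarrow> 'a set \<Rightarrow> 'a set" for V B where
  zero: "0 \<in> vspan V B"
| step: "y \<in> vspan V B \<Longrightarrow> v \<in> V \<Longrightarrow> b \<in> B \<Longrightarrow> v * b + y \<in> vspan V B"

lemma vspan_mono: "x \<in> vspan V B \<Longrightarrow> B \<subseteq> B' \<Longrightarrow> x \<in> vspan V B'"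
  by (induction rule: vspan.induct) (auto intro: vspan.intros)

lemma vspan_base: "v \<in> V \<Longrightarrow> b \<in> B \<Longrightarrow> v * b \<in> vspan V B"
  using vspan.step[OF vspan.zero, of v V b B] by simp

lemma vspan_add: "x \<in> vspan V B \<Longrightarrow> y \<in> vspan V B \<Longrightarrow> x + y \<in> vspan V B"
  by (induction rule: vspan.induct) (auto intro: vspan.intros simp: add.assoc)

lemma vspan_smult:
  assumes "is_subring V" "w \<in> V"
  shows "x \<in> vspan V B \<Longrightarrow> w * x \<in> vspan V B"
  by (induction rule: vspan.induct)
     (auto intro: vspan.intros is_subringD[OF assms(1)] assms(2) simp: distrib_left mult.assoc[symmetric])

lemma vspan_uminus:
  assumes "is_subring V" "x \<in> vspan V B"
  shows "- x \<in> vspan V B"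
  using vspan_smult[OF assms(1) is_subringD(3)[OF assms(1) is_subringD(2)[OF assms(1)]] assms(2)] by simp

lemma vspan_sum: "(\<And>i. i \<in> I \<Longrightarrow> f i \<in> vspan V B) \<Longrightarrow> sum f I \<in> vspan V B"
  by (induction I rule: infinite_finite_induct) (auto intro: vspan.zero vspan_add)

lemma vspan_minimal:
  assumes "is_subring T" "V \<subseteq> T" "B \<subseteq> T"
  shows "x \<in> vspan V B \<Longrightarrow> x \<in> T"
  by (induction rule: vspan.induct) (use assms in \<open>auto intro: is_subringD[OF assms(1)]\<close>)

lemma vspan_trans:
  assumes "is_subring V" "B \<subseteq> vspan V B'"
  shows "x \<in> vspan V B \<Longrightarrow> x \<in> vspan V B'"
  by (induction rule: vspan.induct) (use assms in \<open>auto intro: vspan.zero vspan_add vspan_smult\<close>)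

lemma vspan_insert:
  assumes "is_subring V" "x \<in> vspan V (insert b B)"
  obtains v y where "v \<in> V" "y \<in> vspan V B" "x = v * b + y"
  using assms(2)
proof (induction arbitrary: thesis rule: vspan.induct)
  case zero
  show ?case by (rule zero[of 0 0]) (auto intro: is_subringD[OF assms(1)] vspan.zero)
next
  case (step y v b')
  obtain w z where wz: "w \<in> V" "z \<in> vspan V B" "y = w * b + z" using step.IH .
  show ?case
  proof (cases "b' = b")
    case True
    show ?thesis
      by (rule step.prems[of "v + w" z])
         (use wz step.hyps True in \<open>auto intro: is_subringD[OF assms(1)] simp: distrib_right add.assoc\<close>)
  next
    case False
    show ?thesis
      by (rule step.prems[of w "v * b' + z"])
         (use wz step.hyps False in \<open>auto intro: vspan.step simp: add.left_commute\<close>)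
  qed
qed

lemma vspan_mult:
  assumes "is_subring V" "\<And>b c. b \<in> B \<Longrightarrow> c \<in> B \<Longrightarrow> b * c \<in> vspan V B"
    and "\<And>v b. v \<in> V \<Longrightarrow> b \<in> B \<Longrightarrow> v * b = b * v"
    and "x \<in> vspan V B" "y \<in> vspan V B"
  shows "x * y \<in> vspan V B"
  using assms(4)
proof (induction rule: vspan.induct)
  case (step x v b)
  have "b * y \<in> vspan V B"
    using assms(5)
  proof (induction rule: vspan.induct)
    case (step y w c)
    have "b * (w * c) = w * (b * c)"
      using assms(3)[OF step.hyps(2) \<open>b \<in> B\<close>] by (simp add: mult.assoc[symmetric])
    then show ?case
      using step assms(2) \<open>b \<in> B\<close> by (simp add: distrib_left vspan_add vspan_smult[OF assms(1)])
  qed (simp add: vspan.zero)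
  then show ?case
    using step by (simp add: distrib_right mult.assoc vspan_add vspan_smult[OF assms(1)])
qed (simp add: vspan.zero)

locale subfield_set =
  fixes F :: "'a::division_ring set"
  assumes subring_F: "is_subring F"
    and inverse_F: "x \<in> F \<Longrightarrow> inverse x \<in> F"
    and comm_F: "x \<in> F \<Longrightarrow> y \<in> F \<Longrightarrow> x * y = y * x"
begin

lemmas F_closed = is_subringD[OF subring_F] inverse_F

end

text \<open>Chevalley's construction of valuation rings, with the single condition
  \<open>inverse p \<notin> V\<close> in place of the usual pair of a subring and an ideal.
  Maximality makes \<open>V\<close> a valuation ring (\<open>valuation\<close>) with
  \<open>p\<close> in its Jacobson radical (\<open>one_plus_unit\<close>).\<close>

locale maximal_subring = subfield_set F for F :: "'a::division_ring set" +
  fixes V p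
  assumes subring_V: "is_subring V" and VF: "V \<subseteq> F" and pV: "p \<in> V" and ip: "inverse p \<notin> V"
    and maximal: "\<And>W. is_subring W \<Longrightarrow> V \<subseteq> W \<Longrightarrow> W \<subseteq> F \<Longrightarrow> inverse p \<notin> W \<Longrightarrow> W = V"
begin

lemmas V_closed = is_subringD[OF subring_V]

lemma p0: "p \<noteq> 0" using ip V_closed(1) by auto

definition powers :: "'a \<Rightarrow> 'a set" where "powers x = range (\<lambda>i::nat. x ^ i)"

lemma adjoin_contains:
  assumes "x \<in> F" "x \<notin> V"
  shows "inverse p \<in> vspan V (powers x)"
proof (rule ccontr)
  assume n: "inverse p \<notin> vspan V (powers x)"
  have "vspan V (powers x) = V"
  proof (rule maximal)
    have one: "1 \<in> powers x" unfolding powers_def by (metis power_0 rangeI)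
    have diff: "a - b \<in> vspan V (powers x)" if "a \<in> vspan V (powers x)" "b \<in> vspan V (powers x)" for a b
      using vspan_add[OF that(1) vspan_uminus[OF subring_V that(2)]] by simp
    have "x ^ i * x ^ j \<in> powers x" for i j
      unfolding powers_def by (metis power_add rangeI)
    then have mult: "b * c \<in> vspan V (powers x)" if "b \<in> powers x" "c \<in> powers x" for b c
      using that vspan_base[OF V_closed(2)] by (fastforce simp: powers_def)
    have "v * b = b * v" if "v \<in> V" "b \<in> powers x" for v b
      using that VF assms(1) comm_F F_closed(7) unfolding powers_def by blast
    note mult' = vspan_mult[OF subring_V mult this]
    then show "is_subring (vspan V (powers x))"
      unfolding is_subring_def using vspan_base[OF V_closed(2) one] diff
      by (auto intro: mult')
    show "V \<subseteq> vspan V (powers x)"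
      using vspan_base[OF _ one] by force
    show "vspan V (powers x) \<subseteq> F"
      using vspan_minimal[OF subring_F VF] F_closed(7)[OF assms(1)] unfolding powers_def by blast
  qed (rule n)
  moreover have "1 * x \<in> vspan V (powers x)"
    by (rule vspan_base[OF V_closed(2)]) (metis powers_def power_one_right rangeI)
  ultimately show False using assms(2) by simp
qed

text \<open>If the inverse of \<open>d = 1 + p * v\<close> were not in \<open>V\<close>, adjoining
  it would produce \<open>inverse p\<close>; clearing denominators, \<open>d ^ k * inverse p\<close>
  lies in \<open>V\<close> for some \<open>k\<close>. But \<open>d ^ k\<close> is 1 modulo
  \<open>p\<close>, so \<open>inverse p\<close> would lie in \<open>V\<close>.\<close>

lemma one_plus_unit:
  assumes "v \<in> V"
  shows "1 + p * v \<noteq> 0" "inverse (1 + p * v) \<in> V"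
proof -
  let ?d = "1 + p * v"
  have not1: "p * w \<noteq> 1" if "w \<in> V" for w
    using that ip inverse_unique by metis
  show d0: "?d \<noteq> 0"
  proof
    assume "?d = 0"
    then have "p * (- v) = 1" by (simp add: add_eq_0_iff2)
    then show False using not1[OF V_closed(3)[OF assms]] by simp
  qed
  have dV: "?d \<in> V" using V_closed assms pV by simp
  show "inverse ?d \<in> V"
  proof (rule ccontr)
    assume "inverse ?d \<notin> V"
    moreover have "inverse ?d \<in> F" using F_closed(9) dV VF by blast
    ultimately have "inverse p \<in> vspan V (powers (inverse ?d))" by (rule adjoin_contains[rotated])
    then have "\<exists>k. ?d ^ k * inverse p \<in> V"
    proof (induction rule: vspan.induct)
      case zero
      show ?case using V_closed(1) by simp
    next
      case (step y w b)
      then obtain k where k: "?d ^ k * y \<in> V" by blast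
      obtain i where i: "b = inverse ?d ^ i" using step.hyps unfolding powers_def by blast
      have dc: "?d ^ j * w = w * ?d ^ j" for j
        using comm_F V_closed(7)[OF dV] step.hyps(2) VF by blast
      have "?d ^ (k + i) * (w * b + y) = ?d ^ (k + i) * w * b + ?d ^ (k + i) * y"
        by (simp add: distrib_left mult.assoc)
      also have "?d ^ (k + i) * w * b = w * ?d ^ k * (?d ^ i * inverse (?d ^ i))"
        unfolding dc i by (simp add: power_add mult.assoc power_inverse)
      also have "?d ^ i * inverse (?d ^ i) = 1" using d0 by simp
      also have "?d ^ (k + i) * y = ?d ^ i * (?d ^ k * y)"
        by (simp add: power_add[symmetric] mult.assoc[symmetric] add.commute)
      finally show ?case using V_closed step.hyps(2) dV k by (intro exI[of _ "k + i"]) auto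
    qed
    then obtain k where k: "?d ^ k * inverse p \<in> V" by blast
    have "\<exists>f\<in>V. ?d ^ j = 1 + p * f" for j
    proof (induction j)
      case (Suc j)
      then obtain f where "f \<in> V" "?d ^ j = 1 + p * f" by blast
      then have "?d ^ Suc j = 1 + p * (f + v * (1 + p * f))" by (simp add: algebra_simps)
      then show ?case using V_closed assms \<open>f \<in> V\<close> pV by (metis (no_types, lifting))
    qed (use V_closed(1) in force)
    then obtain f where f: "f \<in> V" "?d ^ k = 1 + p * f" by blast
    have "p * (?d ^ k * inverse p) = ?d ^ k"
    proof -
      have "p * ?d ^ k = ?d ^ k * p"
        using comm_F V_closed(7)[OF dV] pV VF by blast
      then have "p * (?d ^ k * inverse p) = ?d ^ k * (p * inverse p)"
        by (simp only: mult.assoc[symmetric])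
      then show ?thesis using p0 by simp
    qed
    then have "p * (?d ^ k * inverse p - f) = 1" using f by (simp add: right_diff_distrib)
    then show False using not1[OF V_closed(4)[OF k f(1)]] by simp
  qed
qed

definition adj :: "'a \<Rightarrow> nat \<Rightarrow> 'a set" where "adj x n = vspan V ((\<lambda>i. x ^ i) ` {..n})"

text \<open>Write \<open>inverse p = w + r\<close> with \<open>w\<close> the constant term of a
  polynomial in \<open>inverse x\<close>. Then \<open>p * r = 1 - p * w\<close> is a unit of
  \<open>V\<close>, so 1 is a combination of the powers of \<open>inverse x\<close> with exponents 1
  to \<open>m\<close>; multiplied by \<open>x ^ n\<close>, it expresses \<open>x ^ n\<close> by
  lower powers of \<open>x\<close>.\<close>

lemma adj_descent:
  assumes "x \<in> F" "x \<noteq> 0" "inverse p \<in> adj (inverse x) m" "m \<le> n" "inverse p \<in> adj x n"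
  shows "0 < n" "inverse p \<in> adj x (n - 1)"
proof -
  let ?y = "inverse x"
  have adj0: "adj z 0 \<subseteq> V" for z
    unfolding adj_def using vspan_minimal[OF subring_V, of V "(\<lambda>i. z ^ i) ` {..0}"] V_closed(2) by auto
  show n: "0 < n" using assms(5) adj0 ip by (cases n) auto
  have "(\<lambda>i. ?y ^ i) ` {..m} = insert 1 ((\<lambda>i. ?y ^ i) ` {1..m})"
  proof -
    have "{..m} = insert 0 {1..m}" by auto
    then show ?thesis by simp
  qed
  then obtain w r where w: "w \<in> V" "r \<in> vspan V ((\<lambda>i. ?y ^ i) ` {1..m})" "inverse p = w * 1 + r"
    using vspan_insert[OF subring_V] assms(3) unfolding adj_def by metis
  have "p * inverse p = p * w + p * r" unfolding w(3) by (simp add: distrib_left)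
  then have d: "1 + p * (- w) = p * r" using p0 by (simp add: algebra_simps)
  note u = one_plus_unit[OF V_closed(3)[OF w(1)]]
  define c where "c = inverse (1 + p * (- w))"
  have c: "c \<in> V" "c * (p * r) = 1" unfolding c_def using u by (simp_all add: d[symmetric])
  have "r * x ^ n \<in> adj x (n - 1)"
    using w(2)
  proof (induction rule: vspan.induct)
    case (step y v b)
    then obtain i where i: "b = ?y ^ i" "1 \<le> i" "i \<le> m" by auto
    have "b * x ^ n = ?y ^ i * (x ^ i * x ^ (n - i))"
      using i assms(4) by (simp add: power_add[symmetric])
    also have "\<dots> = x ^ (n - i)" using assms(2) by (simp add: mult.assoc[symmetric] power_inverse)
    finally have "v * (b * x ^ n) \<in> adj x (n - 1)"
      unfolding adj_def using step.hyps(2) i by (auto intro!: vspan_base)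
    then show ?case using step.IH unfolding adj_def by (simp add: distrib_right vspan_add mult.assoc)
  qed (simp add: adj_def vspan.zero)
  then have "(c * p) * (r * x ^ n) \<in> adj x (n - 1)"
    unfolding adj_def using vspan_smult[OF subring_V] V_closed(6)[OF c(1) pV] by blast
  also have "(c * p) * (r * x ^ n) = x ^ n" using c(2) by (simp add: mult.assoc[symmetric])
  finally have xn: "x ^ n \<in> adj x (n - 1)" .
  have "x ^ i \<in> adj x (n - 1)" if "i \<le> n" for i
  proof (cases "i = n")
    case False
    then have "1 * x ^ i \<in> adj x (n - 1)"
      unfolding adj_def using that by (intro vspan_base V_closed) auto
    then show ?thesis by simp
  qed (use xn in simp)
  then have "(\<lambda>i. x ^ i) ` {..n} \<subseteq> adj x (n - 1)" by auto
  from vspan_trans[OF subring_V this[unfolded adj_def] assms(5)[unfolded adj_def]]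
  show "inverse p \<in> adj x (n - 1)" unfolding adj_def .
qed

text \<open>Otherwise \<open>inverse p\<close> would be a polynomial over \<open>V\<close> both in
  \<open>x\<close> and in \<open>inverse x\<close>. The larger of the two degrees could always be
  lowered, an infinite descent.\<close>

lemma valuation:
  assumes "x \<in> F"
  shows "x \<in> V \<or> inverse x \<in> V"
proof (rule ccontr)
  assume n: "\<not> ?thesis"
  then have x0: "x \<noteq> 0" using V_closed(1) by auto
  have in_adj: "\<exists>n. y \<in> adj x n" if "y \<in> vspan V (powers x)" for x y
    using that
  proof (induction rule: vspan.induct)
    case (step y v b)
    then obtain n i where "y \<in> adj x n" "b = x ^ i" unfolding powers_def by blast
    then have "v * b \<in> adj x (max n i)" "y \<in> adj x (max n i)"
      unfolding adj_def using step.hyps by (auto intro!: vspan_base elim: vspan_mono)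
    then show ?case unfolding adj_def by (metis vspan_add)
  qed (simp add: adj_def vspan.zero)
  have no: "inverse p \<in> adj x n \<Longrightarrow> inverse p \<in> adj (inverse x) m \<Longrightarrow> False" for n m
  proof (induction "n + m" arbitrary: n m rule: less_induct)
    case less
    show ?case
    proof (cases "m \<le> n")
      case True
      show ?thesis
        using adj_descent[OF assms x0 less.prems(2) True less.prems(1)] less.hyps[of "n - 1" m] less.prems by linarith
    next
      case False
      then show ?thesis
        using adj_descent[OF inverse_F[OF assms], of n m] x0 less.prems less.hyps[of n "m - 1"] by simp
    qed
  qed
  show False
    using no in_adj adjoin_contains assms inverse_F n by metis
qed

end

lemma (in subfield_set) maximal_subring_exists:
  assumes "is_subring R" "R \<subseteq> F" "p \<in> R" "inverse p \<notin> R"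
  obtains V where "maximal_subring F V p"
proof -
  define A where "A = {V. is_subring V \<and> R \<subseteq> V \<and> V \<subseteq> F \<and> inverse p \<notin> V}"
  have "\<exists>M\<in>A. \<forall>Y\<in>A. M \<subseteq> Y \<longrightarrow> Y = M"
  proof (rule subset_Zorn_nonempty)
    show "A \<noteq> {}" using assms unfolding A_def by blast
  next
    fix C assume C: "C \<noteq> {}" "subset.chain A C"
    have sub: "is_subring W" if "W \<in> C" for W
      using C(2) that unfolding subset.chain_def A_def by blast
    have "is_subring (\<Union>C)"
      unfolding is_subring_def
    proof (intro conjI ballI)
      show "1 \<in> \<Union>C" using C(1) sub is_subringD(2) by blast
    next
      fix x y assume "x \<in> \<Union>C" "y \<in> \<Union>C"
      then obtain W where "W \<in> C" "x \<in> W" "y \<in> W"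
        using C(2) unfolding subset_chain_def by (metis UnionE subsetD)
      then show "x - y \<in> \<Union>C" "x * y \<in> \<Union>C" using sub is_subringD(4,6) by blast+
    qed
    moreover have "R \<subseteq> \<Union>C \<and> \<Union>C \<subseteq> F \<and> inverse p \<notin> \<Union>C"
      using C unfolding subset_chain_def A_def by blast
    ultimately show "\<Union>C \<in> A" unfolding A_def by blast
  qed
  then obtain V where V: "V \<in> A" "\<And>Y. Y \<in> A \<Longrightarrow> V \<subseteq> Y \<Longrightarrow> Y = V" by blast
  have "maximal_subring F V p"
  proof unfold_locales
    fix W assume "is_subring W" "V \<subseteq> W" "W \<subseteq> F" "inverse p \<notin> W"
    moreover from this V(1) have "W \<in> A" unfolding A_def by blast
    ultimately show "W = V" using V(2) by blast
  qed (use V(1) assms(3) in \<open>auto simp: A_def\<close>)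
  then show thesis by (rule that)
qed

section \<open>Linear topologies\<close>

locale division_subring =
  fixes E :: "'a::division_ring set"
  assumes subring_E: "is_subring E"
    and inverse_E: "x \<in> E \<Longrightarrow> inverse x \<in> E"
begin

lemmas E_closed = is_subringD[OF subring_E] inverse_E

end

text \<open>\<open>\<U>\<close> is a base of neighbourhoods of 0 made of subrings without 1. With
  \<open>nbhd_inverse\<close> each set \<open>1 + U\<close> is a multiplicative group, so products
  and inverses near 1 need no shrinking of neighbourhoods.\<close>

locale linear_topology = division_subring E for E :: "'a::division_ring set" +
  fixes \<U> :: "'a set set"
  assumes nonempty: "\<U> \<noteq> {}"
    and nbhd_E: "U \<in> \<U> \<Longrightarrow> U \<subseteq> E"
    and directed: "U \<in> \<U> \<Longrightarrow> U' \<in> \<U> \<Longrightarrow> \<exists>W\<in>\<U>. W \<subseteq> U \<and> W \<subseteq> U'"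
    and nbhd_0: "U \<in> \<U> \<Longrightarrow> 0 \<in> U"
    and nbhd_diff: "U \<in> \<U> \<Longrightarrow> x \<in> U \<Longrightarrow> y \<in> U \<Longrightarrow> x - y \<in> U"
    and nbhd_mult: "U \<in> \<U> \<Longrightarrow> x \<in> U \<Longrightarrow> y \<in> U \<Longrightarrow> x * y \<in> U"
    and nbhd_inverse: "U \<in> \<U> \<Longrightarrow> x \<in> U \<Longrightarrow> 1 + x \<noteq> 0 \<and> inverse (1 + x) - 1 \<in> U"
    and continuous_left: "a \<in> E \<Longrightarrow> U \<in> \<U> \<Longrightarrow> \<exists>W\<in>\<U>. \<forall>x\<in>W. a * x \<in> U"
    and continuous_right: "a \<in> E \<Longrightarrow> U \<in> \<U> \<Longrightarrow> \<exists>W\<in>\<U>. \<forall>x\<in>W. x * a \<in> U"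
    and hausdorff: "a \<in> E \<Longrightarrow> a \<noteq> 0 \<Longrightarrow> \<exists>U\<in>\<U>. a \<notin> U"
begin

lemma nbhd_add: "U \<in> \<U> \<Longrightarrow> x \<in> U \<Longrightarrow> y \<in> U \<Longrightarrow> x + y \<in> U"
  using nbhd_diff[of U x "0 - y"] nbhd_diff[of U 0 y] nbhd_0 by simp

lemma nbhd_sum: "U \<in> \<U> \<Longrightarrow> (\<And>i. i \<in> I \<Longrightarrow> f i \<in> U) \<Longrightarrow> sum f I \<in> U"
  by (induction I rule: infinite_finite_induct) (auto intro: nbhd_0 nbhd_add)

lemma directed_finite:
  assumes "finite I" "\<And>i. i \<in> I \<Longrightarrow> f i \<in> \<U>"
  shows "\<exists>W\<in>\<U>. \<forall>i\<in>I. W \<subseteq> f i"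
  using assms
proof (induction I rule: finite_induct)
  case empty
  then show ?case using nonempty by auto
next
  case (insert i I)
  then obtain W where "W \<in> \<U>" "\<forall>i\<in>I. W \<subseteq> f i" by auto
  moreover obtain W' where "W' \<in> \<U>" "W' \<subseteq> W" "W' \<subseteq> f i"
    using directed[of W "f i"] insert.prems[of i] \<open>W \<in> \<U>\<close> by auto
  ultimately show ?case by blast
qed

definition near :: "'a set \<Rightarrow> 'a \<Rightarrow> bool" where "near U t \<longleftrightarrow> t - 1 \<in> U"

lemma near_one: "U \<in> \<U> \<Longrightarrow> near U 1"
  by (simp add: near_def nbhd_0)

lemma near_mono: "near U t \<Longrightarrow> U \<subseteq> W \<Longrightarrow> near W t"
  by (auto simp: near_def)

lemma near_mult:
  assumes "U \<in> \<U>" "near U s" "near U t"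
  shows "near U (s * t)"
proof -
  have "s * t - 1 = (s - 1) + (t - 1) + (s - 1) * (t - 1)" by (simp add: algebra_simps)
  then show ?thesis using assms nbhd_add nbhd_mult unfolding near_def by metis
qed

lemma near_power: "U \<in> \<U> \<Longrightarrow> near U t \<Longrightarrow> near U (t ^ k)"
  by (induction k) (auto intro: near_one near_mult)

lemma near_inverse: "U \<in> \<U> \<Longrightarrow> near U t \<Longrightarrow> t \<noteq> 0 \<and> near U (inverse t)"
  using nbhd_inverse[of U "t - 1"] by (auto simp: near_def)

lemma near_E: "U \<in> \<U> \<Longrightarrow> near U t \<Longrightarrow> t \<in> E"
  using nbhd_E[of U] E_closed(5)[of "t - 1" 1] E_closed(2) by (auto simp: near_def)

definition commutator :: "'a \<Rightarrow> 'a \<Rightarrow> 'a" where "commutator t g = t * g * inverse t * inverse g"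

lemma commutator_mult: "g \<noteq> 0 \<Longrightarrow> commutator t g * g = t * g * inverse t"
  by (simp add: commutator_def mult.assoc)

lemma commutator_eq_1: "t \<noteq> 0 \<Longrightarrow> g \<noteq> 0 \<Longrightarrow> commutator t g = 1 \<Longrightarrow> t * g = g * t"
  using commutator_mult[of g t] by (metis mult.assoc mult_1_left mult_1_right left_inverse)

lemma commutator_near:
  assumes "g \<in> E" "g \<noteq> 0" "U \<in> \<U>"
  obtains W where "W \<in> \<U>" "\<And>t. near W t \<Longrightarrow> near U (commutator t g)"
proof -
  obtain W1 where W1: "W1 \<in> \<U>" "\<forall>x\<in>W1. g * x \<in> U" using continuous_left assms by blast
  obtain W2 where W2: "W2 \<in> \<U>" "\<forall>x\<in>W2. x * inverse g \<in> W1"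
    using continuous_right W1(1) inverse_E assms(1) by blast
  obtain W where W: "W \<in> \<U>" "W \<subseteq> W2" "W \<subseteq> U" using directed W2 assms(3) by blast
  have "near U (commutator t g)" if t: "near W t" for t
  proof -
    have "inverse t - 1 \<in> W2" using near_inverse[OF W(1) t] W(2) by (auto simp: near_def)
    then have "g * ((inverse t - 1) * inverse g) \<in> U" using W1 W2 by blast
    also have "g * ((inverse t - 1) * inverse g) = g * inverse t * inverse g - 1"
      using assms(2) by (simp add: left_diff_distrib right_diff_distrib mult.assoc)
    finally have "near U (g * inverse t * inverse g)" unfolding near_def .
    then have "near U (t * (g * inverse t * inverse g))"
      by (rule near_mult[OF assms(3) near_mono[OF t W(3)]])
    then show ?thesis by (simp add: commutator_def mult.assoc)
  qed
  then show thesis using that W(1) by blast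
qed

text \<open>Induction on the degree. If 1 is no root, continuity of the polynomial excludes roots
  near 1; if it is, a factor \<open>c - 1\<close> splits off. The coefficients need not commute with
  \<open>c\<close>, but they stand on the left and \<open>c\<close> commutes with its own
  powers.\<close>

lemma roots_isolated:
  assumes "\<And>j. a j \<in> E" "\<exists>j\<le>d. a j \<noteq> 0"
  shows "\<exists>U\<in>\<U>. \<forall>c. near U c \<longrightarrow> c \<noteq> 1 \<longrightarrow> (\<Sum>j\<le>d. a j * c ^ j) \<noteq> 0"
  using assms
proof (induction d arbitrary: a)
  case 0
  then show ?case using nonempty by auto
next
  case (Suc d)
  let ?A = "\<Sum>j\<le>Suc d. a j"
  have AE: "?A \<in> E" using Suc.prems(1) by (intro is_subring_sum[OF subring_E]) auto
  show ?case
  proof (cases "?A = 0")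
    case False
    then obtain U where U: "U \<in> \<U>" "?A \<notin> U" using hausdorff AE by blast
    have "\<exists>f. \<forall>j. f j \<in> \<U> \<and> (\<forall>x\<in>f j. a j * x \<in> U)"
      by (rule choice) (use continuous_left Suc.prems(1) U(1) in blast)
    then obtain f where f: "\<And>j. f j \<in> \<U>" "\<And>j x. x \<in> f j \<Longrightarrow> a j * x \<in> U" by blast
    obtain W where W: "W \<in> \<U>" "\<And>j. j \<le> Suc d \<Longrightarrow> W \<subseteq> f j"
      using directed_finite[of "{..Suc d}" f] f(1) by auto
    have "(\<Sum>j\<le>Suc d. a j * c ^ j) \<noteq> 0" if "near W c" for c
    proof
      assume z: "(\<Sum>j\<le>Suc d. a j * c ^ j) = 0"
      have "(\<Sum>j\<le>Suc d. a j * (c ^ j - 1)) \<in> U"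
        using near_power[OF W(1) that] W(2) f(2) by (intro nbhd_sum[OF U(1)]) (metis atMost_iff near_def subsetD)
      also have "(\<Sum>j\<le>Suc d. a j * (c ^ j - 1)) = - ?A"
        using z by (simp add: right_diff_distrib sum_subtractf del: sum.atMost_Suc)
      finally have "0 - (- ?A) \<in> U" using nbhd_diff[OF U(1) nbhd_0[OF U(1)]] by blast
      then show False using U(2) by (simp del: sum.atMost_Suc)
    qed
    then show ?thesis using W(1) by blast
  next
    case True
    \<comment> \<open>The coefficients of the quotient by \<open>c - 1\<close>: partial sums of the
      \<open>a i\<close> from the top.\<close>
    define b where "b j = (\<Sum>i\<in>{Suc j..Suc d}. a i)" for j
    have bE: "b j \<in> E" for j unfolding b_def using Suc.prems(1) by (intro is_subring_sum[OF subring_E]) auto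
    have sum_eq: "(\<Sum>j\<le>Suc d. a j * c ^ j) = ?A + (\<Sum>j\<le>d. b j * c ^ j) * (c - 1)" for c
    proof -
      let ?P = "\<Sum>j\<le>d. b j * c ^ j" and ?Q = "\<Sum>j\<le>d. b j * c ^ Suc j"
        and ?R = "\<Sum>j\<le>d. b (Suc j) * c ^ Suc j"
      have PQ: "?P * (c - 1) = ?Q - ?P"
        by (simp add: right_diff_distrib sum_distrib_right mult.assoc power_commutes)
      have "?P = b 0 + (\<Sum>j<d. b (Suc j) * c ^ Suc j)"
        by (simp add: lessThan_Suc_atMost[symmetric] sum.lessThan_Suc_shift del: sum.lessThan_Suc)
      also have "\<dots> = b 0 + ?R"
        by (simp add: lessThan_Suc_atMost[symmetric] b_def)
      finally have PR: "?P = b 0 + ?R" .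
      have "?Q - ?R = (\<Sum>j\<le>d. (b j - b (Suc j)) * c ^ Suc j)"
        by (simp add: left_diff_distrib sum_subtractf)
      also have "\<dots> = (\<Sum>j\<le>d. a (Suc j) * c ^ Suc j)"
      proof (rule sum.cong)
        fix j assume "j \<in> {..d}"
        then have "b j = a (Suc j) + b (Suc j)"
          unfolding b_def by (simp add: sum.atLeast_Suc_atMost[of "Suc j"] del: sum.cl_ivl_Suc)
        then show "(b j - b (Suc j)) * c ^ Suc j = a (Suc j) * c ^ Suc j" by simp
      qed simp
      also have "\<dots> = (\<Sum>j\<le>Suc d. a j * c ^ j) - a 0"
        by (subst sum.atMost_Suc_shift) simp
      finally have QR: "?Q - ?R = (\<Sum>j\<le>Suc d. a j * c ^ j) - a 0" .
      have b0: "b 0 = ?A - a 0"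
        by (subst sum.atMost_Suc_shift) (simp add: b_def sum.shift_bounds_cl_Suc_ivl atLeast0AtMost del: sum.cl_ivl_Suc)
      have "?P * (c - 1) = (?Q - ?R) - b 0" unfolding PQ using PR by (simp add: diff_diff_add add.commute)
      then show ?thesis unfolding QR b0 by (simp del: sum.atMost_Suc)
    qed
    have "\<exists>j\<le>d. b j \<noteq> 0"
    proof (rule ccontr)
      assume n: "\<not> ?thesis"
      have b0: "b j = 0" for j using n by (cases "j \<le> d") (auto simp: b_def)
      have "a (Suc j) = 0" if "j \<le> d" for j
        using b0[of j] b0[of "Suc j"] that unfolding b_def
        by (simp add: sum.atLeast_Suc_atMost[of "Suc j"] del: sum.cl_ivl_Suc)
      moreover have "a 0 = 0"
        using True calculation by (subst (asm) sum.atMost_Suc_shift) simp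
      ultimately show False using Suc.prems(2) by (metis Suc_le_mono not0_implies_Suc)
    qed
    then obtain U where "U \<in> \<U>" "\<And>c. near U c \<Longrightarrow> c \<noteq> 1 \<Longrightarrow> (\<Sum>j\<le>d. b j * c ^ j) \<noteq> 0"
      using Suc.IH[of b] bE by blast
    then show ?thesis unfolding sum_eq True by (intro bexI[of _ U]) auto
  qed
qed

end

section \<open>Almost subnormal subgroups\<close>

definition mult_subgroup :: "'a::division_ring set \<Rightarrow> bool" where
  "mult_subgroup H \<longleftrightarrow> 0 \<notin> H \<and> 1 \<in> H \<and> (\<forall>x\<in>H. \<forall>y\<in>H. x * y \<in> H) \<and> (\<forall>x\<in>H. inverse x \<in> H)"

lemma mult_subgroupD:
  assumes "mult_subgroup H"
  shows "x \<in> H \<Longrightarrow> x \<noteq> 0" "1 \<in> H" "x \<in> H \<Longrightarrow> y \<in> H \<Longrightarrow> x * y \<in> H" "x \<in> H \<Longrightarrow> inverse x \<in> H"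
  using assms by (auto simp: mult_subgroup_def)

definition normal_in :: "'a::division_ring set \<Rightarrow> 'a set \<Rightarrow> bool" where
  "normal_in H K \<longleftrightarrow> (\<forall>k\<in>K. \<forall>h\<in>H. k * h * inverse k \<in> H)"

text \<open>Any finite labelling of \<open>K\<close> that separates the right cosets of
  \<open>H\<close> will do. Labels are sets so that the cosets themselves can serve.\<close>

definition finite_index_in :: "'a::division_ring set \<Rightarrow> 'a set \<Rightarrow> bool" where
  "finite_index_in H K \<longleftrightarrow>
     (\<exists>\<kappa> :: 'a \<Rightarrow> 'a set. finite (\<kappa> ` K) \<and> (\<forall>s\<in>K. \<forall>t\<in>K. \<kappa> s = \<kappa> t \<longrightarrow> s * inverse t \<in> H))"

text \<open>Generated downwards from the full multiplicative group, so that rule induction supplies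
  a claim for the next larger term \<open>K\<close> when it is to be shown for
  \<open>H\<close>.\<close>

inductive almost_subnormal_set :: "'a::division_ring set \<Rightarrow> bool" where
  top: "almost_subnormal_set (- {0})"
| step: "almost_subnormal_set K \<Longrightarrow> mult_subgroup H \<Longrightarrow> H \<subseteq> K \<Longrightarrow> normal_in H K \<or> finite_index_in H K
    \<Longrightarrow> almost_subnormal_set H"

lemma almost_subnormal_subgroup: "almost_subnormal_set H \<Longrightarrow> mult_subgroup H"
  by (induction rule: almost_subnormal_set.induct) (auto simp: mult_subgroup_def)

locale algebraic_linear_topology = linear_topology E \<U> for E :: "'a::division_ring set" and \<U> +
  fixes F
  assumes F_E: "F \<subseteq> E" and F_central: "f \<in> F \<Longrightarrow> x \<in> E \<Longrightarrow> f * x = x * f"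
    and algebraic: "g \<in> E \<Longrightarrow> \<exists>d f. (\<forall>j. f j \<in> F) \<and> (\<exists>j\<le>d::nat. f j \<noteq> 0) \<and> (\<Sum>j\<le>d. f j * g ^ j) = 0"
    and absorbing: "x \<in> E \<Longrightarrow> U \<in> \<U> \<Longrightarrow> \<exists>f\<in>F. f \<noteq> 0 \<and> f * x \<in> U"
    and commutator_torsion: "x \<in> E \<Longrightarrow> y \<in> E \<Longrightarrow> x \<noteq> 0 \<Longrightarrow> y \<noteq> 0 \<Longrightarrow> k > 0 \<Longrightarrow> commutator x y ^ k \<in> F
      \<Longrightarrow> \<exists>m>0. commutator x y ^ m = 1"
    and no_small_torsion: "\<exists>U\<in>\<U>. \<forall>c k. near U c \<longrightarrow> k > 0 \<longrightarrow> c ^ k = 1 \<longrightarrow> c = 1"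
begin

text \<open>The coefficients \<open>f j\<close> are central, so the conjugate \<open>c * g\<close>
  of \<open>g\<close> is again a root. As \<open>c\<close> commutes with \<open>g\<close>, its
  powers are \<open>g ^ j * c ^ j\<close>, and the equation becomes one for \<open>c\<close> with
  coefficients \<open>f j * g ^ j\<close>, to which \<open>roots_isolated\<close> applies.\<close>

lemma conjugation_isolated:
  assumes g: "g \<in> E" "g \<noteq> 0"
  obtains U where "U \<in> \<U>" "\<And>t. t \<in> E \<Longrightarrow> t \<noteq> 0 \<Longrightarrow> near U (commutator t g) \<Longrightarrow>
    commutator t g * g = g * commutator t g \<Longrightarrow> t * g = g * t"
proof -
  obtain d f where f: "\<And>j. f j \<in> F" "\<exists>j\<le>d. f j \<noteq> 0" "(\<Sum>j\<le>d. f j * g ^ j) = 0"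
    using algebraic[OF g(1)] by blast
  define a where "a j = f j * g ^ j" for j
  have aE: "a j \<in> E" for j unfolding a_def using f(1) F_E g(1) by (auto intro!: E_closed(6,7))
  have a0: "\<exists>j\<le>d. a j \<noteq> 0" unfolding a_def using f(2) g(2) by simp
  obtain U where U: "U \<in> \<U>" "\<And>c. near U c \<Longrightarrow> c \<noteq> 1 \<Longrightarrow> (\<Sum>j\<le>d. a j * c ^ j) \<noteq> 0"
    using roots_isolated[of a d] aE a0 by blast
  have "t * g = g * t" if t: "t \<in> E" "t \<noteq> 0" "near U (commutator t g)"
    and c: "commutator t g * g = g * commutator t g" for t
  proof -
    let ?c = "commutator t g"
    have cg: "(?c * g) ^ j = t * g ^ j * inverse t" for j
    proof (induction j)
      case (Suc j)
      have "(?c * g) ^ Suc j = (t * g ^ j * inverse t) * (t * g * inverse t)"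
        unfolding commutator_mult[OF g(2)] using Suc commutator_mult[OF g(2)] by (simp add: power_Suc2 del: power_Suc)
      also have "\<dots> = t * g ^ j * (inverse t * t) * g * inverse t" by (simp only: mult.assoc)
      finally show ?case using t(2) by (simp add: power_Suc2 mult.assoc del: power_Suc)
    qed (use t in simp)
    have "(\<Sum>j\<le>d. a j * ?c ^ j) = (\<Sum>j\<le>d. f j * (?c * g) ^ j)"
      unfolding a_def
    proof (rule sum.cong)
      fix j
      have "?c ^ j * g ^ j = (?c * g) ^ j"
        using twisted_product_power[of g ?c 1 j] c by simp
      moreover have "g ^ j * ?c ^ j = ?c ^ j * g ^ j"
        using c by (metis commute_power)
      ultimately show "f j * g ^ j * ?c ^ j = f j * (?c * g) ^ j" by (simp add: mult.assoc)
    qed simp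
    also have "\<dots> = (\<Sum>j\<le>d. t * (f j * g ^ j) * inverse t)"
      unfolding cg using F_central[OF f(1) t(1)] by (intro sum.cong) (simp_all add: mult.assoc[symmetric])
    also have "\<dots> = t * (\<Sum>j\<le>d. f j * g ^ j) * inverse t"
      by (simp add: sum_distrib_left sum_distrib_right)
    finally have "?c = 1" using U(2)[OF t(3)] f(3) by auto
    then show ?thesis using commutator_eq_1 t(2) g(2) by blast
  qed
  then show thesis using that U(1) by blast
qed

text \<open>Intersected with \<open>E\<close>, because the topology lives on \<open>E\<close> while
  \<open>H\<close> is a subgroup of the whole division ring.\<close>

definition locally_centralizes :: "'a set \<Rightarrow> 'a \<Rightarrow> bool" where
  "locally_centralizes H g \<longleftrightarrow> (\<exists>U\<in>\<U>. \<forall>t\<in>H \<inter> E. near U t \<longrightarrow> t * g = g * t)"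

lemma commutator_mem:
  assumes "mult_subgroup H" "normal_in H K" "t \<in> K" "g \<in> H"
  shows "commutator t g \<in> H"
  using assms mult_subgroupD(3,4)[OF assms(1)] unfolding normal_in_def commutator_def by blast

lemma commutator_E: "t \<in> E \<Longrightarrow> g \<in> E \<Longrightarrow> commutator t g \<in> E"
  unfolding commutator_def using E_closed by simp

lemma locally_centralizes_normal:
  assumes "mult_subgroup H" "normal_in H K" "0 \<notin> K" "g \<in> H" "g \<in> E" "locally_centralizes H g"
  shows "locally_centralizes K g"
proof -
  have g0: "g \<noteq> 0" using assms(1,4) mult_subgroupD(1) by blast
  obtain U where U: "U \<in> \<U>" "\<And>t. t \<in> H \<Longrightarrow> t \<in> E \<Longrightarrow> near U t \<Longrightarrow> t * g = g * t"
    using assms(6) unfolding locally_centralizes_def by blast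
  obtain U' where U': "U' \<in> \<U>" "\<And>t. t \<in> E \<Longrightarrow> t \<noteq> 0 \<Longrightarrow> near U' (commutator t g) \<Longrightarrow>
      commutator t g * g = g * commutator t g \<Longrightarrow> t * g = g * t"
    using conjugation_isolated[OF assms(5) g0] by blast
  obtain U'' where U'': "U'' \<in> \<U>" "U'' \<subseteq> U" "U'' \<subseteq> U'" using directed U(1) U'(1) by blast
  obtain W where W: "W \<in> \<U>" "\<And>t. near W t \<Longrightarrow> near U'' (commutator t g)"
    using commutator_near[OF assms(5) g0 U''(1)] by blast
  have "t * g = g * t" if t: "t \<in> K" "t \<in> E" "near W t" for t
  proof (rule U'(2)[OF t(2)])
    show "t \<noteq> 0" using t(1) assms(3) by auto
    show "near U' (commutator t g)" using near_mono W(2)[OF t(3)] U''(3) by blast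
    show "commutator t g * g = g * commutator t g"
      using U(2) commutator_mem[OF assms(1,2) t(1) assms(4)] commutator_E[OF t(2) assms(5)]
        near_mono W(2)[OF t(3)] U''(2) by blast
  qed
  then show ?thesis unfolding locally_centralizes_def using W(1) by blast
qed

text \<open>If elements of \<open>K\<close> accumulating at 1 fail to commute with \<open>g\<close>, then some coset of \<open>H\<close> contains
  such elements \<open>t\<^sub>1\<close> and \<open>t \<longlongrightarrow> 1\<close>; as \<open>t * inverse t\<^sub>1\<close> commutes with \<open>g\<close>, so does its limit.\<close>

lemma locally_centralizes_finite_index:
  assumes "finite_index_in H K" "g \<in> E" "locally_centralizes H g"
  shows "locally_centralizes K g"
proof (rule ccontr)
  assume n: "\<not> ?thesis"
  define bad where "bad = {t \<in> K \<inter> E. t * g \<noteq> g * t}"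
  have bad: "\<exists>t\<in>bad. near U t" if "U \<in> \<U>" for U
    using n that unfolding locally_centralizes_def bad_def by blast
  obtain \<kappa> :: "'a \<Rightarrow> 'a set" where \<kappa>: "finite (\<kappa> ` K)" "\<And>s t. s \<in> K \<Longrightarrow> t \<in> K \<Longrightarrow> \<kappa> s = \<kappa> t \<Longrightarrow> s * inverse t \<in> H"
    using assms(1) unfolding finite_index_in_def by blast
  define Q where "Q k U \<longleftrightarrow> (\<exists>t\<in>bad. near U t \<and> \<kappa> t = k)" for k U
  \<comment> \<open>Otherwise every label has a neighbourhood free of bad elements with that label,
    and the finitely many labels share a smaller one without any bad element.\<close>
  have "\<exists>k. \<forall>U\<in>\<U>. Q k U"
  proof (rule ccontr)
    assume "\<not> ?thesis"
    then have "\<forall>k. \<exists>U. U \<in> \<U> \<and> \<not> Q k U" by blast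
    then have "\<exists>f. \<forall>k. f k \<in> \<U> \<and> \<not> Q k (f k)" by (rule choice)
    then obtain f where f: "\<And>k. f k \<in> \<U>" "\<And>k. \<not> Q k (f k)" by blast
    obtain W where W: "W \<in> \<U>" "\<And>k. k \<in> \<kappa> ` K \<Longrightarrow> W \<subseteq> f k"
      using directed_finite[OF \<kappa>(1), of f] f(1) by blast
    obtain t where t: "t \<in> bad" "near W t" using bad[OF W(1)] by blast
    then have "\<kappa> t \<in> \<kappa> ` K" unfolding bad_def by blast
    then have "near (f (\<kappa> t)) t" using near_mono[OF t(2)] W(2) by blast
    then show False using f(2) t(1) unfolding Q_def by blast
  qed
  then obtain k where k: "\<And>U. U \<in> \<U> \<Longrightarrow> \<exists>t\<in>bad. near U t \<and> \<kappa> t = k"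
    unfolding Q_def by blast
  obtain U where U: "U \<in> \<U>" "\<And>t. t \<in> H \<Longrightarrow> t \<in> E \<Longrightarrow> near U t \<Longrightarrow> t * g = g * t"
    using assms(3) unfolding locally_centralizes_def by blast
  obtain s where s: "s \<in> bad" "near U s" "\<kappa> s = k" using k[OF U(1)] by blast
  define r where "r = inverse s"
  have r: "r \<noteq> 0" "near U r" "r \<in> E" using near_inverse[OF U(1) s(2)] near_E[OF U(1)] unfolding r_def by auto
  \<comment> \<open>For every \<open>t\<close> near 1 with the label of \<open>s\<close>,
    \<open>t * r\<close> commutes with \<open>g\<close>, which makes \<open>h\<close> equal to
    \<open>g * ((t - 1) * r) - (t - 1) * (r * g)\<close>. So \<open>h\<close> lies in every
    neighbourhood of 0, although it is not 0.\<close>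
  define h where "h = r * g - g * r"
  have hE: "h \<in> E" unfolding h_def using r(3) assms(2) E_closed by simp
  have "h \<noteq> 0"
  proof
    assume "h = 0"
    then have "s * (r * g) * s = s * (g * r) * s" unfolding h_def by simp
    moreover have "s \<noteq> 0" using r(1) r_def by auto
    then have "s * (r * g) * s = g * s" "s * (g * r) * s = s * g"
      unfolding r_def by (simp_all add: mult.assoc) (simp_all add: mult.assoc[symmetric])
    ultimately show False using s(1) unfolding bad_def by simp
  qed
  then obtain W where W: "W \<in> \<U>" "h \<notin> W" using hausdorff hE by blast
  obtain W1 where W1: "W1 \<in> \<U>" "\<And>x. x \<in> W1 \<Longrightarrow> x * (r * g) \<in> W"
    using continuous_right[OF E_closed(6)[OF r(3) assms(2)] W(1)] by blast
  obtain W2 where W2: "W2 \<in> \<U>" "\<And>x. x \<in> W2 \<Longrightarrow> g * x \<in> W"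
    using continuous_left[OF assms(2) W(1)] by blast
  obtain W3 where W3: "W3 \<in> \<U>" "\<And>x. x \<in> W3 \<Longrightarrow> x * r \<in> W2"
    using continuous_right[OF r(3) W2(1)] by blast
  obtain N where N: "N \<in> \<U>" "\<forall>i\<in>{W1, W3, U}. N \<subseteq> i"
    using directed_finite[of "{W1, W3, U}" "\<lambda>i. i"] W1(1) W3(1) U(1) by auto
  obtain t where t: "t \<in> bad" "near N t" "\<kappa> t = k" using k[OF N(1)] by blast
  have "t * r \<in> H" unfolding r_def using \<kappa>(2) t s unfolding bad_def by auto
  moreover have "near U (t * r)" using near_mult[OF U(1) near_mono[OF t(2)] r(2)] N(2) by blast
  moreover have "t * r \<in> E" using near_E[OF U(1)] calculation(2) by blast
  ultimately have "t * r * g = g * (t * r)" using U(2) by blast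
  then have "h = g * ((t - 1) * r) - (t - 1) * (r * g)"
    unfolding h_def by (simp add: algebra_simps)
  moreover have "t - 1 \<in> W1" "t - 1 \<in> W3" using t(2) N(2) unfolding near_def by auto
  ultimately show False using nbhd_diff[OF W(1) W2(2)[OF W3(2)] W1(2)] W(2) by simp
qed

text \<open>Absorption puts \<open>1 + f * b\<close> near 1 for some nonzero central
  \<open>f\<close>; if this commutes with \<open>g\<close>, so does \<open>b\<close>.\<close>

lemma locally_centralizes_top:
  assumes "locally_centralizes (- {0}) g" "g \<in> E" "b \<in> E"
  shows "b * g = g * b"
proof -
  obtain U where U: "U \<in> \<U>" "\<And>t. t \<noteq> 0 \<Longrightarrow> t \<in> E \<Longrightarrow> near U t \<Longrightarrow> t * g = g * t"
    using assms(1) unfolding locally_centralizes_def by blast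
  obtain f where f: "f \<in> F" "f \<noteq> 0" "f * b \<in> U" using absorbing[OF assms(3) U(1)] by blast
  have "near U (1 + f * b)" using f(3) by (simp add: near_def)
  then have "(1 + f * b) * g = g * (1 + f * b)"
    using U(2) near_inverse[OF U(1)] near_E[OF U(1)] by blast
  then have "f * (b * g) = (g * f) * b"
    by (simp add: distrib_left distrib_right mult.assoc)
  also have "\<dots> = f * (g * b)"
    by (simp only: F_central[OF f(1) assms(2), symmetric] mult.assoc)
  finally have "f * (b * g) = f * (g * b)" .
  then show ?thesis using f(2) by simp
qed

lemma locally_centralizes_imp_central:
  assumes "almost_subnormal_set H" "g \<in> H" "g \<in> E" "locally_centralizes H g" "b \<in> E"
  shows "b * g = g * b"
  using assms
proof (induction arbitrary: b rule: almost_subnormal_set.induct)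
  case top
  then show ?case using locally_centralizes_top by blast
next
  case (step K H)
  have "0 \<notin> K" using almost_subnormal_subgroup[OF step.hyps(1)] by (auto simp: mult_subgroup_def)
  then have "locally_centralizes K g"
    using step.hyps(4) locally_centralizes_normal[OF step.hyps(2)] locally_centralizes_finite_index step.prems by blast
  then show ?case using step.IH step.prems step.hyps(3) by blast
qed

theorem central_if_commutators_commute:
  assumes "almost_subnormal_set H" "g \<in> H" "g \<in> E"
    and "\<And>t. t \<in> H \<Longrightarrow> t \<in> E \<Longrightarrow> commutator t g * g = g * commutator t g"
    and "b \<in> E"
  shows "b * g = g * b"
proof (rule locally_centralizes_imp_central[OF assms(1-3) _ assms(5)])
  have H0: "\<And>t. t \<in> H \<Longrightarrow> t \<noteq> 0" using almost_subnormal_subgroup[OF assms(1)] mult_subgroupD(1) by blast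
  obtain U where U: "U \<in> \<U>" "\<And>t. t \<in> E \<Longrightarrow> t \<noteq> 0 \<Longrightarrow> near U (commutator t g) \<Longrightarrow>
      commutator t g * g = g * commutator t g \<Longrightarrow> t * g = g * t"
    using conjugation_isolated[OF assms(3) H0[OF assms(2)]] by blast
  obtain W where "W \<in> \<U>" "\<And>t. near W t \<Longrightarrow> near U (commutator t g)"
    using commutator_near[OF assms(3) H0[OF assms(2)] U(1)] by blast
  then show "locally_centralizes H g"
    unfolding locally_centralizes_def using U(2) assms(4) H0 by blast
qed

theorem central_if_radical:
  assumes "almost_subnormal_set H" "g \<in> H" "g \<in> E"
    and "\<And>t. t \<in> H \<Longrightarrow> t \<in> E \<Longrightarrow> \<exists>k>0. t ^ k \<in> F"
    and "b \<in> E"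
  shows "b * g = g * b"
proof (rule locally_centralizes_imp_central[OF assms(1-3) _ assms(5)])
  have H: "mult_subgroup H" using almost_subnormal_subgroup[OF assms(1)] .
  note H0 = mult_subgroupD(1)[OF H]
  obtain U where U: "U \<in> \<U>" "\<And>c k. near U c \<Longrightarrow> k > 0 \<Longrightarrow> c ^ k = 1 \<Longrightarrow> c = 1"
    using no_small_torsion by blast
  obtain W where W: "W \<in> \<U>" "\<And>t. near W t \<Longrightarrow> near U (commutator t g)"
    using commutator_near[OF assms(3) H0[OF assms(2)] U(1)] by blast
  have "t * g = g * t" if t: "t \<in> H" "t \<in> E" "near W t" for t
  proof -
    have "commutator t g \<in> H"
      unfolding commutator_def using mult_subgroupD(3,4)[OF H] t(1) assms(2) by blast
    then obtain k where "k > 0" "commutator t g ^ k \<in> F"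
      using assms(4) commutator_E[OF t(2) assms(3)] by blast
    then obtain m where "m > 0" "commutator t g ^ m = 1"
      using commutator_torsion t(2) assms(3) H0[OF t(1)] H0[OF assms(2)] by blast
    then have "commutator t g = 1" using U(2) W(2)[OF t(3)] by blast
    then show ?thesis using commutator_eq_1 H0 t(1) assms(2) by blast
  qed
  then show "locally_centralizes H g" unfolding locally_centralizes_def using W(1) by blast
qed

end

section \<open>Determinants over the center\<close>

text \<open>A determinant over the field \<open>F\<close>, which is only a subset of a noncommutative type, is computed
  in a commutative ring \<^emph>\<open>type\<close> that contains every such \<open>F\<close>: families indexed by all subsets \<open>S\<close>,
  the component at \<open>S\<close> lying in the center of the centralizer of \<open>S\<close>.\<close>

definition bicenter :: "'a::ring_1 set \<Rightarrow> 'a set" where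
  "bicenter S = commutant (commutant UNIV S) (commutant UNIV S)"

lemma is_subring_bicenter: "is_subring (bicenter S)"
  unfolding bicenter_def by (intro is_subring_commutant) (simp add: is_subring_def)

lemma bicenter_commute: "x \<in> bicenter S \<Longrightarrow> y \<in> bicenter S \<Longrightarrow> x * y = y * x"
  unfolding bicenter_def 
  by (rule commutantD(2)[of x "commutant UNIV S" "commutant UNIV S"]) (auto dest: commutantD(1))

typedef (overloaded) 'a center_family = "{\<phi> :: 'a::ring_1 set \<Rightarrow> 'a. \<forall>S. \<phi> S \<in> bicenter S}"
  by (rule exI[of _ "\<lambda>_. 0"]) (simp add: is_subringD(1)[OF is_subring_bicenter])

lemma Rep_bicenter: "Rep_center_family x S \<in> bicenter S"
  using Rep_center_family[of x] by blast

lemma Rep_Abs: "(\<And>S. \<phi> S \<in> bicenter S) \<Longrightarrow> Rep_center_family (Abs_center_family \<phi>) = \<phi>"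
  by (simp add: Abs_center_family_inverse)

instantiation center_family :: (ring_1) "{zero, one, plus, minus, uminus, times}"
begin

definition "0 = Abs_center_family (\<lambda>_. 0)"
definition "1 = Abs_center_family (\<lambda>_. 1)"
definition "x + y = Abs_center_family (\<lambda>S. Rep_center_family x S + Rep_center_family y S)"
definition "x - y = Abs_center_family (\<lambda>S. Rep_center_family x S - Rep_center_family y S)"
definition "- x = Abs_center_family (\<lambda>S. - Rep_center_family x S)"
definition "x * y = Abs_center_family (\<lambda>S. Rep_center_family x S * Rep_center_family y S)"

instance ..

end

lemma Rep_center_family_simps:
  "Rep_center_family 0 S = 0" "Rep_center_family 1 S = 1"
  "Rep_center_family (x + y) S = Rep_center_family x S + Rep_center_family y S"
  "Rep_center_family (x - y) S = Rep_center_family x S - Rep_center_family y S"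
  "Rep_center_family (- x) S = - Rep_center_family x S"
  "Rep_center_family (x * y) S = Rep_center_family x S * Rep_center_family y S"
  unfolding zero_center_family_def one_center_family_def plus_center_family_def minus_center_family_def
    uminus_center_family_def times_center_family_def
  by (subst Rep_Abs; simp add: is_subringD[OF is_subring_bicenter] Rep_bicenter)+

lemma center_family_eqI: "(\<And>S. Rep_center_family x S = Rep_center_family y S) \<Longrightarrow> x = y"
  by (metis Rep_center_family_inject ext)

instance center_family :: (ring_1) comm_ring_1
proof
  fix x y :: "'a center_family"
  show "x * y = y * x"
    by (rule center_family_eqI) (simp add: Rep_center_family_simps bicenter_commute[OF Rep_bicenter Rep_bicenter])
  show "(0 :: 'a center_family) \<noteq> 1"
    using Rep_center_family_simps(1,2) by (metis zero_neq_one)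
qed (rule center_family_eqI; simp add: Rep_center_family_simps algebra_simps)+

lemma Rep_center_family_sum: "Rep_center_family (sum f I) S = (\<Sum>i\<in>I. Rep_center_family (f i) S)"
  by (induction I rule: infinite_finite_induct) (simp_all add: Rep_center_family_simps)

lemma Rep_center_family_power: "Rep_center_family (x ^ k) S = Rep_center_family x S ^ k"
  by (induction k) (simp_all add: Rep_center_family_simps)

section \<open>Linear algebra and the regular norm over a central subfield\<close>

lemma (in subfield_set) homogeneous_system:
  assumes "finite J" "card J > k" "\<And>j i. j \<in> J \<Longrightarrow> i < k \<Longrightarrow> a j i \<in> F"
  shows "\<exists>f. (\<forall>j\<in>J. f j \<in> F) \<and> (\<exists>j\<in>J. f j \<noteq> 0) \<and> (\<forall>i<k. (\<Sum>j\<in>J. f j * a j i) = 0)"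
  using assms
proof (induction k arbitrary: J a)
  case 0
  then have "J \<noteq> {}" by auto
  then show ?case using F_closed(2) by (intro exI[of _ "\<lambda>_. 1"]) auto
next
  case (Suc k)
  show ?case
  proof (cases "\<forall>j\<in>J. a j k = 0")
    case True
    obtain f where "\<forall>j\<in>J. f j \<in> F" "\<exists>j\<in>J. f j \<noteq> 0" "\<forall>i<k. (\<Sum>j\<in>J. f j * a j i) = 0"
      using Suc.IH[of J a] Suc.prems by auto
    then show ?thesis using True by (intro exI[of _ f]) (auto simp: less_Suc_eq)
  next
    case False
    then obtain p where p: "p \<in> J" "a p k \<noteq> 0" by blast
    \<comment> \<open>Gaussian elimination: equation \<open>k\<close> is solved for the unknown
      \<open>p\<close>, which leaves \<open>k\<close> equations in one unknown fewer.\<close>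
    define r where "r j = a j k * inverse (a p k)" for j
    have rF: "r j \<in> F" if "j \<in> J" for j
      unfolding r_def using Suc.prems(3)[OF that] Suc.prems(3)[OF p(1)] F_closed by simp
    define b where "b j i = a j i - r j * a p i" for j i
    have bF: "b j i \<in> F" if "j \<in> J - {p}" "i < k" for j i
      unfolding b_def using Suc.prems(3)[of j i] Suc.prems(3)[OF p(1), of i] that rF F_closed by simp
    have "k < card (J - {p})"
      using Suc.prems(1,2) p(1) by (simp add: card_Diff_singleton)
    then obtain f where f: "\<forall>j\<in>J - {p}. f j \<in> F" "\<exists>j\<in>J - {p}. f j \<noteq> 0"
      "\<forall>i<k. (\<Sum>j\<in>J - {p}. f j * b j i) = 0"
      using Suc.IH[of "J - {p}" b] Suc.prems(1) bF by blast
    define f' where "f' = f(p := - (\<Sum>j\<in>J - {p}. f j * r j))"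
    have sum_f': "(\<Sum>j\<in>J. f' j * a j i) = (\<Sum>j\<in>J - {p}. f j * b j i)" for i
    proof -
      have "(\<Sum>j\<in>J. f' j * a j i) = f' p * a p i + (\<Sum>j\<in>J - {p}. f' j * a j i)"
        using Suc.prems(1) p(1) by (simp add: sum.remove)
      also have "(\<Sum>j\<in>J - {p}. f' j * a j i) = (\<Sum>j\<in>J - {p}. f j * a j i)"
        by (rule sum.cong) (auto simp: f'_def)
      also have "f' p * a p i + \<dots> = (\<Sum>j\<in>J - {p}. f j * b j i)"
        by (simp add: f'_def b_def right_diff_distrib sum_subtractf sum_distrib_right mult.assoc)
      finally show ?thesis .
    qed
    have "b j k = 0" for j unfolding b_def r_def using p(2) by (simp add: mult.assoc)
    then have "\<forall>i<Suc k. (\<Sum>j\<in>J. f' j * a j i) = 0"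
      unfolding sum_f' using f(3) by (auto simp: less_Suc_eq)
    moreover have "(\<Sum>j\<in>J - {p}. f j * r j) \<in> F"
      using f(1) rF F_closed(6) by (intro is_subring_sum[OF subring_F]) auto
    then have "\<forall>j\<in>J. f' j \<in> F" using f(1) F_closed(3) by (auto simp: f'_def)
    moreover have "\<exists>j\<in>J. f' j \<noteq> 0" using f(2) by (auto simp: f'_def)
    ultimately show ?thesis by blast
  qed
qed

locale fd_division = division_subring E + subfield_set F for E F :: "'a::division_ring set" +
  fixes e :: "nat \<Rightarrow> 'a" and n :: nat
  assumes F_E: "F \<subseteq> E" and F_central: "f \<in> F \<Longrightarrow> x \<in> E \<Longrightarrow> f * x = x * f"
    and e_E: "i < n \<Longrightarrow> e i \<in> E"
    and spanning: "x \<in> E \<Longrightarrow> \<exists>c. (\<forall>i. c i \<in> F) \<and> x = (\<Sum>i<n. c i * e i)"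
    and independent: "(\<And>i. i < n \<Longrightarrow> c i \<in> F) \<Longrightarrow> (\<Sum>i<n. c i * e i) = 0 \<Longrightarrow> i < n \<Longrightarrow> c i = 0"
begin

definition coord :: "'a \<Rightarrow> nat \<Rightarrow> 'a" where
  "coord x = (SOME c. (\<forall>i. c i \<in> F) \<and> x = (\<Sum>i<n. c i * e i))"

lemma coord_F: "x \<in> E \<Longrightarrow> coord x i \<in> F" and coord_sum: "x \<in> E \<Longrightarrow> x = (\<Sum>i<n. coord x i * e i)"
  using someI_ex[OF spanning] unfolding coord_def by blast+

lemma coord_eqI:
  assumes "\<And>i. i < n \<Longrightarrow> c i \<in> F" "x = (\<Sum>i<n. c i * e i)" "i < n"
  shows "coord x i = c i"
proof -
  have xE: "x \<in> E"
    unfolding assms(2) using assms(1) F_E e_E by (intro is_subring_sum[OF subring_E] E_closed(6)) auto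
  have "(\<Sum>i<n. (coord x i - c i) * e i) = 0"
    using coord_sum[OF xE] assms(2) by (simp add: left_diff_distrib sum_subtractf)
  then have "coord x i - c i = 0"
    using assms(1) coord_F[OF xE] F_closed(4) by (intro independent[of "\<lambda>i. coord x i - c i"] assms(3)) auto
  then show ?thesis by simp
qed

lemma coord_zero: "i < n \<Longrightarrow> coord 0 i = 0"
  by (rule coord_eqI) (auto intro: F_closed)

lemma coord_diff: "x \<in> E \<Longrightarrow> y \<in> E \<Longrightarrow> i < n \<Longrightarrow> coord (x - y) i = coord x i - coord y i"
  by (rule coord_eqI) 
     (auto intro: F_closed coord_F simp: left_diff_distrib sum_subtractf coord_sum[symmetric])

lemma coord_smult: "f \<in> F \<Longrightarrow> x \<in> E \<Longrightarrow> i < n \<Longrightarrow> coord (f * x) i = f * coord x i"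
  by (rule coord_eqI) 
     (auto intro: F_closed coord_F simp: mult.assoc sum_distrib_left[symmetric] coord_sum[symmetric])

lemma coord_e: "i < n \<Longrightarrow> j < n \<Longrightarrow> coord (e j) i = (if i = j then 1 else 0)"
  by (rule coord_eqI) (auto intro: F_closed simp: if_distrib[of "\<lambda>c. c * _"] sum.delta cong: if_cong)

lemma dimension_pos: "n > 0"
proof (rule ccontr)
  assume "\<not> n > 0"
  then have "(1::'a) = 0" using coord_sum[OF E_closed(2)] by simp
  then show False by simp
qed

lemma algebraic:
  assumes "g \<in> E"
  shows "\<exists>d f. (\<forall>j. f j \<in> F) \<and> (\<exists>j\<le>d::nat. f j \<noteq> 0) \<and> (\<Sum>j\<le>d. f j * g ^ j) = 0"
proof -
  have gE: "g ^ j \<in> E" for j by (rule E_closed(7)[OF assms])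
  \<comment> \<open>The \<open>n + 1\<close> powers of \<open>g\<close> up to \<open>g ^ n\<close>
    have only \<open>n\<close> coordinates each.\<close>
  obtain f where f: "\<forall>j\<in>{..n}. f j \<in> F" "\<exists>j\<in>{..n}. f j \<noteq> 0"
    "\<forall>i<n. (\<Sum>j\<in>{..n}. f j * coord (g ^ j) i) = 0"
    using homogeneous_system[of "{..n}" n "\<lambda>j. coord (g ^ j)"] coord_F[OF gE] by auto
  define h where "h j = (if j \<le> n then f j else 0)" for j
  have "(\<Sum>j\<le>n. h j * g ^ j) = (\<Sum>j\<le>n. f j * (\<Sum>i<n. coord (g ^ j) i * e i))"
    by (rule sum.cong) (auto simp: h_def coord_sum[OF gE, symmetric])
  also have "\<dots> = (\<Sum>i<n. (\<Sum>j\<le>n. f j * coord (g ^ j) i) * e i)"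
    unfolding sum_distrib_left sum_distrib_right by (subst sum.swap) (simp add: mult.assoc)
  also have "\<dots> = 0" using f(3) by simp
  finally show ?thesis
    using f(1,2) F_closed(1) by (intro exI[of _ n] exI[of _ h]) (auto simp: h_def)
qed

text \<open>Supported on the component at \<open>E\<close> alone, hence additive and multiplicative
  on \<open>F\<close> but not unital: \<open>lift 1\<close> is merely an idempotent. So
  \<open>norm_E 1\<close> is an idempotent too, and values of the norm are read off at
  \<open>E\<close>.\<close>

definition lift :: "'a \<Rightarrow> 'a center_family" where
  "lift x = Abs_center_family (\<lambda>S. if S = E then x else 0)"

lemma F_bicenter: "x \<in> F \<Longrightarrow> x \<in> bicenter E"
  unfolding bicenter_def commutant_def using F_central F_E by auto

lemma Rep_lift: "x \<in> F \<Longrightarrow> Rep_center_family (lift x) S = (if S = E then x else 0)"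
  unfolding lift_def by (subst Rep_Abs) (auto simp: F_bicenter is_subringD[OF is_subring_bicenter])

definition left_mult_mat :: "'a \<Rightarrow> 'a center_family mat" where
  "left_mult_mat x = mat n n (\<lambda>(i, j). lift (coord (x * e j) i))"

lemma coord_mult:
  assumes "x \<in> E" "y \<in> E" "i < n" "j < n"
  shows "coord (x * y * e j) i = (\<Sum>k<n. coord (x * e k) i * coord (y * e j) k)"
proof (rule coord_eqI[OF _ _ assms(3)])
  have E1: "x * e k \<in> E" "y * e k \<in> E" if "k < n" for k
    using that assms e_E E_closed(6) by auto
  show "(\<Sum>k<n. coord (x * e k) i * coord (y * e j) k) \<in> F" for i
    using E1 assms(4) by (intro is_subring_sum[OF subring_F] F_closed(6) coord_F) auto
  have "x * y * e j = x * (\<Sum>k<n. coord (y * e j) k * e k)"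
    using coord_sum[OF E1(2)[OF assms(4)]] by (simp add: mult.assoc)
  also have "\<dots> = (\<Sum>k<n. coord (y * e j) k * (x * e k))"
    unfolding sum_distrib_left
    using F_central[OF coord_F[OF E1(2)[OF assms(4)]] assms(1)] by (simp add: mult.assoc[symmetric])
  also have "\<dots> = (\<Sum>k<n. coord (y * e j) k * (\<Sum>i<n. coord (x * e k) i * e i))"
    using coord_sum[OF E1(1)] by (intro sum.cong) auto
  also have "\<dots> = (\<Sum>i<n. (\<Sum>k<n. coord (y * e j) k * coord (x * e k) i) * e i)"
    unfolding sum_distrib_left sum_distrib_right by (subst sum.swap) (simp add: mult.assoc)
  also have "\<dots> = (\<Sum>i<n. (\<Sum>k<n. coord (x * e k) i * coord (y * e j) k) * e i)"
    using comm_F coord_F E1 assms(4) by (intro sum.cong arg_cong[where f = "\<lambda>s. s * _"]) auto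
  finally show "x * y * e j = \<dots>" .
qed

lemma left_mult_mat_mult:
  assumes "x \<in> E" "y \<in> E"
  shows "left_mult_mat (x * y) = left_mult_mat x * left_mult_mat y"
proof (rule eq_matI)
  fix i j assume "i < dim_row (left_mult_mat x * left_mult_mat y)" "j < dim_col (left_mult_mat x * left_mult_mat y)"
  then have ij: "i < n" "j < n" by (auto simp: left_mult_mat_def)
  have E1: "x * e k \<in> E" "y * e k \<in> E" "x * y * e k \<in> E" if "k < n" for k
    using that assms e_E E_closed(6) by auto
  have "lift (coord (x * y * e j) i) = (\<Sum>k<n. lift (coord (x * e k) i) * lift (coord (y * e j) k))"
    by (rule center_family_eqI)
       (use E1 ij in \<open>auto simp: Rep_center_family_sum Rep_center_family_simps Rep_lift coord_F coord_mult[OF assms ij, symmetric]\<close>)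
  then show "left_mult_mat (x * y) $$ (i, j) = (left_mult_mat x * left_mult_mat y) $$ (i, j)"
    using ij by (simp add: left_mult_mat_def scalar_prod_def lessThan_atLeast0)
qed (simp_all add: left_mult_mat_def)

definition norm_E :: "'a \<Rightarrow> 'a center_family" where "norm_E x = det (left_mult_mat x)"

lemma norm_E_mult: "x \<in> E \<Longrightarrow> y \<in> E \<Longrightarrow> norm_E (x * y) = norm_E x * norm_E y"
  unfolding norm_E_def by (subst left_mult_mat_mult) (auto intro!: det_mult[of _ n] simp: left_mult_mat_def)

lemma norm_E_F:
  assumes "c \<in> F"
  shows "Rep_center_family (norm_E c) E = c ^ n"
proof -
  have "left_mult_mat c = lift c \<cdot>\<^sub>m 1\<^sub>m n"
    by (rule eq_matI)
       (auto simp: left_mult_mat_def coord_smult[OF assms e_E] coord_e Rep_center_family_simps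
         intro!: center_family_eqI simp: Rep_lift F_closed)
  then have "norm_E c = lift c ^ n" by (simp add: norm_E_def)
  then show ?thesis by (simp add: Rep_center_family_power Rep_lift assms)
qed

text \<open>The norm is multiplicative with values in a commutative ring, so a commutator and its
  powers have the norm of 1. On \<open>F\<close> it is the \<open>n\<close>-th power, so
  \<open>k * n\<close> is an exponent.\<close>

lemma commutator_power_torsion:
  assumes "x \<in> E" "y \<in> E" "x \<noteq> 0" "y \<noteq> 0" "k > 0" "(x * y * inverse x * inverse y) ^ k \<in> F"
  shows "\<exists>m>0. (x * y * inverse x * inverse y) ^ m = 1"
proof -
  let ?z = "x * y * inverse x * inverse y"
  have iE: "inverse x \<in> E" "inverse y \<in> E" using assms inverse_E by auto
  have one: "norm_E 1 * norm_E 1 = norm_E 1"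
    using norm_E_mult[of 1 1] E_closed(2) by simp
  have "norm_E ?z = (norm_E x * norm_E (inverse x)) * (norm_E y * norm_E (inverse y))"
    using assms(1,2) iE E_closed(6) by (simp add: norm_E_mult)
  also have "\<dots> = norm_E 1"
    using assms iE by (simp add: norm_E_mult[symmetric] one)
  finally have z1: "norm_E ?z = norm_E 1" .
  have zE: "?z \<in> E" using assms(1,2) iE E_closed(6) by simp
  have "norm_E (?z ^ j) = norm_E 1" for j
  proof (induction j)
    case (Suc j)
    then show ?case using norm_E_mult[OF zE E_closed(7)[OF zE]] z1 one by simp
  qed simp
  then have "(?z ^ k) ^ n = 1 ^ n"
    using norm_E_F[OF assms(6)] norm_E_F[OF F_closed(2)] by simp
  then show ?thesis using assms(5) dimension_pos by (intro exI[of _ "k * n"]) (simp add: power_mult)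
qed

end

section \<open>The topology of a valuation\<close>

context maximal_subring
begin

lemma V_F: "v \<in> V \<Longrightarrow> v \<in> F" using VF by blast

lemma common_denominator:
  assumes "finite A" "A \<subseteq> F"
  shows "\<exists>r\<in>V. r \<noteq> 0 \<and> (\<forall>a\<in>A. r * a \<in> V)"
  using assms
proof (induction A rule: finite_induct)
  case empty
  show ?case using V_closed(2) by (intro bexI[of _ 1]) auto
next
  case (insert a A)
  then obtain r where r: "r \<in> V" "r \<noteq> 0" "\<forall>a\<in>A. r * a \<in> V" by auto
  show ?case
  proof (cases "a \<in> V")
    case True
    then show ?thesis using r V_closed(6) by blast
  next
    case False
    then have i: "inverse a \<in> V" "a \<noteq> 0" using valuation[of a] insert.prems V_closed(1) by auto
    have "(r * inverse a) * b \<in> V" if "b \<in> A" for b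
      using comm_F[OF V_F[OF r(1)] V_F[OF i(1)]] V_closed(6)[OF i(1)] r(3) that by (simp add: mult.assoc)
    moreover have "(r * inverse a) * a \<in> V" using r(1) i(2) by (simp add: mult.assoc)
    ultimately have "\<forall>b\<in>insert a A. (r * inverse a) * b \<in> V" by blast
    then show ?thesis
      using r i V_closed(6) by (intro bexI[of _ "r * inverse a"]) auto
  qed
qed

end

section \<open>Lattices over the valuation ring\<close>

locale valued_division = fd_division E F e n + maximal_subring F V p
  for E F :: "'a::division_ring set" and e n V p +
  assumes e_mult: "i < n \<Longrightarrow> j < n \<Longrightarrow> k < n \<Longrightarrow> coord (e i * e j) k \<in> V"
begin

lemma V_E: "v \<in> V \<Longrightarrow> v \<in> E" using VF F_E by blast

lemma V_central: "v \<in> V \<Longrightarrow> x \<in> E \<Longrightarrow> v * x = x * v"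
  by (rule F_central[OF V_F])

text \<open>Closed under multiplication by \<open>e_mult\<close>, but possibly without 1. Hence
  elements such as -1 or a prime number are multiplied by \<open>e 0\<close> before a coordinate is
  read.\<close>

definition order :: "'a set" where "order = vspan V (e ` {..<n})"

lemma order_E: "x \<in> order \<Longrightarrow> x \<in> E"
  unfolding order_def by (rule vspan_minimal[OF subring_E]) (use V_E e_E in auto)

lemma order_iff: "x \<in> order \<longleftrightarrow> x \<in> E \<and> (\<forall>i<n. coord x i \<in> V)"
proof
  assume "x \<in> order"
  then have "\<forall>i<n. coord x i \<in> V"
    unfolding order_def
  proof (induction rule: vspan.induct)
    case zero
    show ?case by (simp add: coord_zero V_closed)
  next
    case (step y v b)
    then obtain j where j: "j < n" "b = e j" by auto
    have yE: "y \<in> E" using order_E step.hyps(1) unfolding order_def by blast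
    have vE: "- v \<in> F" "v * b \<in> E" "- v * b \<in> E"
      using F_closed(3)[OF V_F[OF step.hyps(2)]] E_closed(6)[OF V_E[OF step.hyps(2)] e_E[OF j(1)]] j E_closed(3)
      by simp_all
    have "coord (v * b + y) i = coord y i - (- v) * (if i = j then 1 else 0)" if "i < n" for i
      using coord_diff[OF yE vE(3) that] coord_smult[OF vE(1) e_E[OF j(1)] that] coord_e[OF that j(1)] j(2)
      by (simp add: add.commute)
    then show ?case using step V_closed by auto
  qed
  then show "x \<in> E \<and> (\<forall>i<n. coord x i \<in> V)" using order_E \<open>x \<in> order\<close> by blast
next
  assume x: "x \<in> E \<and> (\<forall>i<n. coord x i \<in> V)"
  have "(\<Sum>i<n. coord x i * e i) \<in> order"
    unfolding order_def using x by (intro vspan_sum vspan_base) auto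
  then show "x \<in> order" using coord_sum x by metis
qed

lemma order_coord: "x \<in> order \<Longrightarrow> i < n \<Longrightarrow> coord x i \<in> V"
  using order_iff by blast

lemma order_diff: "x \<in> order \<Longrightarrow> y \<in> order \<Longrightarrow> x - y \<in> order"
  unfolding order_iff using coord_diff V_closed(4) E_closed(4) by simp

lemma order_smult: "v \<in> V \<Longrightarrow> x \<in> order \<Longrightarrow> v * x \<in> order"
  unfolding order_def by (rule vspan_smult[OF subring_V])

lemma e_order: "i < n \<Longrightarrow> e i \<in> order"
  unfolding order_iff by (simp add: e_E coord_e V_closed)

lemma order_mult: "x \<in> order \<Longrightarrow> y \<in> order \<Longrightarrow> x * y \<in> order"
  unfolding order_def
proof (rule vspan_mult[OF subring_V])
  fix b c assume bc: "b \<in> e ` {..<n}" "c \<in> e ` {..<n}"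
  then have "b * c \<in> order" unfolding order_iff using e_mult e_E E_closed(6) by auto
  then show "b * c \<in> vspan V (e ` {..<n})" unfolding order_def .
next
  fix v b assume "v \<in> V" "b \<in> e ` {..<n}"
  then show "v * b = b * v" using V_central e_E by auto
qed

lemma order_absorbs:
  assumes "a \<in> E"
  obtains r where "r \<in> V" "r \<noteq> 0" "r * a \<in> order"
proof -
  obtain r where r: "r \<in> V" "r \<noteq> 0" "\<forall>a\<in>coord a ` {..<n}. r * a \<in> V"
    using common_denominator[of "coord a ` {..<n}"] coord_F[OF assms] by auto
  then have "r * a \<in> order"
    unfolding order_iff using coord_smult[OF V_F[OF r(1)] assms] E_closed(6)[OF V_E assms] by auto
  then show thesis using that r by blast
qed

text \<open>Of two nonzero elements of \<open>F\<close> one divides the other over \<open>V\<close>,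
  so a finite set has an element dividing all the others.\<close>

lemma maximal_value:
  assumes "finite A" "A \<noteq> {}" "A \<subseteq> F - {0}"
  shows "\<exists>m\<in>A. \<forall>a\<in>A. inverse m * a \<in> V"
  using assms
proof (induction A rule: finite_ne_induct)
  case (singleton x)
  then show ?case using V_closed(2) by simp
next
  case (insert x A)
  then obtain m where m: "m \<in> A" "\<forall>a\<in>A. inverse m * a \<in> V" by auto
  have F: "x \<in> F" "x \<noteq> 0" "m \<in> F" "m \<noteq> 0" using insert.prems m(1) by auto
  have "inverse (inverse m * x) = inverse x * m"
    using F by (simp add: nonzero_inverse_mult_distrib)
  then consider "inverse m * x \<in> V" | "inverse x * m \<in> V"
    using valuation[OF F_closed(6)[OF F_closed(9)[OF F(3)] F(1)]] by auto
  then show ?case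
  proof cases
    case 1
    then show ?thesis using m by blast
  next
    case 2
    have eq: "inverse x * a = (inverse x * m) * (inverse m * a)" for a
      using F(4) by (simp add: mult.assoc) (simp add: mult.assoc[symmetric])
    have "inverse x * a \<in> V" if "a \<in> A" for a
      by (subst eq) (rule V_closed(6)[OF 2 bspec[OF m(2) that]])
    moreover have "inverse x * x \<in> V" using V_closed(2) F(2) by simp
    ultimately have "\<forall>a\<in>insert x A. inverse x * a \<in> V" by blast
    then show ?thesis by blast
  qed
qed

text \<open>Divide by a coordinate of \<open>x\<close> that divides all the others over
  \<open>V\<close>: it becomes 1 and the rest fall into \<open>V\<close>.\<close>

lemma primitive_multiple:
  assumes "x \<in> E" "x \<noteq> 0"
  obtains y d i where "y \<in> F" "y \<noteq> 0" "d \<in> order" "i < n" "coord d i = 1" "x = y * d"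
proof -
  have "\<exists>i<n. coord x i \<noteq> 0"
  proof (rule ccontr)
    assume "\<not> ?thesis"
    then have "x = 0" using coord_sum[OF assms(1)] by simp
    then show False using assms(2) by simp
  qed
  then have "coord x ` {..<n} - {0} \<noteq> {}" by auto
  then obtain m where m: "m \<in> coord x ` {..<n} - {0}" "\<forall>a\<in>coord x ` {..<n} - {0}. inverse m * a \<in> V"
    using maximal_value[of "coord x ` {..<n} - {0}"] coord_F[OF assms(1)] by blast
  then obtain i where i: "i < n" "m = coord x i" "m \<noteq> 0" by auto
  have mF: "m \<in> F" "inverse m \<in> F" using i coord_F[OF assms(1)] F_closed(9) by auto
  have "inverse m * a \<in> V" if "a \<in> coord x ` {..<n}" for a
    using m(2) that V_closed(1) by (cases "a = 0") auto
  then have "inverse m * x \<in> order"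
    unfolding order_iff using coord_smult[OF mF(2) assms(1)] E_closed(6)[OF _ assms(1)] mF F_E by auto
  moreover have "coord (inverse m * x) i = 1"
    using coord_smult[OF mF(2) assms(1) i(1)] i by simp
  moreover have "x = m * (inverse m * x)" using i(3) by (simp add: mult.assoc[symmetric])
  ultimately show thesis using that[OF mF(1) i(3) _ i(1)] by blast
qed

text \<open>The radii are multiples of \<open>p\<close>, so that \<open>1 - s * v\<close> is a unit
  of \<open>V\<close> by \<open>one_plus_unit\<close>.\<close>

definition small :: "'a set" where "small = (\<lambda>v. p * v) ` (V - {0})"

definition ball :: "'a \<Rightarrow> 'a set" where "ball s = (\<lambda>x. s * x) ` order"

lemma smallD: "s \<in> small \<Longrightarrow> s \<in> V" "s \<in> small \<Longrightarrow> s \<noteq> 0" "s \<in> small \<Longrightarrow> \<exists>v\<in>V. s = p * v"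
  using pV p0 V_closed(6) unfolding small_def by auto

lemma small_mult: "s \<in> small \<Longrightarrow> r \<in> V \<Longrightarrow> r \<noteq> 0 \<Longrightarrow> s * r \<in> small"
  unfolding small_def using V_closed(6) by (auto simp: mult.assoc intro!: imageI)

lemma ball_memI: "x \<in> order \<Longrightarrow> s * x \<in> ball s" unfolding ball_def by blast

lemma ball_mult_subset: "r \<in> V \<Longrightarrow> ball (s * r) \<subseteq> ball s"
  unfolding ball_def using order_smult by (auto simp: mult.assoc intro!: imageI)

lemma not_one_small: "s \<in> small \<Longrightarrow> v \<in> V \<Longrightarrow> s * v \<noteq> 1"
proof
  assume s: "s \<in> small" "v \<in> V" "s * v = 1"
  then obtain w where w: "w \<in> V" "s = p * w" using smallD(3) by blast
  then have "p * (w * v) = 1" using s(3) by (simp add: mult.assoc)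
  then have "inverse p = w * v" by (rule inverse_unique)
  then show False using ip V_closed(6) w(1) s(2) by simp
qed

lemma ball_coord:
  assumes "s \<in> small" "x \<in> ball s" "i < n"
  obtains v where "v \<in> V" "coord x i = s * v"
proof -
  obtain y where y: "y \<in> order" "x = s * y" using assms(2) unfolding ball_def by blast
  show thesis
    using that[OF order_coord[OF y(1) assms(3)]] coord_smult[OF V_F[OF smallD(1)[OF assms(1)]] order_E[OF y(1)] assms(3)] y(2)
    by simp
qed

lemma ball_right_mult: "x \<in> ball s \<Longrightarrow> y \<in> order \<Longrightarrow> x * y \<in> ball s"
  unfolding ball_def using order_mult by (auto simp: mult.assoc intro!: imageI)

lemma not_unit_ball:
  assumes "s \<in> small" "x \<in> ball s"
  shows "1 + x \<noteq> 0"
proof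
  assume "1 + x = 0"
  then have x: "x = - 1" by (simp add: add_eq_0_iff)
  have n: "0 < n" by (rule dimension_pos)
  have "x * e 0 \<in> ball s" using ball_right_mult[OF assms(2) e_order[OF n]] .
  then obtain v where v: "v \<in> V" "coord (x * e 0) 0 = s * v" using ball_coord[OF assms(1) _ n] by blast
  have "coord (x * e 0) 0 = - 1"
    unfolding x using coord_smult[OF F_closed(3)[OF F_closed(2)] e_E[OF n] n] coord_e[OF n n] by simp
  then have "s * (- v) = 1" using v(2) by simp
  then show False using not_one_small[OF assms(1) V_closed(3)[OF v(1)]] by simp
qed

text \<open>In place of a geometric series, \<open>?d\<close> is written as \<open>y * d\<close>
  with \<open>d\<close> primitive. Coordinate \<open>i\<close> of \<open>?d + x * ?d = - x\<close>
  then reads \<open>y * (1 - s * v) = s * w\<close>; as \<open>1 - s * v\<close> is a unit of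
  \<open>V\<close>, \<open>y\<close> is a multiple of \<open>s\<close>.\<close>

lemma ball_inverse:
  assumes "s \<in> small" "x \<in> ball s"
  shows "inverse (1 + x) - 1 \<in> ball s"
proof (cases "inverse (1 + x) - 1 = 0")
  case True
  then show ?thesis using ball_memI[of 0 s] order_diff[OF e_order[OF dimension_pos] e_order[OF dimension_pos]] by simp
next
  case False
  let ?d = "inverse (1 + x) - 1"
  obtain b where b: "b \<in> order" "x = s * b" using assms(2) unfolding ball_def by blast
  have sV: "s \<in> V" by (rule smallD(1)[OF assms(1)])
  have xE: "x \<in> E" using b order_E V_E[OF sV] E_closed(6) by simp
  have dE: "?d \<in> E" using xE E_closed by simp
  obtain y d i where y: "y \<in> F" "y \<noteq> 0" "d \<in> order" "i < n" "coord d i = 1" "?d = y * d"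
    using primitive_multiple[OF dE False] .
  have "(1 + x) * (?d + 1) = 1" using not_unit_ball[OF assms] by simp
  then have "?d + x * ?d = - x" by (simp add: algebra_simps add_eq_0_iff)
  moreover have "x * ?d = y * (x * d)" unfolding y(6) using F_central[OF y(1) xE] by (simp add: mult.assoc[symmetric])
  ultimately have eq: "y * (d - (- x * d)) = - x" using y(6) by (simp add: algebra_simps)
  have mxE: "- x * d \<in> ball s"
    using ball_memI[OF order_smult[OF V_closed(3)[OF V_closed(2)] order_mult[OF b(1) y(3)]], of s] b(2)
    by (simp add: mult.assoc)
  obtain v where v: "v \<in> V" "coord (- x * d) i = s * v" using ball_coord[OF assms(1) mxE y(4)] .
  have "- x \<in> ball s"
    using ball_memI[OF order_smult[OF V_closed(3)[OF V_closed(2)] b(1)], of s] b(2) by simp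
  then obtain w where w: "w \<in> V" "coord (- x) i = s * w" using ball_coord[OF assms(1) _ y(4)] by blast
  have E2: "d \<in> E" "- x * d \<in> E" using order_E[OF y(3)] E_closed(6)[OF E_closed(3)[OF xE]] by auto
  have "y * (1 - s * v) = s * w"
    using coord_smult[OF y(1) E_closed(4)[OF E2] y(4)] coord_diff[OF E2 y(4)] y(5) v(2) w(2) eq by simp
  obtain v0 where v0: "v0 \<in> V" "s = p * v0" using smallD(3)[OF assms(1)] by blast
  define u where "u = 1 + p * (- (v0 * v))"
  have u: "u \<noteq> 0" "inverse u \<in> V"
    unfolding u_def by (rule one_plus_unit[OF V_closed(3)[OF V_closed(6)[OF v0(1) v(1)]]])+
  have "y * u = s * w" using \<open>y * (1 - s * v) = s * w\<close> v0(2) unfolding u_def by (simp add: mult.assoc)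
  then have "y * u * inverse u = s * w * inverse u" by simp
  then have "y = s * (w * inverse u)" using u(1) by (simp add: mult.assoc)
  then have "?d = s * ((w * inverse u) * d)" using y(6) by (simp add: mult.assoc)
  then show ?thesis using ball_memI order_smult[OF V_closed(6)[OF w(1) u(2)] y(3)] by simp
qed

sublocale linear_topology E "ball ` small"
proof
  show "ball ` small \<noteq> {}" unfolding small_def using V_closed(2) by (auto intro!: exI[of _ 1] simp: ex_in_conv[symmetric])
next
  fix U assume "U \<in> ball ` small"
  then obtain s where s: "s \<in> small" "U = ball s" by blast
  have sV: "s \<in> V" by (rule smallD(1)[OF s(1)])
  have sc: "x * s = s * x" if "x \<in> E" for x using V_central[OF sV that] by simp
  show "U \<subseteq> E" unfolding s(2) ball_def using order_E V_E[OF sV] E_closed(6) by auto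
  show "0 \<in> U" unfolding s(2) using ball_memI[of 0 s] order_diff[OF e_order[OF dimension_pos] e_order[OF dimension_pos]] by simp
  show "x - y \<in> U" if "x \<in> U" "y \<in> U" for x y
    using that order_diff unfolding s(2) ball_def by (auto simp: right_diff_distrib[symmetric])
  show "x * y \<in> U" if xy: "x \<in> U" "y \<in> U" for x y
  proof -
    obtain a b where ab: "a \<in> order" "b \<in> order" "x = s * a" "y = s * b" using xy unfolding s(2) ball_def by blast
    have "x * y = s * ((a * s) * b)" using ab by (simp add: mult.assoc)
    also have "\<dots> = s * (s * (a * b))" using sc[OF order_E[OF ab(1)]] by (simp add: mult.assoc)
    finally show ?thesis unfolding s(2) using ball_memI[OF order_smult[OF sV order_mult[OF ab(1,2)]]] by simp
  qed
  show "1 + x \<noteq> 0 \<and> inverse (1 + x) - 1 \<in> U" if "x \<in> U" for x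
    using not_unit_ball[OF s(1)] ball_inverse[OF s(1)] that unfolding s(2) by blast
  show "\<exists>W\<in>ball ` small. W \<subseteq> U \<and> W \<subseteq> U'" if "U' \<in> ball ` small" for U'
  proof -
    obtain t where t: "t \<in> small" "U' = ball t" using \<open>U' \<in> ball ` small\<close> by blast
    have "ball (s * t) \<subseteq> U" unfolding s(2) by (rule ball_mult_subset[OF smallD(1)[OF t(1)]])
    moreover have "s * t = t * s" by (rule comm_F[OF V_F[OF sV] V_F[OF smallD(1)[OF t(1)]]])
    then have "ball (s * t) \<subseteq> U'" unfolding t(2) using ball_mult_subset[OF sV] by simp
    ultimately show ?thesis using small_mult[OF s(1) smallD(1,2)[OF t(1)]] by blast
  qed
  fix a assume a: "a \<in> E"
  \<comment> \<open>\<open>r\<close> clears the denominators of \<open>a\<close>. Since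
    \<open>s\<close> and \<open>r\<close> are central in \<open>E\<close>, the radius
    \<open>s * r\<close> serves multiplication by \<open>a\<close> on either side.\<close>
  obtain r where r: "r \<in> V" "r \<noteq> 0" "r * a \<in> order" using order_absorbs[OF a] .
  have sr: "s * r \<in> small" by (rule small_mult[OF s(1) r(1,2)])
  show "\<exists>W\<in>ball ` small. \<forall>x\<in>W. a * x \<in> U"
  proof (intro bexI[of _ "ball (s * r)"] ballI)
    fix x assume "x \<in> ball (s * r)"
    then obtain y where y: "y \<in> order" "x = s * r * y" unfolding ball_def by blast
    have "a * x = (a * s) * r * y" using y by (simp add: mult.assoc)
    also have "\<dots> = s * (a * r) * y" using sc[OF a] by (simp add: mult.assoc)
    also have "\<dots> = s * ((r * a) * y)" using V_central[OF r(1) a] by (simp add: mult.assoc)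
    finally show "a * x \<in> U" unfolding s(2) using ball_memI[OF order_mult[OF r(3) y(1)]] by simp
  qed (use sr in simp)
  show "\<exists>W\<in>ball ` small. \<forall>x\<in>W. x * a \<in> U"
  proof (intro bexI[of _ "ball (s * r)"] ballI)
    fix x assume "x \<in> ball (s * r)"
    then obtain y where y: "y \<in> order" "x = s * r * y" unfolding ball_def by blast
    have "x * a = s * ((r * y) * a)" using y by (simp add: mult.assoc)
    also have "\<dots> = s * (y * (r * a))" using V_central[OF r(1) order_E[OF y(1)]] by (simp add: mult.assoc)
    finally show "x * a \<in> U" unfolding s(2) using ball_memI[OF order_mult[OF y(1) r(3)]] by simp
  qed (use sr in simp)
next
  fix a assume a: "a \<in> E" "a \<noteq> 0"
  have "\<exists>i<n. coord a i \<noteq> 0"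
  proof (rule ccontr)
    assume "\<not> ?thesis"
    then have "a = 0" using coord_sum[OF a(1)] by simp
    then show False using a(2) by simp
  qed
  then obtain i where i: "i < n" "coord a i \<noteq> 0" by blast
  show "\<exists>U\<in>ball ` small. a \<notin> U"
  proof (cases "coord a i \<in> V")
    case True
    \<comment> \<open>Coordinates of a ball are multiples of its radius, and a nonzero element of
      \<open>V\<close> is no multiple of its own product with the non-unit \<open>p\<close>.\<close>
    have s: "p * coord a i \<in> small" unfolding small_def using True i(2) by blast
    moreover have "a \<notin> ball (p * coord a i)"
    proof
      assume "a \<in> ball (p * coord a i)"
      then obtain v where v: "v \<in> V" "coord a i = p * coord a i * v" using ball_coord[OF s _ i(1)] by blast
      have "p * coord a i = coord a i * p" by (rule comm_F[OF V_F[OF pV] V_F[OF True]])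
      then have "coord a i * (p * v) = coord a i * 1" using v(2) by (simp add: mult.assoc)
      then have "p * v = 1" using i(2) by simp
      then show False using ip v(1) inverse_unique by metis
    qed
    ultimately show ?thesis by blast
  next
    case False
    have s: "p * 1 \<in> small" unfolding small_def using V_closed(2) by (intro imageI) auto
    moreover have "a \<notin> ball (p * 1)"
    proof
      assume "a \<in> ball (p * 1)"
      then obtain v where "v \<in> V" "coord a i = p * 1 * v" using ball_coord[OF s _ i(1)] by blast
      then show False using False V_closed(6)[OF pV] by simp
    qed
    ultimately show ?thesis by blast
  qed
qed

text \<open>Some power of \<open>c\<close> has prime order \<open>q\<close> and is still near 1;
  \<open>q\<close> is not the characteristic by \<open>power_CHAR_one_imp_one\<close>. Its powers up
  to exponent \<open>q - 1\<close> sum to 0, so \<open>q\<close> lies in \<open>ball s\<close> and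
  is divisible by \<open>s\<close> in \<open>V\<close>, contrary to \<open>no_prime\<close>.\<close>

lemma small_torsion_free:
  assumes s: "s \<in> small"
    and no_prime: "\<And>q v. Factorial_Ring.prime q \<Longrightarrow> of_nat q \<noteq> (0::'a) \<Longrightarrow> v \<in> V \<Longrightarrow> of_nat q \<noteq> s * v"
    and c: "near (ball s) c" "k > 0" "c ^ k = 1"
  shows "c = 1"
proof (rule ccontr)
  assume "c \<noteq> 1"
  have U: "ball s \<in> ball ` small" using s by blast
  define k0 where "k0 = (LEAST k. k > 0 \<and> c ^ k = 1)"
  have k0: "k0 > 0" "c ^ k0 = 1"
    using LeastI[of "\<lambda>k. k > 0 \<and> c ^ k = 1" k] c unfolding k0_def by auto
  have "k0 \<noteq> 1" using k0 \<open>c \<noteq> 1\<close> by auto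
  then obtain q where q: "Factorial_Ring.prime q" "q dvd k0" using prime_factor_nat by blast
  then obtain m where m: "k0 = q * m" by blast
  have "0 < m" "m < k0" using m k0(1) prime_gt_1_nat[OF q(1)] by auto
  then have z1: "c ^ m \<noteq> 1"
    using not_less_Least[of m "\<lambda>k. k > 0 \<and> c ^ k = 1"] unfolding k0_def by auto
  have zq: "(c ^ m) ^ q = 1" using k0(2) m by (simp add: power_mult[symmetric] mult.commute)
  have q0: "of_nat q \<noteq> (0::'a)"
  proof
    assume "of_nat q = (0::'a)"
    then have "CHAR('a) dvd q" by (simp add: of_nat_eq_0_iff_char_dvd)
    moreover have "CHAR('a) \<noteq> 1" using of_nat_CHAR[where 'a='a] by (metis of_nat_1 zero_neq_one)
    ultimately have "CHAR('a) = q" using q(1) by (metis prime_nat_iff)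
    then show False using power_CHAR_one_imp_one[of "c ^ m"] q(1) zq z1 by simp
  qed
  have "0 = (\<Sum>i<q. (c ^ m) ^ i)" using sum_powers_eq_zero[OF zq z1] by simp
  also have "\<dots> = of_nat q + (\<Sum>i<q. (c ^ m) ^ i - 1)" by (simp add: sum_subtractf)
  finally have "of_nat q = 0 - (\<Sum>i<q. (c ^ m) ^ i - 1)" by (simp add: eq_neg_iff_add_eq_0)
  moreover have "(\<Sum>i<q. (c ^ m) ^ i - 1) \<in> ball s"
    using near_power[OF U near_power[OF U c(1)]] by (intro nbhd_sum[OF U]) (auto simp: near_def)
  ultimately have "of_nat q \<in> ball s" using nbhd_diff[OF U nbhd_0[OF U]] by simp
  then have "of_nat q * e 0 \<in> ball s" by (rule ball_right_mult[OF _ e_order[OF dimension_pos]])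
  then obtain v where v: "v \<in> V" "coord (of_nat q * e 0) 0 = s * v"
    using ball_coord[OF s _ dimension_pos] by blast
  have "coord (of_nat q * e 0) 0 = of_nat q"
    using coord_smult[OF F_closed(8) e_E[OF dimension_pos] dimension_pos] coord_e[OF dimension_pos dimension_pos] by simp
  then show False using no_prime[OF q(1) q0 v(1)] v(2) by simp
qed

lemma algebraic_linear_topology:
  assumes s: "s \<in> small"
    and no_prime: "\<And>q v. Factorial_Ring.prime q \<Longrightarrow> of_nat q \<noteq> (0::'a) \<Longrightarrow> v \<in> V \<Longrightarrow> of_nat q \<noteq> s * v"
  shows "algebraic_linear_topology E (ball ` small) F"
proof
  fix x U assume x: "x \<in> E" "U \<in> ball ` small"
  then obtain t where t: "t \<in> small" "U = ball t" by blast
  obtain r where r: "r \<in> V" "r \<noteq> 0" "r * x \<in> order" using order_absorbs[OF x(1)] .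
  have "t * r * x \<in> U" unfolding t(2) using ball_memI[OF r(3), of t] by (simp add: mult.assoc)
  then show "\<exists>f\<in>F. f \<noteq> 0 \<and> f * x \<in> U"
    using V_F[OF smallD(1)[OF small_mult[OF t(1) r(1,2)]]] smallD(2)[OF small_mult[OF t(1) r(1,2)]] by blast
next
  show "\<exists>U\<in>ball ` small. \<forall>c k. near U c \<longrightarrow> k > 0 \<longrightarrow> c ^ k = 1 \<longrightarrow> c = 1"
    using small_torsion_free[OF s no_prime] s by blast
next
  fix g assume "g \<in> E"
  then show "\<exists>d f. (\<forall>j. f j \<in> F) \<and> (\<exists>j\<le>d::nat. f j \<noteq> 0) \<and> (\<Sum>j\<le>d. f j * g ^ j) = 0"
    by (rule algebraic)
next
  fix x y and k :: nat
  assume "x \<in> E" "y \<in> E" "x \<noteq> 0" "y \<noteq> 0" "k > 0" "commutator x y ^ k \<in> F"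
  then show "\<exists>m>0. commutator x y ^ m = 1"
    unfolding commutator_def by (rule commutator_power_torsion)
qed (use F_E F_central in auto)

end

section \<open>Existence of the topology\<close>

lemma vspan_mono_scalars: "x \<in> vspan V B \<Longrightarrow> V \<subseteq> V' \<Longrightarrow> x \<in> vspan V' B"
  by (induction rule: vspan.induct) (auto intro: vspan.intros)

lemma finite_vspan:
  assumes "is_subring V" "finite V" "finite B"
  shows "finite (vspan V B)"
  using assms(3)
proof (induction B rule: finite_induct)
  case empty
  have "x = 0" if "x \<in> vspan V {}" for x
    using that by (induction rule: vspan.induct) auto
  then have "vspan V {} \<subseteq> {0}" by blast
  then show ?case by (rule finite_subset) simp
next
  case (insert b B)
  have "vspan V (insert b B) \<subseteq> (\<lambda>(v, y). v * b + y) ` (V \<times> vspan V B)"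
  proof
    fix x assume "x \<in> vspan V (insert b B)"
    then obtain v y where "v \<in> V" "y \<in> vspan V B" "x = v * b + y" using vspan_insert[OF assms(1)] by metis
    then show "x \<in> (\<lambda>(v, y). v * b + y) ` (V \<times> vspan V B)" by force
  qed
  then show ?case by (rule finite_subset) (use insert.IH assms(2) in simp)
qed

definition subring_gen :: "'a::ring_1 \<Rightarrow> 'a set" where
  "subring_gen x = \<Inter> {S. is_subring S \<and> x \<in> S}"

lemma is_subring_gen: "is_subring (subring_gen x)"
  unfolding subring_gen_def is_subring_def by auto

lemma subring_gen_mem: "x \<in> subring_gen x"
  by (auto simp: subring_gen_def)

lemma subring_gen_minimal: "is_subring S \<Longrightarrow> x \<in> S \<Longrightarrow> subring_gen x \<subseteq> S"
  by (auto simp: subring_gen_def)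

lemma is_subring_range_of_int: "is_subring (range (of_int :: int \<Rightarrow> 'a::ring_1))"
  unfolding is_subring_def
proof (intro conjI ballI)
  show "1 \<in> range (of_int :: int \<Rightarrow> 'a)" by (rule range_eqI[of _ _ 1]) simp
  fix x y :: 'a assume "x \<in> range of_int" "y \<in> range of_int"
  then obtain i j where "x = of_int i" "y = of_int j" by blast
  then show "x - y \<in> range of_int" "x * y \<in> range of_int"
    by (auto intro: range_eqI[of _ _ "i - j"] range_eqI[of _ _ "i * j"])
qed

lemma range_of_int_subset:
  fixes S :: "'a::ring_1 set"
  assumes "is_subring S" shows "range of_int \<subseteq> S"
proof
  fix x :: 'a assume "x \<in> range of_int"
  then obtain i where x: "x = of_int i" by blast
  show "x \<in> S"
    unfolding x by (cases i) (auto intro: is_subringD[OF assms])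
qed

lemma finite_range_of_int:
  assumes "CHAR('a::ring_1) > 0"
  shows "finite (range (of_int :: int \<Rightarrow> 'a))"
proof (rule finite_subset)
  let ?c = "int CHAR('a)"
  show "range (of_int :: int \<Rightarrow> 'a) \<subseteq> of_int ` {0..<?c}"
  proof
    fix x :: 'a assume "x \<in> range of_int"
    then obtain i where x: "x = of_int i" by blast
    have "of_int i = (of_int (?c * (i div ?c) + i mod ?c) :: 'a)" by simp
    also have "\<dots> = of_int ?c * of_int (i div ?c) + of_int (i mod ?c)"
      by (simp only: of_int_add of_int_mult)
    also have "of_int ?c = (0::'a)" by simp
    finally have "x = of_int (i mod ?c)" using x by simp
    moreover have "i mod ?c \<in> {0..<?c}" using assms by simp
    ultimately show "x \<in> of_int ` {0..<?c}" by blast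
  qed
qed simp

lemma power_span_mult:
  fixes y :: "'a::division_ring"
  assumes "\<And>v. v \<in> V \<Longrightarrow> v * y = y * v" "is_subring V"
    and "a \<in> vspan V ((\<lambda>i. y ^ i) ` {..m})" "b \<in> vspan V ((\<lambda>i. y ^ i) ` {..k})"
  shows "a * b \<in> vspan V ((\<lambda>i. y ^ i) ` {..m + k})"
  using assms(3)
proof (induction rule: vspan.induct)
  case (step a v c)
  then obtain i where i: "i \<le> m" "c = y ^ i" by auto
  have "y ^ i * b \<in> vspan V ((\<lambda>i. y ^ i) ` {..m + k})"
    using assms(4)
  proof (induction rule: vspan.induct)
    case (step b w c)
    then obtain j where j: "j \<le> k" "c = y ^ j" by auto
    have "y ^ i * w = w * y ^ i" using assms(1)[OF step.hyps(2)] by (metis commute_power)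
    then have "y ^ i * (w * c) = w * y ^ (i + j)"
      unfolding j(2) power_add by (simp add: mult.assoc[symmetric])
    moreover have "w * y ^ (i + j) \<in> vspan V ((\<lambda>i. y ^ i) ` {..m + k})"
      using i(1) j(1) step.hyps(2) by (intro vspan_base) auto
    ultimately show ?case using step.IH by (simp add: distrib_left vspan_add)
  qed (simp add: vspan.zero)
  then have "v * (c * b) \<in> vspan V ((\<lambda>i. y ^ i) ` {..m + k})"
    unfolding i(2) by (rule vspan_smult[OF assms(2) step.hyps(2)])
  then show ?case using step.IH by (simp add: distrib_right mult.assoc vspan_add)
qed (simp add: vspan.zero)

text \<open>If \<open>y = inverse x\<close> is an integral polynomial of degree at most
  \<open>m\<close> in \<open>x\<close>, multiplication by \<open>y ^ m\<close> turns this into an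
  equation of integrality for \<open>y\<close>.\<close>

lemma integral_if_inverse_mem:
  fixes x :: "'a::division_ring"
  assumes "x \<noteq> 0" "inverse x \<in> subring_gen x"
  obtains m where "inverse x ^ Suc m \<in> vspan (range of_int) ((\<lambda>i. inverse x ^ i) ` {..m})"
proof -
  define y where "y = inverse x"
  let ?P = "range (of_int :: int \<Rightarrow> 'a)"
  define W where "W m = vspan ?P ((\<lambda>i. y ^ i) ` {..m})" for m :: nat
  have comm: "v * y = y * v" if "v \<in> ?P" for v
    using that by (auto simp: mult_of_int_commute)
  have W_mult: "a * b \<in> W (m + k)" if "a \<in> W m" "b \<in> W k" for a b m k
    using that unfolding W_def by (intro power_span_mult comm is_subring_range_of_int)
  have yW: "y ^ i \<in> W m" if "i \<le> m" for i m
    unfolding W_def using vspan_base[OF is_subringD(2)[OF is_subring_range_of_int], of "y ^ i"] that by simp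
  \<comment> \<open>The degree of \<open>z\<close> as a polynomial in \<open>x\<close> is measured
    by the power of \<open>y\<close> that carries it into polynomials in \<open>y\<close>.
    \<open>T\<close> is a subring containing \<open>x\<close>, hence also \<open>y\<close>.\<close>
  define T where "T = {z. (\<exists>m. z * y ^ m \<in> W m) \<and> z * y = y * z}"
  have "is_subring T"
    unfolding is_subring_def
  proof (intro conjI ballI)
    show "1 \<in> T" unfolding T_def using yW[of 0 0] by (auto intro: exI[of _ 0])
    fix a b assume "a \<in> T" "b \<in> T"
    then obtain m k where mk: "a * y ^ m \<in> W m" "b * y ^ k \<in> W k" and ab: "a * y = y * a" "b * y = y * b"
      unfolding T_def by blast
    have "(a * y ^ m) * y ^ k \<in> W (m + k)" "(b * y ^ k) * y ^ m \<in> W (k + m)"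
      using W_mult mk yW by blast+
    then have "a * y ^ (m + k) \<in> W (m + k)" "b * y ^ (m + k) \<in> W (m + k)"
      by (simp_all add: mult.assoc power_add[symmetric] add.commute)
    then have "(a - b) * y ^ (m + k) \<in> W (m + k)"
      unfolding W_def left_diff_distrib
      using vspan_add vspan_uminus[OF is_subring_range_of_int] by (metis diff_conv_add_uminus)
    then show "a - b \<in> T" unfolding T_def using ab by (auto simp: algebra_simps)
    have "b * y ^ m = y ^ m * b" using ab(2) by (metis commute_power)
    then have "(a * b) * y ^ (m + k) = (a * y ^ m) * (b * y ^ k)"
      by (simp add: power_add mult.assoc) (simp add: mult.assoc[symmetric])
    moreover have "a * b * y = y * (a * b)" using ab by (metis mult.assoc)
    ultimately show "a * b \<in> T" unfolding T_def using W_mult[OF mk] by (auto intro: exI[of _ "m + k"])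
  qed
  moreover have "x * y ^ 1 \<in> W 1" "x * y = y * x" using yW[of 0 1] assms(1) by (simp_all add: y_def)
  then have "x \<in> T" unfolding T_def by blast
  ultimately have "y \<in> T" using subring_gen_minimal[of T x] assms(2) unfolding y_def by blast
  then obtain m where "y ^ Suc m \<in> W m" unfolding T_def by auto
  then show thesis using that unfolding W_def y_def by blast
qed

text \<open>Integrality of \<open>y = inverse x\<close> makes the span of its powers up to
  \<open>m\<close> a ring, finite over the finite ring \<open>R\<close>. Finite subrings are closed
  under inverses, so it contains \<open>x\<close> as well.\<close>

lemma (in subfield_set) finite_subring_adjoin:
  assumes "is_subring R" "finite R" "R \<subseteq> F" "x \<in> F" "x \<noteq> 0" "inverse x \<in> subring_gen x"
  obtains R' where "is_subring R'" "finite R'" "R' \<subseteq> F" "R \<subseteq> R'" "x \<in> R'"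
proof -
  define y where "y = inverse x"
  have yF: "y \<in> F" unfolding y_def using F_closed(9)[OF assms(4)] .
  obtain m where m: "y ^ Suc m \<in> vspan (range of_int) ((\<lambda>i. y ^ i) ` {..m})"
    using integral_if_inverse_mem[OF assms(5,6)] unfolding y_def .
  define R' where "R' = vspan R ((\<lambda>i. y ^ i) ` {..m})"
  have comm: "v * y ^ i = y ^ i * v" if "v \<in> R" for v i
    using comm_F[OF subsetD[OF assms(3) that] F_closed(7)[OF yF]] .
  have one: "1 \<in> R" by (rule is_subringD(2)[OF assms(1)])
  have base: "y ^ i \<in> R'" if "i \<le> m" for i
    using vspan_base[OF one, of "y ^ i"] that unfolding R'_def by simp
  have Suc_m: "y ^ Suc m \<in> R'"
    unfolding R'_def by (rule vspan_mono_scalars[OF m range_of_int_subset[OF assms(1)]])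
  have ymult: "y * a \<in> R'" if "a \<in> R'" for a
    using that unfolding R'_def
  proof (induction rule: vspan.induct)
    case (step a v b)
    then obtain i where i: "i \<le> m" "b = y ^ i" by auto
    have "y ^ Suc i \<in> R'" using i(1) Suc_m base[of "Suc i"] by (cases "i = m") auto
    then have "v * y ^ Suc i \<in> R'" unfolding R'_def by (rule vspan_smult[OF assms(1) step.hyps(2)])
    also have "v * y ^ Suc i = y * (v * b)" using comm[OF step.hyps(2), of 1] by (simp add: i(2) mult.assoc[symmetric])
    finally show ?case using step.IH unfolding R'_def by (simp add: distrib_left vspan_add)
  qed (simp add: vspan.zero)
  have pow: "y ^ k \<in> R'" for k
    by (induction k) (use base[of 0] ymult in auto)
  have mult: "a * b \<in> R'" if "a \<in> R'" "b \<in> R'" for a b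
    using that unfolding R'_def
    by (rule vspan_mult[OF assms(1), rotated 2]) (use pow comm in \<open>auto simp: R'_def power_add[symmetric]\<close>)
  have "a - b \<in> R'" if "a \<in> R'" "b \<in> R'" for a b
    using vspan_add[of a R _ "- b"] vspan_uminus[OF assms(1), of b] that unfolding R'_def by simp
  then have sub: "is_subring R'" unfolding is_subring_def using mult base[of 0] by simp
  moreover have fin: "finite R'" unfolding R'_def by (rule finite_vspan[OF assms(1,2)]) simp
  moreover have "R' \<subseteq> F"
    unfolding R'_def using vspan_minimal[OF subring_F assms(3)] F_closed(7)[OF yF] by blast
  moreover have "R \<subseteq> R'"
  proof
    fix v assume v: "v \<in> R"
    have "v * y ^ 0 \<in> R'"
      using vspan_smult[OF assms(1) v base[of 0, unfolded R'_def]] unfolding R'_def by simp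
    then show "v \<in> R'" by simp
  qed
  moreover have "inverse y \<in> R'" using finite_inverse_mem[OF fin sub] pow[of 1] by simp
  then have "x \<in> R'" by (simp add: y_def)
  ultimately show thesis using that by blast
qed

lemma (in subfield_set) finite_subset_finite_subring:
  assumes "CHAR('a) > 0" "\<And>x. x \<in> F \<Longrightarrow> x \<noteq> 0 \<Longrightarrow> inverse x \<in> subring_gen x" "finite T" "T \<subseteq> F"
  shows "\<exists>R. is_subring R \<and> finite R \<and> R \<subseteq> F \<and> T \<subseteq> R"
  using assms(3,4)
proof (induction T rule: finite_induct)
  case empty
  show ?case
    using is_subring_range_of_int finite_range_of_int[OF assms(1)] range_of_int_subset[OF subring_F] by blast
next
  case (insert x T)
  then obtain R where R: "is_subring R" "finite R" "R \<subseteq> F" "T \<subseteq> R" by blast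
  show ?case
  proof (cases "x = 0")
    case True
    then show ?thesis using R is_subringD(1)[OF R(1)] by blast
  next
    case False
    have "x \<in> F" using insert.prems by simp
    then obtain R' where "is_subring R'" "finite R'" "R' \<subseteq> F" "R \<subseteq> R'" "x \<in> R'"
      using finite_subring_adjoin[OF R(1-3) _ False assms(2)[OF _ False]] by metis
    then show ?thesis using R(4) by blast
  qed
qed

lemma (in fd_division) commutative_if_locally_finite:
  assumes "CHAR('a) > 0" "\<And>x. x \<in> F \<Longrightarrow> x \<noteq> 0 \<Longrightarrow> inverse x \<in> subring_gen x" "g \<in> E" "d \<in> E"
  shows "g * d = d * g"
proof -
  \<comment> \<open>The structure constants make the span of the basis over \<open>R\<close> closed
    under multiplication; the coordinates of 1, \<open>g\<close> and \<open>d\<close> put these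
    elements into it.\<close>
  define T where "T = (\<lambda>(i, j, k). coord (e i * e j) k) ` ({..<n} \<times> {..<n} \<times> {..<n}) \<union>
    coord 1 ` {..<n} \<union> coord g ` {..<n} \<union> coord d ` {..<n}"
  have eE: "e i * e j \<in> E" if "i < n" "j < n" for i j
    using E_closed(6) e_E that by simp
  have "finite T" unfolding T_def by simp
  moreover have "T \<subseteq> F"
    unfolding T_def using coord_F[OF eE] coord_F[OF E_closed(2)] coord_F[OF assms(3)] coord_F[OF assms(4)] by auto
  ultimately obtain R where R: "is_subring R" "finite R" "R \<subseteq> F" "T \<subseteq> R"
    using finite_subset_finite_subring[OF assms(1,2)] by metis
  define S where "S = vspan R (e ` {..<n})"
  have memS: "x \<in> S" if "x \<in> E" "\<And>i. i < n \<Longrightarrow> coord x i \<in> T" for x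
  proof -
    have "(\<Sum>i<n. coord x i * e i) \<in> S"
      unfolding S_def using that(2) R(4) by (intro vspan_sum vspan_base) auto
    then show ?thesis using coord_sum[OF that(1)] by simp
  qed
  have mult: "a * b \<in> S" if "a \<in> S" "b \<in> S" for a b
    using that unfolding S_def
  proof (rule vspan_mult[OF R(1), rotated 2])
    fix b c assume "b \<in> e ` {..<n}" "c \<in> e ` {..<n}"
    then obtain i j where ij: "i < n" "j < n" "b = e i" "c = e j" by auto
    have "e i * e j \<in> S"
      by (rule memS[OF eE[OF ij(1,2)]]) (use ij(1,2) in \<open>force simp: T_def\<close>)
    then show "b * c \<in> vspan R (e ` {..<n})" using ij unfolding S_def by simp
  next
    fix v b assume "v \<in> R" "b \<in> e ` {..<n}"
    then show "v * b = b * v" using F_central R(3) e_E by auto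
  qed
  have "a - b \<in> S" if "a \<in> S" "b \<in> S" for a b
    using vspan_add[of a R _ "- b"] vspan_uminus[OF R(1), of b] that unfolding S_def by simp
  moreover have "1 \<in> S" "g \<in> S" "d \<in> S"
    by (rule memS[OF E_closed(2)] memS[OF assms(3)] memS[OF assms(4)]; simp add: T_def)+
  ultimately have "is_subring S" unfolding is_subring_def using mult by simp
  moreover have "finite S" unfolding S_def by (rule finite_vspan[OF R(1,2)]) simp
  ultimately show ?thesis using finite_subring_commutative \<open>g \<in> S\<close> \<open>d \<in> S\<close> by blast
qed

section \<open>Choice of the basis, the valuation ring and the radius\<close>

lemma (in fd_division) scale_basis:
  assumes "r \<in> F" "r \<noteq> 0"
  shows "fd_division E F (\<lambda>i. r * e i) n"
proof unfold_locales
  show "F \<subseteq> E" by (rule F_E)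
  show "f * x = x * f" if "f \<in> F" "x \<in> E" for f x by (rule F_central[OF that])
  show "r * e i \<in> E" if "i < n" for i
    using E_closed(6)[OF subsetD[OF F_E assms(1)] e_E[OF that]] .
next
  fix x assume x: "x \<in> E"
  have "x = (\<Sum>i<n. (coord x i * inverse r) * (r * e i))"
    using coord_sum[OF x] assms(2) by (simp add: mult.assoc) (simp add: mult.assoc[symmetric])
  then show "\<exists>c. (\<forall>i. c i \<in> F) \<and> x = (\<Sum>i<n. c i * (r * e i))"
    using F_closed(6)[OF coord_F[OF x] F_closed(9)[OF assms(1)]]
    by (intro exI[of _ "\<lambda>i. coord x i * inverse r"]) simp
next
  fix c i assume c: "\<And>i. i < n \<Longrightarrow> c i \<in> F" "(\<Sum>i<n. c i * (r * e i)) = 0" "i < n"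
  have "c i * r = 0"
    using independent[of "\<lambda>i. c i * r" i] c F_closed(6)[OF _ assms(1)] by (simp add: mult.assoc)
  then show "c i = 0" using assms(2) by simp
qed

text \<open>Scaling the basis by \<open>r\<close> multiplies all structure constants by
  \<open>r\<close>, so a common denominator brings them into \<open>V\<close>.\<close>

lemma (in fd_division) valued_division_exists:
  assumes "maximal_subring F V p"
  obtains e' where "valued_division E F e' n V p"
proof -
  interpret maximal_subring F V p by (rule assms)
  have eE: "e i * e j \<in> E" if "i < n" "j < n" for i j
    using E_closed(6) e_E that by simp
  define T where "T = (\<lambda>(i, j, k). coord (e i * e j) k) ` ({..<n} \<times> {..<n} \<times> {..<n})"
  have "finite T" "T \<subseteq> F" unfolding T_def using coord_F[OF eE] by auto
  then obtain r where r: "r \<in> V" "r \<noteq> 0" "\<forall>a\<in>T. r * a \<in> V" using common_denominator by blast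
  have rF: "r \<in> F" by (rule V_F[OF r(1)])
  define e' where "e' i = r * e i" for i
  interpret B: fd_division E F e' n unfolding e'_def by (rule scale_basis[OF rF r(2)])
  have "valued_division E F e' n V p"
  proof unfold_locales
    fix i j k assume ijk: "i < n" "j < n" "k < n"
    have ec: "e i * r = r * e i" using F_central[OF rF e_E[OF ijk(1)]] by simp
    have "B.coord (e' i * e' j) k = r * coord (e i * e j) k"
    proof (rule B.coord_eqI[OF _ _ ijk(3)])
      show "r * coord (e i * e j) l \<in> F" for l
        by (rule F_closed(6)[OF rF coord_F[OF eE[OF ijk(1,2)]]])
      have "e' i * e' j = r * (r * (e i * e j))"
        unfolding e'_def using ec by (simp add: mult.assoc) (simp add: mult.assoc[symmetric])
      also have "\<dots> = r * (r * (\<Sum>l<n. coord (e i * e j) l * e l))"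
        using coord_sum[OF eE[OF ijk(1,2)]] by simp
      also have "\<dots> = (\<Sum>l<n. r * coord (e i * e j) l * e' l)"
        unfolding e'_def sum_distrib_left
        using comm_F[OF rF coord_F[OF eE[OF ijk(1,2)]]] by (simp add: mult.assoc) (simp add: mult.assoc[symmetric])
      finally show "e' i * e' j = \<dots>" .
    qed
    moreover have "coord (e i * e j) k \<in> T" unfolding T_def using ijk by force
    ultimately show "B.coord (e' i * e' j) k \<in> V" using r(3) by simp
  qed
  then show thesis by (rule that)
qed

lemma (in fd_division) topology_or_commutative:
  "(\<exists>\<U>. algebraic_linear_topology E \<U> F) \<or> (\<forall>g\<in>E. \<forall>d\<in>E. g * d = d * g)"
proof (cases "CHAR('a) = 0")
  case True
  have two_eq: "(2::'a) = of_int 2" by simp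
  have ni: "2 * of_int k \<noteq> (1::'a)" for k
  proof
    assume "2 * of_int k = (1::'a)"
    then have "of_int (2 * k - 1) = (0::'a)" by simp
    then have "2 * k - 1 = 0" using True by (simp only: of_int_eq_0_iff_char_dvd) simp
    then show False by presburger
  qed
  have "inverse 2 \<notin> range (of_int :: int \<Rightarrow> 'a)"
  proof
    assume "inverse 2 \<in> range (of_int :: int \<Rightarrow> 'a)"
    then obtain k where "inverse (2::'a) = of_int k" by blast
    moreover have "(2::'a) \<noteq> 0" using CHAR_eq0_iff[where 'a='a] True by (metis of_nat_numeral zero_less_numeral)
    ultimately show False using ni[of k] by (metis right_inverse)
  qed
  moreover have "(2::'a) \<in> range of_int" unfolding two_eq by blast
  ultimately obtain V where "maximal_subring F V 2"
    using maximal_subring_exists[OF is_subring_range_of_int range_of_int_subset[OF subring_F]] by metis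
  then obtain e' where "valued_division E F e' n V 2" using valued_division_exists by blast
  then interpret v: valued_division E F e' n V 2 .
  have no1: "2 * w \<noteq> 1" if "w \<in> V" for w using v.ip that inverse_unique by metis
  have "algebraic_linear_topology E (v.ball ` v.small) F"
  proof (rule v.algebraic_linear_topology)
    \<comment> \<open>The radius is 4 because the prime 2 is itself a multiple of 2 in
      \<open>V\<close>, but not of 4. An odd prime is no multiple of 4 either, since 2 would then be
      a unit.\<close>
    show "2 * 2 \<in> v.small" unfolding v.small_def using v.pV v.p0 by blast
    fix q :: nat and w assume q: "of_nat q \<noteq> (0::'a)" "w \<in> V" "Factorial_Ring.prime q"
    show "of_nat q \<noteq> 2 * 2 * w"
    proof
      assume eq: "of_nat q = 2 * 2 * w"
      show False
      proof (cases "q = 2")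
        case True
        then have "2 * (2 * w) = 2 * 1" using eq by (simp add: mult.assoc)
        then have "2 * w = 1" using v.p0 mult_left_cancel by blast
        then show False using no1[OF q(2)] by simp
      next
        case False
        then have "odd q" using q(3) primes_dvd_imp_eq two_is_prime_nat by blast
        then obtain k where k: "q = 2 * k + 1" by (rule oddE)
        have "2 * 2 * w = 2 * of_nat k + 1" unfolding eq[symmetric] k by simp
        then have "2 * (2 * w - of_nat k) = 1" by (simp only: right_diff_distrib mult.assoc[symmetric]) simp
        moreover have "2 * w - of_nat k \<in> V" using v.V_closed v.pV q(2) by simp
        ultimately show False using no1 by blast
      qed
    qed
  qed
  then show ?thesis by blast
next
  case False
  then have pos: "CHAR('a) > 0" by simp
  note prime = prime_CHAR_division_ring[OF pos]
  show ?thesis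
  proof (cases "\<forall>x\<in>F. x \<noteq> 0 \<longrightarrow> inverse x \<in> subring_gen x")
    case True
    then show ?thesis using commutative_if_locally_finite[OF pos] by blast
  next
    case False
    then obtain x where x: "x \<in> F" "x \<noteq> 0" "inverse x \<notin> subring_gen x" by blast
    obtain V where "maximal_subring F V x"
      using maximal_subring_exists[OF is_subring_gen subring_gen_minimal[OF subring_F x(1)] subring_gen_mem x(3)] .
    then obtain e' where "valued_division E F e' n V x" using valued_division_exists by blast
    then interpret v: valued_division E F e' n V x .
    have "algebraic_linear_topology E (v.ball ` v.small) F"
    proof (rule v.algebraic_linear_topology)
      show "x * 1 \<in> v.small" unfolding v.small_def using v.V_closed(2) by (intro imageI) auto
      fix q :: nat and w assume q: "of_nat q \<noteq> (0::'a)" "w \<in> V"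
      show "of_nat q \<noteq> x * 1 * w"
      proof
        assume eq: "of_nat q = x * 1 * w"
        \<comment> \<open>A prime other than the characteristic is invertible in the prime field by
          Bezout, so it is a multiple of \<open>x\<close> only if \<open>x\<close> is a unit of
          \<open>V\<close>.\<close>
        have "\<not> CHAR('a) dvd q" using q(1) by (simp add: of_nat_eq_0_iff_char_dvd)
        then have "coprime q CHAR('a)" using prime by (metis coprime_commute prime_imp_coprime)
        moreover have "CHAR('a) \<noteq> 1" using prime by auto
        ultimately obtain a b where "q * a = CHAR('a) * b + 1"
          using coprime_bezout_strong[of q "CHAR('a)"] by blast
        then have "of_nat q * of_nat a = of_nat (CHAR('a)) * of_nat b + (1::'a)"
          by (metis of_nat_1 of_nat_add of_nat_mult)
        then have "x * (w * of_nat a) = 1" using eq by (simp add: mult.assoc)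
        then have "inverse x = w * of_nat a" by (rule inverse_unique)
        then show False using v.ip v.V_closed(6)[OF q(2) v.V_closed(8)] by simp
      qed
    qed
    then show ?thesis by blast
  qed
qed

section \<open>Weakly locally finite division rings\<close>

text \<open>A spanning set of least cardinality is independent: a relation with a nonzero
  coefficient at \<open>k\<close> would allow \<open>k\<close> to be dropped.\<close>

lemma basis_exists:
  fixes E F :: "'a::division_ring set"
  assumes "division_subring E" "subfield_set F" "F \<subseteq> E" "\<And>f x. f \<in> F \<Longrightarrow> x \<in> E \<Longrightarrow> f * x = x * f"
    and "finite B" "B \<subseteq> E" "\<And>x. x \<in> E \<Longrightarrow> \<exists>c. (\<forall>b\<in>B. c b \<in> F) \<and> x = (\<Sum>b\<in>B. c b * b)"
  obtains e n where "fd_division E F e n"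
proof -
  interpret E: division_subring E by fact
  interpret F: subfield_set F by fact
  define spans where "spans B \<longleftrightarrow> finite B \<and> B \<subseteq> E \<and>
    (\<forall>x\<in>E. \<exists>c. (\<forall>b\<in>B. c b \<in> F) \<and> x = (\<Sum>b\<in>B. c b * b))" for B
  have "spans B" unfolding spans_def using assms(5-7) by blast
  then obtain B where B: "spans B" "\<And>C. spans C \<Longrightarrow> card B \<le> card C"
    using ex_has_least_nat[of spans B card] by blast
  have fin: "finite B" and BE: "B \<subseteq> E" using B(1) unfolding spans_def by auto
  have indep: "c k = 0" if c: "\<And>b. b \<in> B \<Longrightarrow> c b \<in> F" "(\<Sum>b\<in>B. c b * b) = 0" and k: "k \<in> B" for c k
  proof (rule ccontr)
    assume ck: "c k \<noteq> 0"
    have "spans (B - {k})"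
      unfolding spans_def
    proof (intro conjI ballI)
      fix x assume "x \<in> E"
      then obtain d where d: "\<And>b. b \<in> B \<Longrightarrow> d b \<in> F" "x = (\<Sum>b\<in>B. d b * b)"
        using B(1) unfolding spans_def by blast
      define r where "r = d k * inverse (c k)"
      have rF: "r \<in> F" unfolding r_def using d(1)[OF k] c(1)[OF k] F.F_closed(6,9) by blast
      have "(\<Sum>b\<in>B. (d b - r * c b) * b) = x - r * (\<Sum>b\<in>B. c b * b)"
        unfolding d(2) by (simp add: left_diff_distrib sum_subtractf sum_distrib_left mult.assoc)
      then have "x = (\<Sum>b\<in>B. (d b - r * c b) * b)" using c(2) by simp
      also have "\<dots> = (\<Sum>b\<in>B - {k}. (d b - r * c b) * b)"
        using fin k ck by (simp add: sum.remove[of B k] r_def mult.assoc)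
      finally have "x = (\<Sum>b\<in>B - {k}. (d b - r * c b) * b)" .
      moreover have "d b - r * c b \<in> F" if "b \<in> B - {k}" for b
        using that F.F_closed(4)[OF d(1) F.F_closed(6)[OF rF c(1)]] by blast
      ultimately show "\<exists>c. (\<forall>b\<in>B - {k}. c b \<in> F) \<and> x = (\<Sum>b\<in>B - {k}. c b * b)"
        by (intro exI[of _ "\<lambda>b. d b - r * c b"]) simp
    qed (use fin BE in auto)
    then have "card B \<le> card (B - {k})" by (rule B(2))
    moreover have "card (B - {k}) < card B" using fin k by (rule card_Diff1_less)
    ultimately show False by simp
  qed
  define n where "n = card B"
  obtain e where e: "bij_betw e {..<n} B"
    using ex_bij_betw_nat_finite[OF fin] unfolding n_def atLeast0LessThan by blast
  define idx where "idx = inv_into {..<n} e"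
  have idx: "idx (e i) = i" if "i < n" for i
    unfolding idx_def using bij_betw_inv_into_left[OF e] that by simp
  have eB: "e i \<in> B" if "i < n" for i using bij_betwE[OF e] that by simp
  have sum_e: "(\<Sum>i<n. c (e i) * e i) = (\<Sum>b\<in>B. c b * b)" for c
    by (rule sum.reindex_bij_betw[OF e])
  have "fd_division E F e n"
  proof unfold_locales
    show "F \<subseteq> E" by fact
    show "f * x = x * f" if "f \<in> F" "x \<in> E" for f x using assms(4) that .
    show "e i \<in> E" if "i < n" for i using eB[OF that] BE by blast
  next
    fix x assume "x \<in> E"
    then obtain d where d: "\<And>b. b \<in> B \<Longrightarrow> d b \<in> F" "x = (\<Sum>b\<in>B. d b * b)"
      using B(1) unfolding spans_def by blast
    \<comment> \<open>The default 0 beyond \<open>n\<close> is there because \<open>spanning\<close>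
      asks for coefficients in \<open>F\<close> at every index.\<close>
    define c where "c i = (if i < n then d (e i) else 0)" for i
    have "(\<Sum>i<n. c i * e i) = (\<Sum>i<n. d (e i) * e i)" unfolding c_def by (rule sum.cong) auto
    then have "x = (\<Sum>i<n. c i * e i)" using sum_e d(2) by simp
    moreover have "c i \<in> F" for i unfolding c_def using d(1) eB F.F_closed(1) by simp
    ultimately show "\<exists>c. (\<forall>i. c i \<in> F) \<and> x = (\<Sum>i<n. c i * e i)" by blast
  next
    fix c i assume c: "\<And>i. i < n \<Longrightarrow> c i \<in> F" "(\<Sum>i<n. c i * e i) = 0" "i < n"
    have "(\<Sum>b\<in>B. c (idx b) * b) = (\<Sum>i<n. c (idx (e i)) * e i)" by (rule sum_e[symmetric])
    also have "\<dots> = 0" using c(2) idx by simp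
    finally have s: "(\<Sum>b\<in>B. c (idx b) * b) = 0" .
    have "c (idx b) \<in> F" if "b \<in> B" for b
      using c(1)[of "idx b"] bij_betwE[OF bij_betw_inv_into[OF e]] that unfolding idx_def by simp
    then have "c (idx (e i)) = 0" using indep[of "\<lambda>b. c (idx b)" "e i"] s eB[OF c(3)] by blast
    then show "c i = 0" using idx[OF c(3)] by simp
  qed
  then show thesis by (rule that)
qed

lemma division_subring_gen: "division_subring (divsubring_gen S)"
  unfolding division_subring_def is_subring_def
  using divsubring_gen.add[OF _ divsubring_gen.neg] 
  by (auto intro: divsubring_gen.intros simp del: add_uminus_conv_diff simp: diff_conv_add_uminus)

lemma subfield_center_of:
  assumes "division_subring E"
  shows "subfield_set (center_of E)"
proof -
  interpret division_subring E by fact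
  have eq: "center_of E = commutant E E" by (auto simp: center_of_def commutant_def)
  show ?thesis
  proof
    show "is_subring (center_of E)" unfolding eq by (rule is_subring_commutant[OF subring_E])
    show "inverse x \<in> center_of E" if "x \<in> center_of E" for x
    proof (cases "x = 0")
      case False
      have "inverse x * y = y * inverse x" if "y \<in> E" for y
      proof -
        have "x * y = y * x" using \<open>x \<in> center_of E\<close> that unfolding center_of_def by blast
        then have "inverse x * (x * y) * inverse x = inverse x * (y * x) * inverse x" by simp
        moreover have "inverse x * (x * y) * inverse x = y * inverse x"
          using False by (simp add: mult.assoc[symmetric])
        moreover have "inverse x * (y * x) * inverse x = inverse x * y"
          using False by (simp add: mult.assoc)
        ultimately show ?thesis by simp
      qed
      then show ?thesis using that inverse_E unfolding center_of_def by blast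
    qed (use that in simp)
    show "x * y = y * x" if "x \<in> center_of E" "y \<in> center_of E" for x y
      using that unfolding center_of_def by blast
  qed
qed

lemma topology_or_commuting:
  fixes g d :: "'a::division_ring"
  assumes "weakly_locally_finite TYPE('a)"
  shows "(\<exists>\<U>. algebraic_linear_topology (divsubring_gen {g, d}) \<U> (center_of (divsubring_gen {g, d})))
    \<or> g * d = d * g"
proof -
  let ?E = "divsubring_gen {g, d}"
  have "fin_dim_over_center ?E" using assms unfolding weakly_locally_finite_def by simp
  then obtain B where B: "finite B" "B \<subseteq> ?E"
    "\<And>x. x \<in> ?E \<Longrightarrow> \<exists>c. (\<forall>b\<in>B. c b \<in> center_of ?E) \<and> x = (\<Sum>b\<in>B. c b * b)"
    unfolding fin_dim_over_center_def by blast
  obtain e n where "fd_division ?E (center_of ?E) e n"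
    using basis_exists[OF division_subring_gen subfield_center_of[OF division_subring_gen] _ _ B]
    unfolding center_of_def by blast
  then interpret fd_division ?E "center_of ?E" e n .
  have "g \<in> ?E" "d \<in> ?E" by (auto intro: divsubring_gen.gen)
  then show ?thesis using topology_or_commutative by blast
qed

definition central :: "'a::division_ring \<Rightarrow> bool" where
  "central x \<longleftrightarrow> (\<forall>y. x * y = y * x)"

lemma central_if_commutators_central:
  fixes H :: "'a::division_ring set"
  assumes "weakly_locally_finite TYPE('a)" "almost_subnormal_set H" "g \<in> H"
    and "\<And>t. t \<in> H \<Longrightarrow> central (t * g * inverse t * inverse g)"
  shows "central g"
  unfolding central_def
proof
  fix d
  let ?E = "divsubring_gen {g, d}"
  show "g * d = d * g"
  proof (rule ccontr)
    \<comment> \<open>The subring and its topology depend on \<open>d\<close>, while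
      \<open>H\<close> stays fixed. The assumption rules out the alternative without a
      topology.\<close>
    assume "g * d \<noteq> d * g"
    then obtain \<U> where "algebraic_linear_topology ?E \<U> (center_of ?E)"
      using topology_or_commuting[OF assms(1)] by blast
    then interpret algebraic_linear_topology ?E \<U> "center_of ?E" .
    have "d * g = g * d"
      by (rule central_if_commutators_commute[OF assms(2,3)])
         (use assms(4) in \<open>auto intro: divsubring_gen.gen simp: commutator_def central_def\<close>)
    then show False using \<open>g * d \<noteq> d * g\<close> by simp
  qed
qed

lemma central_if_radical_over_center:
  fixes H :: "'a::division_ring set"
  assumes "weakly_locally_finite TYPE('a)" "almost_subnormal_set H" "g \<in> H"
    and "\<And>t. t \<in> H \<Longrightarrow> \<exists>k>0. central (t ^ k)"
  shows "central g"
  unfolding central_def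
proof
  fix d
  let ?E = "divsubring_gen {g, d}"
  show "g * d = d * g"
  proof (rule ccontr)
    assume "g * d \<noteq> d * g"
    then obtain \<U> where "algebraic_linear_topology ?E \<U> (center_of ?E)"
      using topology_or_commuting[OF assms(1)] by blast
    then interpret algebraic_linear_topology ?E \<U> "center_of ?E" .
    have "\<exists>k>0. t ^ k \<in> center_of ?E" if "t \<in> H" "t \<in> ?E" for t
      using assms(4)[OF that(1)] E_closed(7)[OF that(2)] unfolding center_of_def central_def by blast
    then have "d * g = g * d"
      by (intro central_if_radical[OF assms(2,3)]) (auto intro: divsubring_gen.gen)
    then show False using \<open>g * d \<noteq> d * g\<close> by simp
  qed
qed


section \<open>From group-theoretic notions to subsets of the division ring\<close>

lemma units_group_simps [simp]:
  "carrier units_group = - {0}" "x \<otimes>\<^bsub>units_group\<^esub> y = x * y" "\<one>\<^bsub>units_group\<^esub> = 1"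
  by (simp_all add: units_group_def)

lemma group_units_group: "group (units_group :: 'a::division_ring monoid)"
  by (rule groupI) (auto simp: mult.assoc intro!: bexI[of _ "inverse x" for x])

lemma inv_units_group: "x \<noteq> 0 \<Longrightarrow> inv\<^bsub>units_group\<^esub> x = inverse (x :: 'a::division_ring)"
  by (rule group.inv_equality[OF group_units_group]) auto

lemma pow_units_group: "x [^]\<^bsub>units_group\<^esub> (k::nat) = (x :: 'a::division_ring) ^ k"
  by (induction k) (simp_all add: power_commutes)

lemma mult_subgroup_units:
  assumes "subgroup H units_group"
  shows "mult_subgroup H"
  unfolding mult_subgroup_def
proof (intro conjI ballI)
  show H0: "0 \<notin> H" using subgroup.subset[OF assms] by auto
  show "1 \<in> H" using subgroup.one_closed[OF assms] by simp
  fix x assume x: "x \<in> H"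
  then have "x \<noteq> 0" using H0 by blast
  then show "inverse x \<in> H" using subgroup.m_inv_closed[OF assms x] inv_units_group by metis
  show "x * y \<in> H" if "y \<in> H" for y using subgroup.m_closed[OF assms x that] by simp
qed

lemma inv_units_subgroup:
  assumes "subgroup K units_group" "x \<in> K"
  shows "inv\<^bsub>units_group\<lparr>carrier := K\<rparr>\<^esub> x = inverse x"
  using group.m_inv_consistent[OF group_units_group assms] inv_units_group[of x]
    mult_subgroupD(1)[OF mult_subgroup_units[OF assms(1)] assms(2)] by simp

lemma normal_in_units:
  assumes "subgroup K units_group" "H \<lhd> units_group\<lparr>carrier := K\<rparr>"
  shows "normal_in H K"
  unfolding normal_in_def
proof (intro ballI)
  fix k h assume "k \<in> K" "h \<in> H"
  then show "k * h * inverse k \<in> H"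
    using normal.inv_op_closed2[OF assms(2), of k h] inv_units_subgroup[OF assms(1)] by simp
qed

lemma finite_index_in_units:
  assumes "subgroup H units_group" "subgroup K units_group"
    "finite (rcosets\<^bsub>units_group\<lparr>carrier := K\<rparr>\<^esub> H)"
  shows "finite_index_in H K"
  unfolding finite_index_in_def
proof (intro exI conjI ballI impI)
  let ?\<kappa> = "\<lambda>t. H #>\<^bsub>units_group\<lparr>carrier := K\<rparr>\<^esub> t"
  have "?\<kappa> ` K \<subseteq> rcosets\<^bsub>units_group\<lparr>carrier := K\<rparr>\<^esub> H" by (auto simp: RCOSETS_def)
  then show "finite (?\<kappa> ` K)" using assms(3) by (rule finite_subset)
  fix s t assume st: "s \<in> K" "t \<in> K" "?\<kappa> s = ?\<kappa> t"
  have "1 * s \<in> ?\<kappa> s" using subgroup.one_closed[OF assms(1)] by (auto simp: r_coset_def)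
  then have "s \<in> ?\<kappa> t" using st(3) by simp
  then obtain h where h: "h \<in> H" "s = h * t" by (auto simp: r_coset_def)
  moreover have "t \<noteq> 0" using st(2) mult_subgroupD(1)[OF mult_subgroup_units[OF assms(2)]] by blast
  ultimately show "s * inverse t \<in> H" by (simp add: mult.assoc)
qed

lemma almost_subnormal_set_units:
  assumes "almost_subnormal units_group H (carrier units_group)"
  shows "almost_subnormal_set H"
proof -
  obtain r :: nat and Hs where r: "1 \<le> r" "Hs r = H" "Hs 1 = - {0}"
    and sub: "\<And>i. 1 \<le> i \<Longrightarrow> i \<le> r \<Longrightarrow> subgroup (Hs i) units_group"
    and step: "\<And>i. 1 < i \<Longrightarrow> i \<le> r \<Longrightarrow> Hs i \<subseteq> Hs (i - 1) \<and>
           (Hs i \<lhd> units_group\<lparr>carrier := Hs (i - 1)\<rparr> \<or>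
            finite (rcosets\<^bsub>units_group\<lparr>carrier := Hs (i - 1)\<rparr>\<^esub> (Hs i)))"
    using assms unfolding almost_subnormal_def units_group_simps by blast
  \<comment> \<open>The chain starts at index 1, hence the shift; its last term is reached at
    \<open>i = r - 1\<close>.\<close>
  have "almost_subnormal_set (Hs (Suc i))" if "Suc i \<le> r" for i
    using that
  proof (induction i)
    case 0
    then show ?case using r(3) almost_subnormal_set.top by simp
  next
    case (Suc i)
    have H: "subgroup (Hs (Suc (Suc i))) units_group" "subgroup (Hs (Suc i)) units_group"
      using sub Suc.prems by auto
    show ?case
      using step[of "Suc (Suc i)"] Suc normal_in_units[OF H(2)] finite_index_in_units[OF H]
      by (intro almost_subnormal_set.step[OF _ mult_subgroup_units[OF H(1)]]) auto
  qed
  from this[of "r - 1"] show ?thesis using r by simp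
qed

text \<open>A normal subgroup prolongs the chain by one step, so both the solvable subgroup
  \<open>N\<close> and the terms of its solvable series are themselves almost subnormal.\<close>

lemma almost_subnormal_set_normal:
  assumes "almost_subnormal_set K" "subgroup K units_group" "H \<lhd> units_group\<lparr>carrier := K\<rparr>"
  shows "subgroup H units_group" "almost_subnormal_set H"
proof -
  have s: "subgroup H (units_group\<lparr>carrier := K\<rparr>)" by (rule normal_imp_subgroup[OF assms(3)])
  show sub: "subgroup H units_group"
    by (rule group.incl_subgroup[OF group_units_group assms(2) s])
  show "almost_subnormal_set H"
    by (rule almost_subnormal_set.step[OF assms(1) mult_subgroup_units[OF sub]])
       (use subgroup.subset[OF s] normal_in_units[OF assms(2,3)] in auto)
qed

text \<open>Induction up the series from the trivial group: the commutators of \<open>H\<close> lie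
  in \<open>K\<close>, which is central by induction, and
  \<open>central_if_commutators_central\<close> passes this on to \<open>H\<close>.\<close>

lemma solvable_almost_subnormal_central:
  assumes "weakly_locally_finite TYPE('a::division_ring)"
    and "solvable_seq (units_group\<lparr>carrier := N\<rparr> :: 'a monoid) H"
    and "subgroup N units_group" "subgroup H units_group" "almost_subnormal_set H" "g \<in> H"
  shows "central g"
  using assms(2,4-6)
proof (induction arbitrary: g rule: solvable_seq.induct)
  case unity
  then show ?case by (simp add: central_def)
next
  case (extension K H)
  have K: "K \<lhd> units_group\<lparr>carrier := H\<rparr>" using extension.hyps(2) by simp
  note Ks = almost_subnormal_set_normal[OF extension.prems(2,1) K]
  have grp: "group (units_group\<lparr>carrier := H\<rparr>)"
    by (rule group.subgroup_imp_group[OF group_units_group extension.prems(1)])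
  have "derived (units_group\<lparr>carrier := H\<rparr>) H \<subseteq> K"
    using group.derived_minimal[OF grp K] extension.hyps(4) by simp
  then have "central (t * g * inverse t * inverse g)" if "t \<in> H" for t
  proof -
    have "t * g * inverse t * inverse g \<in> derived (units_group\<lparr>carrier := H\<rparr>) H"
      unfolding derived_def
      by (rule generate.incl) (use that extension.prems in \<open>force simp: inv_units_subgroup\<close>)
    then have "t * g * inverse t * inverse g \<in> K" using \<open>derived _ H \<subseteq> K\<close> by blast
    then show ?thesis by (rule extension.IH[OF Ks])
  qed
  then show ?case
    using central_if_commutators_central[OF assms(1) extension.prems(2,3)] by blast
qed

theorem theorem4p5:
  fixes G :: "('a::division_ring) set"
  assumes "weakly_locally_finite TYPE('a)"
    and "subgroup G units_group"
    and "almost_subnormal units_group G (carrier units_group)"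
    and "soluble_by_periodic units_group G"
  shows "G \<subseteq> center_of UNIV - {0}"
proof
  fix g assume g: "g \<in> G"
  have G: "almost_subnormal_set G" by (rule almost_subnormal_set_units[OF assms(3)])
  obtain N where N: "N \<lhd> units_group\<lparr>carrier := G\<rparr>" "solvable (units_group\<lparr>carrier := N\<rparr>)"
    "\<And>g. g \<in> G \<Longrightarrow> \<exists>n::nat. n \<ge> 1 \<and> g [^]\<^bsub>units_group\<^esub> n \<in> N"
    using assms(4) unfolding soluble_by_periodic_def by blast
  note Ns = almost_subnormal_set_normal[OF G assms(2) N(1)]
  have "central h" if "h \<in> N" for h
    using solvable_almost_subnormal_central[OF assms(1) _ Ns(1) Ns that] N(2) unfolding solvable_def by simp
  then have "\<exists>k>0. central (t ^ k)" if "t \<in> G" for t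
    using N(3)[OF that] unfolding pow_units_group by (auto simp: Suc_le_eq)
  then have "central g" by (rule central_if_radical_over_center[OF assms(1) G g])
  moreover have "g \<noteq> 0" using g mult_subgroupD(1)[OF mult_subgroup_units[OF assms(2)]] by blast
  ultimately show "g \<in> center_of UNIV - {0}" by (simp add: center_of_def central_def)
qed

end
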